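(* For every $N\in\mathbb N$ there is a constant $C_N$ such that for all real $x\ge 2$: $$\Big|S^{+}(x,s)-\frac{x/2}{e^{\gamma}\log(x^{1/s})}F(s)\Big|\le C_N\frac{x}{(s-1)(\log x)^2}\qquad(1<s\le N),$$ and $$\Big|S^{-}(x,s)-\frac{x/2}{e^{\gamma}\log(x^{1/s})}f(s)\Big|\le C_N\frac{x}{(\log x)^2}\qquad(1\le s\le N).$$
   Context: $\lambda(n)=(-1)^{\Omega(n)}$ is the Liouville function, $\Omega(n)$ the number of prime factors of $n$ counted with multiplicity. For $s\ge1$ and $x\ge2$, $$S^{\pm}(x,s)=\#\{n\in\mathbb N:\ n\le x,\ \lambda(n)=\mp1,\ \text{every prime } p\mid n \text{ satisfies } p\ge x^{1/s}\}.$$ $\gamma$ is Euler's constant. The functions $F,f:(0,\infty)\to\mathbb R$ are the continuous functions defined by $F(s)=2e^{\gamma}/s$ for $0<s\le3$, $f(s)=0$ for $0<s\le2$, and $(sF(s))'=f(s-1)$, $(sf(s))'=F(s-1)$ for $s>2$. *)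

theory Defs
  imports "HOL-Analysis.Analysis" "HOL-Computational_Algebra.Primes"
begin

definition liouville :: "nat \<Rightarrow> int" where
  "liouville n = (-1) ^ size (prime_factorization n)"

definition S_plus :: "real \<Rightarrow> real \<Rightarrow> nat" where
  "S_plus x s = card {n::nat. 1 \<le> n \<and> real n \<le> x \<and> liouville n = -1 \<and>
      (\<forall>p. prime p \<and> p dvd n \<longrightarrow> real p \<ge> x powr (1/s))}"

definition S_minus :: "real \<Rightarrow> real \<Rightarrow> nat" where
  "S_minus x s = card {n::nat. 1 \<le> n \<and> real n \<le> x \<and> liouville n = 1 \<and>
      (\<forall>p. prime p \<and> p dvd n \<longrightarrow> real p \<ge> x powr (1/s))}"

definition sieve_pair :: "(real \<Rightarrow> real) \<Rightarrow> (real \<Rightarrow> real) \<Rightarrow> bool" where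
  "sieve_pair F f \<longleftrightarrow>
     continuous_on {0<..} F \<and> continuous_on {0<..} f \<and>
     (\<forall>s. 0 < s \<and> s \<le> 3 \<longrightarrow> F s = 2 * exp euler_mascheroni / s) \<and>
     (\<forall>s. 0 < s \<and> s \<le> 2 \<longrightarrow> f s = 0) \<and>
     (\<forall>s. s > 2 \<longrightarrow> ((\<lambda>t. t * F t) has_real_derivative f (s - 1)) (at s)) \<and>
     (\<forall>s. s > 2 \<longrightarrow> ((\<lambda>t. t * f t) has_real_derivative F (s - 1)) (at s))"

definition sieve_F :: "real \<Rightarrow> real" where
  "sieve_F s = (THE y. \<exists>F f. sieve_pair F f \<and> F s = y)"

definition sieve_f :: "real \<Rightarrow> real" where
  "sieve_f s = (THE y. \<exists>F f. sieve_pair F f \<and> f s = y)"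

end

theory Submission
  imports Defs "HOL-Probability.Probability" "HOL-Complex_Analysis.Complex_Analysis"
    "HOL-Number_Theory.Prime_Powers" "HOL-Real_Asymp.Real_Asymp"
begin

text \<open>
  Put \<open>T\<^sub>\<epsilon>(x, z) = \<Sum> \<epsilon>\<^bsup>\<Omega>(n)\<^esup>\<close> over the \<open>n \<le> x\<close> free of prime factors below \<open>z\<close>, for \<open>\<epsilon> = \<plusminus>1\<close>; the
  two counting functions are half the difference and half the sum of \<open>T\<^sub>1\<close> and \<open>T\<^sub>-\<^sub>1\<close>. Splitting off
  the smallest prime factor gives Buchstab's identity
  \<open>T\<^sub>\<epsilon>(x, z) = T\<^sub>\<epsilon>(x, w) + \<epsilon> \<Sum>\<^bsub>z \<le> p < w\<^esub> T\<^sub>\<epsilon>(x/p, p)\<close>, so by induction on the unit interval containing \<open>s\<close>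
  one obtains \<open>T\<^sub>\<epsilon>(x, x\<^bsup>1/s\<^esup>) = \<epsilon> Q\<^sub>\<epsilon>(s) x / log x + O(x / log\<^sup>2 x + x\<^bsup>1/s\<^esup> / log x)\<close>, where \<open>Q\<^sub>\<epsilon> = 1\<close> on \<open>(0, 2]\<close>
  and \<open>Q\<^sub>\<epsilon>'(s) = \<epsilon> Q\<^sub>\<epsilon>(s - 1) / (s - 1)\<close> beyond; then \<open>F, f = e\<^sup>\<gamma> (Q\<^sub>1 \<plusminus> Q\<^sub>-\<^sub>1) / s\<close>. The second error term is
  the number of primes below the sifting level; it is what produces the factor \<open>1 / (s - 1)\<close>.

  The case \<open>s \<le> 2\<close> is the prime number theorem with error \<open>O(x / log\<^sup>2 x)\<close>. For it one needs no contour
  to the left of \<open>Re s = 1\<close>: the second derivative of \<open>- \<zeta>'/\<zeta> - \<zeta>\<close>, whose Dirichlet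
  coefficients are \<open>(\<Lambda>(n) - 1) log\<^sup>2 n\<close>, is \<open>O(\<bar>t\<bar>\<^bsup>1/2\<^esup>)\<close> up to the line \<open>Re s = 1\<close>, so that the sum of these
  coefficients with weights \<open>1 - n/x\<close> is \<open>O(x)\<close>. Differencing removes the weights at the cost of one
  logarithm, and partial summation removes \<open>log\<^sup>2 n\<close>.
\<close>

subsection \<open>Dirichlet series on the half-plane Re s > 1\<close>

text \<open>The number of derivatives is dictated by a count of logarithms: the sums of
  \<open>(\<Lambda>(n) - 1) log^2 n\<close> come out as \<open>O(x log x)\<close>, and on the
  primes, where the weight is \<open>log^3\<close>, dividing it out leaves
  \<open>x / log^2 x\<close>, the error claimed. The growth exponent 1/2 has to be below 1 to stay
  integrable against the kernel \<open>1 / (s (s + 1))\<close>. Since the lower bound for zeta on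
  the line loses a high power of the upper bound, zeta is first bounded by \<open>|t|^\<eta>\<close>
  with \<open>\<eta>\<close> at free disposal.

  The induction needs an error term that reproduces itself when \<open>x\<close> becomes
  \<open>x/p\<close> and the level becomes \<open>p\<close>. The term \<open>x^(1/s) / log x\<close>
  then has size \<open>p / log x\<close>, and over the primes below \<open>sqrt x\<close> this sums
  to \<open>O(x / log^2 x)\<close>. It is at most \<open>s x / ((s - 1) log^2 x)\<close>, which is
  admissible for \<open>S^+\<close>; for \<open>S^-\<close> with \<open>s \<le> 2\<close> it would
  be too large, and there one counts directly, since only \<open>n = 1\<close> and
  \<open>n = x\<close> can occur. Sums of \<open>1/p\<close> are only taken between powers of
  \<open>x\<close>, so Mertens' constant never enters; \<open>e^\<gamma>\<close> is a normalisation
  of \<open>F\<close> and \<open>f\<close> that cancels.\<close>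

text \<open>
  Writing \<open>n\<^bsup>-s\<^esup>\<close> as \<open>exp (- s ln n)\<close> makes every term entire; since \<open>ln 0 = 0\<close> the term at \<open>n = 0\<close> is
  \<open>a 0\<close>, so coefficient sequences have to vanish there.
\<close>
definition dseries :: "(nat \<Rightarrow> real) \<Rightarrow> complex \<Rightarrow> complex" where
  "dseries a s = (\<Sum>n. of_real (a n) * exp (- s * of_real (ln (real n))))"

text \<open>Absolute convergence on all of \<open>Re s > 1\<close>; real exponents suffice by
  \<open>norm_dseries_term\<close>. Demanding it for every \<open>\<sigma> > 1\<close> rather than
  at one point makes the property stable under multiplication of the coefficients by
  \<open>ln n\<close>.\<close>

definition dconv :: "(nat \<Rightarrow> real) \<Rightarrow> bool" where
  "dconv a \<longleftrightarrow> (\<forall>\<sigma>>1. summable (\<lambda>n. \<bar>a n\<bar> * exp (- \<sigma> * ln (real n))))"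

lemma norm_dseries_term:
  "norm (of_real (a n) * exp (- s * of_real (ln (real n)))) = \<bar>a n\<bar> * exp (- Re s * ln (real n))"
  by (simp add: norm_mult)

lemma dconv_summable_norm:
  assumes "dconv a" "Re s > 1"
  shows "summable (\<lambda>n. norm (of_real (a n) * exp (- s * of_real (ln (real n)))))"
  unfolding norm_dseries_term using assms unfolding dconv_def by blast

lemma dseries_sums:
  assumes "dconv a" "Re s > 1"
  shows "(\<lambda>n. of_real (a n) * exp (- s * of_real (ln (real n)))) sums dseries a s"
  unfolding dseries_def by (rule summable_sums[OF summable_norm_cancel[OF dconv_summable_norm[OF assms]]])

lemma dconv_mono:
  assumes "dconv b" "\<And>n. \<bar>a n\<bar> \<le> \<bar>b n\<bar>"
  shows "dconv a"
  unfolding dconv_def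
proof (intro allI impI)
  fix \<sigma> :: real assume "\<sigma> > 1"
  then have "summable (\<lambda>n. \<bar>b n\<bar> * exp (- \<sigma> * ln (real n)))" using assms(1) by (auto simp: dconv_def)
  then show "summable (\<lambda>n. \<bar>a n\<bar> * exp (- \<sigma> * ln (real n)))"
    by (rule summable_comparison_test') (auto intro!: mult_right_mono assms(2) simp: abs_mult)
qed

lemma dconv_add: "dconv a \<Longrightarrow> dconv b \<Longrightarrow> dconv (\<lambda>n. a n + b n)"
  unfolding dconv_def
proof (intro allI impI)
  fix \<sigma> :: real assume *: "\<forall>\<sigma>>1. summable (\<lambda>n. \<bar>a n\<bar> * exp (- \<sigma> * ln (real n)))"
    "\<forall>\<sigma>>1. summable (\<lambda>n. \<bar>b n\<bar> * exp (- \<sigma> * ln (real n)))" "\<sigma> > 1"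
  then have "summable (\<lambda>n. \<bar>a n\<bar> * exp (- \<sigma> * ln (real n)) + \<bar>b n\<bar> * exp (- \<sigma> * ln (real n)))"
    by (intro summable_add) auto
  then show "summable (\<lambda>n. \<bar>a n + b n\<bar> * exp (- \<sigma> * ln (real n)))"
    by (rule summable_comparison_test') (auto intro!: mult_right_mono simp: abs_mult simp flip: distrib_right)
qed

lemma dconv_uminus: "dconv a \<Longrightarrow> dconv (\<lambda>n. - a n)"
  by (simp add: dconv_def)

lemma dseries_uminus: "dconv a \<Longrightarrow> Re s > 1 \<Longrightarrow> dseries (\<lambda>n. - a n) s = - dseries a s"
  using sums_minus[OF dseries_sums[of a s]] dseries_sums[OF dconv_uminus[of a], of s] sums_unique2
  by fastforce

lemma dseries_diff:
  assumes "dconv a" "dconv b" "Re s > 1"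
  shows "dseries (\<lambda>n. a n - b n) s = dseries a s - dseries b s"
proof -
  have "dconv (\<lambda>n. a n - b n)" using dconv_add[OF assms(1) dconv_uminus[OF assms(2)]] by simp
  from dseries_sums[OF this assms(3)] sums_diff[OF dseries_sums[OF assms(1,3)] dseries_sums[OF assms(2,3)]]
  show ?thesis by (simp add: sums_unique2 ring_distribs)
qed

text \<open>Half of the margin \<open>\<sigma> - 1\<close> pays for the logarithm, through
  \<open>d * ln n \<le> exp (d * ln n)\<close>. The sign is the one produced by termwise
  differentiation.\<close>

lemma dconv_ln:
  assumes "dconv a" shows "dconv (\<lambda>n. - a n * ln (real n))"
  unfolding dconv_def
proof (intro allI impI)
  fix \<sigma> :: real assume s: "\<sigma> > 1"
  define d where "d = (\<sigma> - 1) / 2"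
  have d: "d > 0" "\<sigma> - d > 1" using s by (auto simp: d_def field_simps)
  have "summable (\<lambda>n. (1/d) * (\<bar>a n\<bar> * exp (- (\<sigma> - d) * ln (real n))))"
    using assms d unfolding dconv_def by (intro summable_mult) blast
  moreover have "norm (\<bar>- a n * ln (real n)\<bar> * exp (- \<sigma> * ln (real n))) \<le> (1/d) * (\<bar>a n\<bar> * exp (- (\<sigma> - d) * ln (real n)))" for n
  proof -
    have l: "ln (real n) \<ge> 0" by (cases "n = 0") auto
    have "d * ln (real n) \<le> exp (d * ln (real n))" using exp_ge_add_one_self[of "d * ln (real n)"] by linarith
    then have "ln (real n) \<le> (1/d) * exp (d * ln (real n))" using d by (simp add: field_simps)
    then have "\<bar>a n\<bar> * exp (- \<sigma> * ln (real n)) * ln (real n) \<le> \<bar>a n\<bar> * exp (- \<sigma> * ln (real n)) * ((1/d) * exp (d * ln (real n)))"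
      by (intro mult_left_mono) auto
    also have "\<dots> = (1/d) * (\<bar>a n\<bar> * exp (- (\<sigma> - d) * ln (real n)))"
      by (simp add: field_simps flip: exp_add)
    finally show ?thesis using l by (simp add: abs_mult mult_ac)
  qed
  ultimately show "summable (\<lambda>n. \<bar>- a n * ln (real n)\<bar> * exp (- \<sigma> * ln (real n)))"
    by (rule summable_comparison_test'[where N=0])
qed

lemma open_Re_gt: "open {s. Re s > c}"
  by (rule open_halfspace_Re_gt)

lemma dseries_deriv:
  assumes "dconv a" "Re s > 1"
  shows "(dseries a has_field_derivative dseries (\<lambda>n. - a n * ln (real n)) s) (at s)"
proof -
  let ?S = "{s. Re s > 1}"
  let ?f = "\<lambda>n s. of_real (a n) * exp (- s * of_real (ln (real n)))"
  let ?f' = "\<lambda>n s. of_real (- a n * ln (real n)) * exp (- s * of_real (ln (real n)))"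
  have "\<exists>g g'. \<forall>x \<in> ?S. ((\<lambda>n. ?f n x) sums g x) \<and> ((\<lambda>n. ?f' n x) sums g' x) \<and> (g has_field_derivative g' x) (at x)"
  proof (rule series_and_derivative_comparison_complex[OF open_Re_gt])
    show "(?f n has_field_derivative ?f' n x) (at x)" for n x
      by (auto intro!: derivative_eq_intros simp: mult_ac)
    fix x :: complex assume "x \<in> ?S"
    then have x: "Re x > 1" by simp
    \<comment> \<open>On the ball of radius \<open>d\<close> every term is dominated by its size at
      the real point \<open>Re x - d > 1\<close>, which gives the locally uniform convergence behind
      termwise differentiation.\<close>
    define d where "d = (Re x - 1) / 2"
    define h where "h = (\<lambda>n. of_real (\<bar>a n\<bar> * exp (- (Re x - d) * ln (real n))) :: complex)"
    have d: "d > 0" "Re x - d > 1" using x by (auto simp: d_def field_simps)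
    have "summable h" unfolding h_def summable_of_real_iff
      using assms d unfolding dconv_def by blast
    moreover have "norm (?f n y) \<le> norm (h n)" if "y \<in> ball x d" for n y
    proof -
      have "\<bar>Re (x - y)\<bar> < d" using that abs_Re_le_cmod[of "x - y"] by (simp add: dist_norm)
      then have "Re x - d \<le> Re y" by auto
      moreover have "ln (real n) \<ge> 0" by (cases "n = 0") auto
      ultimately have "(Re x - d) * ln (real n) \<le> Re y * ln (real n)" by (intro mult_right_mono)
      then have "exp (- Re y * ln (real n)) \<le> exp (- (Re x - d) * ln (real n))" by (simp add: algebra_simps)
      then show ?thesis unfolding norm_dseries_term h_def norm_of_real abs_mult abs_idempotent abs_exp_cancel
        by (intro mult_left_mono) auto
    qed
    ultimately show "\<exists>d h. 0 < d \<and> summable h \<and> range h \<subseteq> \<real>\<^sub>\<ge>\<^sub>0 \<and> (\<forall>\<^sub>F n in sequentially. \<forall>y\<in>ball x d \<inter> ?S. cmod(?f n y) \<le> cmod (h n))"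
      using d by (intro exI[of _ d] exI[of _ h]) (auto simp: h_def simp del: norm_mult of_real_mult)
  qed
  then obtain g g' where g: "\<And>x. x \<in> ?S \<Longrightarrow> ((\<lambda>n. ?f n x) sums g x) \<and> ((\<lambda>n. ?f' n x) sums g' x) \<and> (g has_field_derivative g' x) (at x)"
    by blast
  have eq: "g x = dseries a x" if "x \<in> ?S" for x
    using g[OF that] by (simp add: dseries_def sums_iff)
  have "g' s = dseries (\<lambda>n. - a n * ln (real n)) s"
    using g[of s] assms(2) by (simp add: dseries_def sums_iff)
  moreover have "(dseries a has_field_derivative g' s) (at s)"
    by (rule has_field_derivative_transform_within_open[of g _ _ ?S]) (use g eq assms open_Re_gt in auto)
  ultimately show ?thesis by simp
qed

lemma summable_exp_ln:
  assumes "\<sigma> > 1" shows "summable (\<lambda>n. exp (- \<sigma> * ln (real n)))"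
proof -
  have "summable (\<lambda>n. real n powr (-\<sigma>))" using assms by (simp add: summable_real_powr_iff)
  then show ?thesis
    by (rule summable_comparison_test'[where N = 1]) (auto simp: powr_def)
qed

definition one_coeff :: "nat \<Rightarrow> real" where "one_coeff n = (if n = 0 then 0 else 1)"

lemma dconv_one_coeff: "dconv one_coeff"
  unfolding dconv_def
proof (intro allI impI)
  fix \<sigma> :: real assume "\<sigma> > 1"
  from summable_exp_ln[OF this] show "summable (\<lambda>n. \<bar>one_coeff n\<bar> * exp (- \<sigma> * ln (real n)))"
    by (rule summable_comparison_test'[where N=0]) (auto simp: one_coeff_def)
qed

abbreviation zeta :: "complex \<Rightarrow> complex" where "zeta \<equiv> dseries one_coeff"

lemma dconv_ln_coeff: "dconv (\<lambda>n. ln (real n))"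
  by (rule dconv_mono[OF dconv_ln[OF dconv_one_coeff]]) (auto simp: one_coeff_def)

lemma dconv_mangoldt: "dconv mangoldt"
  by (rule dconv_mono[OF dconv_ln_coeff])
    (metis abs_ge_self abs_mangoldt gr0I mangoldt_0 mangoldt_le order_trans abs_ge_zero)

lemma zeta_deriv:
  assumes "Re s > 1"
  shows "(zeta has_field_derivative - dseries (\<lambda>n. ln (real n)) s) (at s)"
proof -
  have "(\<lambda>n. - one_coeff n * ln (real n)) = (\<lambda>n. - ln (real n))" by (auto simp: one_coeff_def fun_eq_iff)
  then show ?thesis using dseries_deriv[OF dconv_one_coeff assms] dseries_uminus[OF dconv_ln_coeff assms] by simp
qed

text \<open>The pairs \<open>(d, m)\<close> of positive integers are regrouped by
  \<open>n = d * m\<close>, and the sum of \<open>mangoldt\<close> over the divisors of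
  \<open>n\<close> is \<open>ln n\<close>. The index 0 is removed first, because every number
  divides 0 and its fibre would be infinite.\<close>

lemma mangoldt_convolution:
  assumes s: "Re s > 1"
  shows "dseries mangoldt s * zeta s = dseries (\<lambda>n. ln (real n)) s"
proof -
  define e where "e n = exp (- s * of_real (ln (real n)))" for n
  define f where "f n = of_real (mangoldt n) * e n" for n
  define g where "g n = of_real (one_coeff n) * e n" for n
  let ?A = "{0<..} :: nat set"
  let ?B = "Sigma ?A (\<lambda>n. {d. d dvd n})"
  have sf: "summable (\<lambda>n. norm (f n))" "f sums dseries mangoldt s"
    using dconv_summable_norm[OF dconv_mangoldt s] dseries_sums[OF dconv_mangoldt s] by (simp_all add: f_def[abs_def] e_def)
  have sg: "summable (\<lambda>n. norm (g n))" "g sums zeta s"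
    using dconv_summable_norm[OF dconv_one_coeff s] dseries_sums[OF dconv_one_coeff s] by (simp_all add: g_def[abs_def] e_def)
  have f1: "(\<lambda>n. norm (f n)) summable_on UNIV"
    using sf(1) by (intro norm_summable_imp_summable_on) simp
  have g1: "(\<lambda>n. norm (g n)) summable_on UNIV"
    using sg(1) by (intro norm_summable_imp_summable_on) simp
  have "(f has_sum dseries mangoldt s) UNIV" using sf by (rule norm_summable_imp_has_sum)
  then have f0: "(f has_sum dseries mangoldt s) ?A"
    by (rule has_sum_cong_neutral[THEN iffD1, rotated -1]) (auto simp: f_def)
  have "(g has_sum zeta s) UNIV" using sg by (rule norm_summable_imp_has_sum)
  then have g0: "(g has_sum zeta s) ?A"
    by (rule has_sum_cong_neutral[THEN iffD1, rotated -1]) (auto simp: g_def one_coeff_def)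
  let ?fg = "\<lambda>z. f (fst z) * g (snd z)"
  have "(\<lambda>z. norm (?fg z)) summable_on ?A \<times> ?A"
    unfolding norm_mult
  proof (rule summable_on_SigmaI)
    show "((\<lambda>y. norm (f (fst (x,y))) * norm (g (snd (x,y)))) has_sum (norm (f x) * infsum (\<lambda>y. norm (g y)) ?A)) ?A" for x
      unfolding fst_conv snd_conv
      by (intro has_sum_cmult_right has_sum_infsum summable_on_subset_banach[OF g1]) auto
    show "(\<lambda>x. norm (f x) * infsum (\<lambda>y. norm (g y)) ?A) summable_on ?A"
      by (intro summable_on_cmult_left summable_on_subset_banach[OF f1]) auto
  qed auto
  then have fg: "?fg summable_on ?A \<times> ?A" by (rule abs_summable_summable)
  have "infsum ?fg (?A \<times> ?A) = infsum (\<lambda>x. infsum (\<lambda>y. ?fg (x,y)) ?A) ?A"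
    by (rule infsum_Sigma_banach[OF fg, symmetric])
  also have "\<dots> = infsum (\<lambda>x. f x * zeta s) ?A"
    unfolding fst_conv snd_conv by (intro infsum_cong infsumI has_sum_cmult_right g0)
  also have "\<dots> = dseries mangoldt s * zeta s"
    by (intro infsumI has_sum_cmult_left f0)
  finally have 1: "(?fg has_sum (dseries mangoldt s * zeta s)) (?A \<times> ?A)"
    using has_sum_infsum[OF fg] by simp
  have bij: "bij_betw (\<lambda>z. (snd z, fst z div snd z)) ?B (?A \<times> ?A)"
    by (rule bij_betwI[where g = "\<lambda>z. (fst z * snd z, fst z)"]) (auto intro!: Nat.gr0I)
  have "((\<lambda>z. ?fg (snd z, fst z div snd z)) has_sum (dseries mangoldt s * zeta s)) ?B"
    using has_sum_reindex_bij_betw[OF bij, of ?fg] 1 by blast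
  moreover have 3: "?fg (snd z, fst z div snd z) = of_real (mangoldt (snd z)) * e (fst z)" if "z \<in> ?B" for z
  proof -
    from that obtain m where m: "fst z = snd z * m" "snd z > 0" "m > 0" by (auto elim!: dvdE)
    then have "ln (real (fst z)) = ln (real (snd z)) + ln (real m)" by (simp add: ln_mult)
    then have "e (fst z) = e (snd z) * e m" by (simp add: e_def ring_distribs flip: exp_add)
    then show ?thesis using m by (simp add: one_coeff_def f_def g_def)
  qed
  ultimately have "((\<lambda>z. of_real (mangoldt (snd z)) * e (fst z)) has_sum (dseries mangoldt s * zeta s)) ?B"
    by (rule has_sum_cong[THEN iffD1, rotated])
  then have 2: "((\<lambda>n. \<Sum>d\<in>{d. d dvd n}. of_real (mangoldt d) * e n) has_sum (dseries mangoldt s * zeta s)) ?A"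
    by (rule has_sum_SigmaD) (auto intro!: has_sum_finite)
  have "(\<Sum>d\<in>{d. d dvd n}. of_real (mangoldt d) * e n) = of_real (ln (real n)) * e n" if "n \<in> ?A" for n
    using mangoldt_sum[of n, where ?'a = complex] that by (simp flip: sum_distrib_right)
  then have "((\<lambda>n. of_real (ln (real n)) * e n) has_sum (dseries mangoldt s * zeta s)) ?A"
    by (rule has_sum_cong[THEN iffD1, OF _ 2])
  then have "((\<lambda>n. of_real (ln (real n)) * e n) has_sum (dseries mangoldt s * zeta s)) UNIV"
    by (rule has_sum_cong_neutral[THEN iffD1, rotated -1]) auto
  from has_sum_imp_sums[OF this] show ?thesis by (simp add: dseries_def sums_iff e_def)
qed

subsection \<open>Continuation of the zeta function\<close>

definition cpow :: "complex \<Rightarrow> real \<Rightarrow> complex" where "cpow s x = exp (s * of_real (ln x))"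

lemma norm_cpow: "x > 0 \<Longrightarrow> norm (cpow s x) = x powr Re s"
  by (simp add: cpow_def powr_def mult.commute)

lemma cpow_vderiv:
  assumes "x > 0"
  shows "(cpow s has_vector_derivative s * cpow (s - 1) x) (at x within A)"
proof -
  have 1: "((\<lambda>x. of_real (ln x) :: complex) has_vector_derivative of_real (1 / x)) (at x within A)"
    using assms by (intro has_vector_derivative_of_real)
      (auto intro!: derivative_eq_intros simp: field_simps simp flip: has_real_derivative_iff_has_vector_derivative)
  have "((\<lambda>z. exp (s * z)) has_field_derivative s * exp (s * of_real (ln x))) (at (of_real (ln x)) within range of_real)"
    by (auto intro!: derivative_eq_intros)
  from field_vector_diff_chain_within[OF 1, of "\<lambda>z. exp (s * z)" "s * exp (s * of_real (ln x))"]
  have "((\<lambda>x. exp (s * of_real (ln x))) has_vector_derivative of_real (1/x) * (s * exp (s * of_real (ln x)))) (at x within A)"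
    using DERIV_subset by (force simp: o_def intro!: derivative_eq_intros)
  moreover have "of_real (1/x) * (s * exp (s * of_real (ln x))) = s * cpow (s - 1) x"
  proof -
    have "exp (of_real (ln x)) = (of_real x :: complex)" using assms by (metis exp_ln exp_of_real)
    then show ?thesis by (simp add: cpow_def ring_distribs exp_diff left_diff_distrib divide_inverse mult_ac)
  qed
  ultimately show ?thesis by (simp add: cpow_def[abs_def])
qed

definition zeta_term :: "nat \<Rightarrow> complex \<Rightarrow> complex" where
  "zeta_term n s = (s - 1) * cpow (- s) (real (Suc n)) + (cpow (1 - s) (real (Suc (Suc n))) - cpow (1 - s) (real (Suc n)))"

text \<open>For \<open>u \<ge> 1\<close> the constant 2 is enough, and for \<open>u < 1\<close> an
  exponent \<open>\<eta> \<le> 1\<close> only enlarges \<open>u\<close>. This is the interpolation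
  between a trivial and a mean value bound.\<close>

lemma min_powr_bound:
  fixes u :: real assumes "u \<ge> 0" "0 \<le> \<eta>" "\<eta> \<le> 1" "y \<le> 2" "y \<le> u"
  shows "y \<le> 2 * u powr \<eta>"
proof (cases "u \<ge> 1")
  case True
  then have "1 \<le> u powr \<eta>" using assms by (simp add: ge_one_powr_ge_zero)
  then show ?thesis using assms by linarith
next
  case False
  then have "u powr 1 \<le> u powr \<eta>" using assms by (intro powr_mono') auto
  then have "u \<le> u powr \<eta>" using assms by simp
  then show ?thesis using assms by (smt (verit))
qed

text \<open>
  Interpolating between the trivial bound \<open>2 m\<^bsup>-\<sigma>\<^esup>\<close> and the mean value bound \<open>\<bar>s\<bar> m\<^bsup>-\<sigma>-1\<^esup>\<close> gives growth
  \<open>\<bar>s\<bar>\<^bsup>\<eta>\<^esup>\<close> near the line \<open>Re s = 1\<close> without truncating the series.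
\<close>
lemma zeta_term_bound:
  assumes s: "Re s > 0" and \<eta>: "0 \<le> \<eta>" "\<eta> \<le> 1"
  shows "norm (zeta_term n s) \<le> norm (s - 1) * (2 * norm s powr \<eta> * real (Suc n) powr (- (Re s + \<eta>)))"
proof -
  define m where "m = real (Suc n)"
  have m: "m \<ge> 1" by (simp add: m_def)
  have key: "norm (cpow (-s) x - cpow (-s) m) \<le> 2 * norm s powr \<eta> * m powr (- (Re s + \<eta>))" if x: "x \<in> {m..m+1}" for x
  proof -
    have a: "norm (cpow (-s) x - cpow (-s) m) \<le> 2 * m powr (- Re s)"
    proof -
      have "norm (cpow (-s) x - cpow (-s) m) \<le> x powr (- Re s) + m powr (- Re s)"
        using norm_triangle_ineq4[of "cpow (-s) x" "cpow (-s) m"] x m by (simp add: norm_cpow)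
      moreover have "x powr (- Re s) \<le> m powr (- Re s)" using x m s by (intro powr_mono2') auto
      ultimately show ?thesis by simp
    qed
    have b: "norm (cpow (-s) x - cpow (-s) m) \<le> norm s * m powr (- Re s - 1)"
    proof (cases "x = m")
      case False
      then have "m < x" using x by auto
      moreover have "continuous_on {m..x} (cpow (-s))"
        by (rule continuous_on_vector_derivative[OF cpow_vderiv]) (use m in auto)
      moreover have "(cpow (-s) has_derivative (\<lambda>h. h *\<^sub>R (-s * cpow (-s-1) y))) (at y)" if "m < y" "y < x" for y
        using cpow_vderiv[of y "-s" UNIV] that m by (simp add: has_vector_derivative_def)
      ultimately obtain y where y: "y \<in> {m<..<x}" "norm (cpow (-s) x - cpow (-s) m) \<le> norm ((x - m) *\<^sub>R (-s * cpow (-s-1) y))"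
        using mvt_general[of m x "cpow (-s)" "\<lambda>y h. h *\<^sub>R (-s * cpow (-s-1) y)"] by blast
      note y(2)
      also have "norm ((x - m) *\<^sub>R (-s * cpow (-s-1) y)) = (x - m) * (norm s * y powr (- Re s - 1))"
        using y m by (simp add: norm_mult norm_cpow)
      also have "\<dots> \<le> 1 * (norm s * m powr (- Re s - 1))"
        using y x m s by (intro mult_mono mult_left_mono powr_mono2') auto
      finally show ?thesis by simp
    qed (use m in auto)
    have "norm (cpow (-s) x - cpow (-s) m) / m powr (- Re s) \<le> 2 * (norm s / m) powr \<eta>"
    proof (rule min_powr_bound)
      show "norm (cpow (-s) x - cpow (-s) m) / m powr (- Re s) \<le> 2"
        using a m by (simp add: field_simps)
      have "norm (cpow (-s) x - cpow (-s) m) / m powr (- Re s) \<le> (norm s * m powr (- Re s - 1)) / m powr (- Re s)"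
        by (intro divide_right_mono b) auto
      also have "\<dots> = norm s / m" using m by (simp add: powr_diff)
      finally show "norm (cpow (-s) x - cpow (-s) m) / m powr (- Re s) \<le> norm s / m" .
    qed (use \<eta> m in auto)
    also have "\<dots> = 2 * norm s powr \<eta> / m powr \<eta>" using m by (simp add: powr_divide)
    finally have "norm (cpow (-s) x - cpow (-s) m) \<le> 2 * norm s powr \<eta> / m powr \<eta> * m powr (- Re s)"
      using m by (simp add: pos_divide_le_eq)
    also have "\<dots> = 2 * norm s powr \<eta> * m powr (- (Re s + \<eta>))"
    proof -
      have "m powr (- (Re s + \<eta>)) = m powr (- Re s) / m powr \<eta>"
        by (simp flip: powr_diff)
      then show ?thesis by simp
    qed
    finally show ?thesis .
  qed
  \<comment> \<open>The term \<open>zeta_term n s\<close> is the error of the linear approximation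
    of \<open>cpow (1 - s)\<close> at \<open>m\<close> over a unit step, hence bounded by the
    oscillation of the derivative, which \<open>key\<close> controls.\<close>
  have "norm (cpow (1 - s) (m + 1) - cpow (1 - s) m - ((m + 1) - m) *\<^sub>R ((1 - s) * cpow (- s) m))
     \<le> norm ((m + 1) - m) * (norm (s - 1) * (2 * norm s powr \<eta> * m powr (- (Re s + \<eta>))))"
  proof (rule vector_differentiable_bound_linearization[where S = "{m..m+1}" and f' = "\<lambda>x. (1 - s) * cpow (- s) x"])
    show "(cpow (1 - s) has_vector_derivative (1 - s) * cpow (- s) x) (at x within {m..m+1})" if "x \<in> {m..m+1}" for x
      using cpow_vderiv[of x "1 - s" "{m..m+1}"] that m by auto
    show "norm ((1 - s) * cpow (- s) x - (1 - s) * cpow (- s) m) \<le> norm (s - 1) * (2 * norm s powr \<eta> * m powr (- (Re s + \<eta>)))"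
      if "x \<in> {m..m+1}" for x
      using mult_left_mono[OF key[OF that], of "norm (1 - s)"]
      by (simp add: norm_minus_commute norm_mult flip: right_diff_distrib)
  qed (use m in \<open>auto simp: closed_segment_eq_real_ivl\<close>)
  moreover have "real (Suc (Suc n)) = m + 1" by (simp add: m_def)
  ultimately show ?thesis unfolding zeta_term_def m_def[symmetric] by (simp add: algebra_simps)
qed

text \<open>
  This is \<open>(s - 1) \<zeta>(s)\<close>, continued to \<open>Re s > 0\<close>: the term for \<open>m = n + 1\<close> equals \<open>s - 1\<close> times the
  difference of \<open>m\<^bsup>-s\<^esup>\<close> and the integral of \<open>x\<^bsup>-s\<^esup>\<close> over \<open>[m, m + 1]\<close>.
\<close>
definition zeta_E :: "complex \<Rightarrow> complex" where "zeta_E s = 1 + (\<Sum>n. zeta_term n s)"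

lemma summable_Suc_powr: "a < -1 \<Longrightarrow> summable (\<lambda>n. real (Suc n) powr a)"
  using summable_Suc_iff[of "\<lambda>n. real n powr a"] by (simp add: summable_real_powr_iff)

text \<open>The choice \<open>\<eta> = 1\<close> gives decay like
  \<open>m powr (- Re s - 1)\<close>, summable on the whole half-plane
  \<open>Re s > 0\<close>.\<close>

lemma zeta_term_sums:
  assumes "Re s > 0" shows "(\<lambda>n. zeta_term n s) sums (zeta_E s - 1)"
proof -
  have "summable (\<lambda>n. norm (s - 1) * (2 * norm s powr 1 * real (Suc n) powr (- (Re s + 1))))"
    using assms by (intro summable_mult summable_Suc_powr) auto
  then have "summable (\<lambda>n. zeta_term n s)"
    by (rule summable_comparison_test'[where N = 0]) (use zeta_term_bound[OF assms, of 1] in auto)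
  then show ?thesis by (simp add: zeta_E_def summable_sums)
qed

lemma zeta_E_holomorphic: "zeta_E holomorphic_on {s. Re s > 0}"
proof -
  let ?S = "{s. Re s > 0}"
  obtain g where g: "\<forall>x \<in> ?S. ((\<lambda>n. zeta_term n x) sums g x) \<and> g field_differentiable (at x)"
  proof (rule series_differentiable_comparison_complex[of ?S zeta_term])
    show "open ?S" by (rule open_halfspace_Re_gt)
    show "zeta_term n field_differentiable at x" for n x
    proof -
      have "(\<lambda>s. zeta_term n s) holomorphic_on UNIV" unfolding zeta_term_def cpow_def by (intro holomorphic_intros)
      then show ?thesis by (simp add: holomorphic_on_def)
    qed
    fix x :: complex assume "x \<in> ?S"
    then have x: "Re x > 0" by simp
    define d where "d = Re x / 2"
    define R where "R = norm x + d + 1"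
    define h where "h = (\<lambda>n. of_real (R * (2 * R powr 1 * real (Suc n) powr (- (d + 1)))) :: complex)"
    have d: "d > 0" using x by (auto simp: d_def)
    have "summable h" unfolding h_def summable_of_real_iff
      using d by (intro summable_mult summable_Suc_powr) auto
    moreover have "norm (zeta_term n y) \<le> norm (h n)" if "y \<in> ball x d" for n y
    proof -
      have "\<bar>Re (x - y)\<bar> < d" using that abs_Re_le_cmod[of "x - y"] by (simp add: dist_norm)
      then have r: "d \<le> Re y" by (auto simp: d_def abs_if split: if_splits)
      have "norm y \<le> norm x + d" using that norm_triangle_ineq2[of y x] by (simp add: dist_norm norm_minus_commute)
      then have "norm y \<le> R" "norm (y - 1) \<le> R" using norm_triangle_ineq4[of y 1] by (auto simp: R_def)
      then have "norm (y - 1) * (2 * norm y powr 1 * real (Suc n) powr (- (Re y + 1))) \<le> R * (2 * R powr 1 * real (Suc n) powr (- (d + 1)))"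
        using r d by (intro mult_mono powr_mono powr_mono2) (auto simp: R_def)
      then show ?thesis using zeta_term_bound[of y 1 n] r d unfolding h_def norm_of_real by (smt (verit))
    qed
    moreover have "range h \<subseteq> \<real>\<^sub>\<ge>\<^sub>0" using d by (auto simp: h_def R_def simp del: of_real_mult of_real_add)
    ultimately show "\<exists>d h. 0 < d \<and> summable h \<and> range h \<subseteq> \<real>\<^sub>\<ge>\<^sub>0 \<and> (\<forall>\<^sub>F n in sequentially. \<forall>y\<in>ball x d \<inter> ?S. cmod(zeta_term n y) \<le> cmod (h n))"
      using d by (intro exI[of _ d] exI[of _ h]) auto
  qed blast
  have "(\<lambda>s. 1 + g s) holomorphic_on ?S"
    by (intro holomorphic_intros) (use g in \<open>auto simp: holomorphic_on_def intro: field_differentiable_at_within\<close>)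
  moreover have "1 + g s = zeta_E s" if "s \<in> ?S" for s
    using g that by (simp add: zeta_E_def sums_iff)
  ultimately show ?thesis by (rule holomorphic_transform)
qed

lemma zeta_E_1 [simp]: "zeta_E 1 = 1"
  by (simp add: zeta_E_def zeta_term_def cpow_def)

text \<open>The bracketed differences in \<open>zeta_term\<close> telescope to \<open>-1\<close>,
  which cancels the leading 1 of \<open>zeta_E\<close>.\<close>

lemma zeta_E_eq_zeta:
  assumes "Re s > 1" shows "zeta_E s = (s - 1) * zeta s"
proof -
  have "(\<lambda>n. of_real (one_coeff n) * exp (- s * of_real (ln (real n)))) sums zeta s"
    using dseries_sums[OF dconv_one_coeff assms] .
  then have "(\<lambda>n. of_real (one_coeff (Suc n)) * exp (- s * of_real (ln (real (Suc n))))) sums zeta s"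
    by (subst sums_Suc_iff) (simp add: one_coeff_def)
  then have 1: "(\<lambda>n. cpow (-s) (real (Suc n))) sums zeta s"
    by (simp add: one_coeff_def cpow_def)
  have "(\<lambda>n. norm (cpow (1 - s) (real (Suc n)))) \<longlonglongrightarrow> 0"
  proof -
    have "(\<lambda>n. real (Suc n) powr (1 - Re s)) \<longlonglongrightarrow> 0"
      using assms by real_asymp
    then show ?thesis by (simp add: norm_cpow)
  qed
  then have "(\<lambda>n. cpow (1 - s) (real (Suc n))) \<longlonglongrightarrow> 0" by (rule tendsto_norm_zero_cancel)
  from telescope_sums[OF this] have "(\<lambda>n. cpow (1 - s) (real (Suc (Suc n))) - cpow (1 - s) (real (Suc n))) sums (-1)"
    by (simp add: cpow_def)
  from sums_add[OF sums_mult[OF 1, of "s - 1"] this] 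
  have "(\<lambda>n. zeta_term n s) sums ((s - 1) * zeta s + (-1))" by (simp add: zeta_term_def)
  moreover have "(\<lambda>n. zeta_term n s) sums (zeta_E s - 1)" using assms by (intro zeta_term_sums) auto
  ultimately show ?thesis by (metis add_uminus_conv_diff diff_add_cancel sums_unique2)
qed

text \<open>Division by zero makes the value at \<open>s = 1\<close> equal to 0, so statements about
  the growth exclude this point.\<close>

definition zeta_ext :: "complex \<Rightarrow> complex" where "zeta_ext s = zeta_E s / (s - 1)"

lemma zeta_ext_eq: "Re s > 1 \<Longrightarrow> zeta_ext s = zeta s"
  by (auto simp: zeta_ext_def zeta_E_eq_zeta)

text \<open>Of the exponent \<open>\<eta>\<close> one half is spent on moving left of
  \<open>Re s = 1\<close> and the other half keeps the series over
  \<open>m powr (- (1 + \<eta> / 2))\<close> summable.\<close>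

lemma zeta_ext_growth:
  assumes \<eta>: "0 < \<eta>" "\<eta> \<le> 1"
  shows "\<exists>A>0. \<forall>s. Re s \<ge> 1 - \<eta> / 2 \<longrightarrow> s \<noteq> 1 \<longrightarrow> norm (zeta_ext s - 1 / (s - 1)) \<le> A * norm s powr \<eta>"
proof -
  define S where "S = (\<Sum>n. real (Suc n) powr (- (1 + \<eta> / 2)))"
  have S: "summable (\<lambda>n. real (Suc n) powr (- (1 + \<eta> / 2)))" using \<eta> by (intro summable_Suc_powr) auto
  have S0: "S \<ge> 0" unfolding S_def by (intro suminf_nonneg S) auto
  have "norm (zeta_ext s - 1 / (s - 1)) \<le> (2 * S + 1) * norm s powr \<eta>" if s: "Re s \<ge> 1 - \<eta> / 2" "s \<noteq> 1" for s
  proof -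
    have r: "Re s > 0" using s \<eta> by auto
    have b: "norm (zeta_term n s) \<le> (norm (s - 1) * (2 * norm s powr \<eta>)) * real (Suc n) powr (- (1 + \<eta> / 2))" for n
    proof -
      have "norm (zeta_term n s) \<le> norm (s - 1) * (2 * norm s powr \<eta> * real (Suc n) powr (- (Re s + \<eta>)))"
        using zeta_term_bound[OF r, of \<eta> n] \<eta> by simp
      also have "\<dots> \<le> norm (s - 1) * (2 * norm s powr \<eta> * real (Suc n) powr (- (1 + \<eta> / 2)))"
        using s by (intro mult_left_mono powr_mono) auto
      finally show ?thesis by (simp add: mult_ac)
    qed
    have "norm (zeta_E s - 1) \<le> (\<Sum>n. (norm (s - 1) * (2 * norm s powr \<eta>)) * real (Suc n) powr (- (1 + \<eta> / 2)))"
      using zeta_term_sums[OF r] b S by (metis norm_suminf_le sums_unique summable_mult)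
    also have "\<dots> = norm (s - 1) * (2 * norm s powr \<eta>) * S" unfolding S_def by (rule suminf_mult[OF S])
    finally have "norm (zeta_E s - 1) / norm (s - 1) \<le> 2 * S * norm s powr \<eta>" using s by (simp add: field_simps)
    moreover have "zeta_ext s - 1 / (s - 1) = (zeta_E s - 1) / (s - 1)" by (simp add: zeta_ext_def diff_divide_distrib)
    ultimately have "norm (zeta_ext s - 1 / (s - 1)) \<le> 2 * S * norm s powr \<eta>" by (simp add: norm_divide)
    also have "\<dots> \<le> (2 * S + 1) * norm s powr \<eta>" by (intro mult_right_mono) auto
    finally show ?thesis .
  qed
  then show ?thesis using S0 by (intro exI[of _ "2 * S + 1"]) auto
qed

section \<open>The logarithm of zeta and the 3-4-1 inequality\<close>

definition log_zeta_coeff :: "nat \<Rightarrow> real" where "log_zeta_coeff n = mangoldt n / ln (real n)"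

lemma log_zeta_coeff_nonneg: "log_zeta_coeff n \<ge> 0"
  using mangoldt_nonneg by (cases "n = 0") (auto simp: log_zeta_coeff_def)

lemma log_zeta_coeff_le: "log_zeta_coeff n \<le> one_coeff n"
proof (cases "n \<le> 1")
  case True then show ?thesis by (cases n) (auto simp: log_zeta_coeff_def one_coeff_def)
next
  case False then show ?thesis using mangoldt_le[of n] by (simp add: log_zeta_coeff_def one_coeff_def)
qed

lemma dconv_log_zeta_coeff: "dconv log_zeta_coeff"
  by (rule dconv_mono[OF dconv_one_coeff]) (smt (verit) log_zeta_coeff_nonneg log_zeta_coeff_le)

text \<open>At 0 and 1 the coefficient is a quotient by \<open>ln = 0\<close>, hence 0, and
  \<open>mangoldt\<close> vanishes there as well.\<close>

lemma log_zeta_coeff_mult_ln: "log_zeta_coeff n * ln (real n) = mangoldt n"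
  by (cases "n = 0"; cases "n = 1") (auto simp: log_zeta_coeff_def)

lemma dseries_log_zeta_coeff_deriv: "Re s > 1 \<Longrightarrow> (dseries log_zeta_coeff has_field_derivative - dseries mangoldt s) (at s)"
  using dseries_deriv[OF dconv_log_zeta_coeff, of s] dseries_uminus[OF dconv_mangoldt, of s] by (simp add: log_zeta_coeff_mult_ln)

lemma Re_dseries:
  assumes "dconv a" "Re s > 1"
  shows "(\<lambda>n. a n * exp (- Re s * ln (real n)) * cos (Im s * ln (real n))) sums Re (dseries a s)"
proof -
  have "Re (of_real (a n) * exp (- s * of_real (ln (real n)))) = a n * exp (- Re s * ln (real n)) * cos (Im s * ln (real n))" for n
    by (simp add: Re_exp)
  then show ?thesis using sums_Re[OF dseries_sums[OF assms]] by (simp only:)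
qed

text \<open>The product of \<open>zeta\<close> with the inverse of the exponential has derivative
  zero by \<open>mangoldt_convolution\<close>; this takes the place of the Euler product. The
  constant is nonzero because \<open>zeta 2\<close> is a sum of nonnegative terms whose term at 1 is
  positive.\<close>

lemma zeta_exp: "\<exists>c. c \<noteq> 0 \<and> (\<forall>s. Re s > 1 \<longrightarrow> zeta s = c * exp (dseries log_zeta_coeff s))"
proof -
  have "\<exists>c. \<forall>s\<in>{s. Re s > 1}. zeta s * exp (- dseries log_zeta_coeff s) = c"
  proof (rule has_field_derivative_zero_constant)
    show "convex {s. Re s > 1}" by (rule convex_halfspace_Re_gt)
    fix s assume "s \<in> {s. Re s > 1}"
    then have s: "Re s > 1" by simp
    have "((\<lambda>s. zeta s * exp (- dseries log_zeta_coeff s)) has_field_derivative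
        (- dseries (\<lambda>n. ln (real n)) s) * exp (- dseries log_zeta_coeff s) + zeta s * (exp (- dseries log_zeta_coeff s) * dseries mangoldt s))
       (at s within {s. Re s > 1})"
      using zeta_deriv[OF s] dseries_log_zeta_coeff_deriv[OF s]
      by (auto intro!: derivative_eq_intros DERIV_subset[where s=UNIV and t = "{s. Re s > 1}"])
    moreover have "(- dseries (\<lambda>n. ln (real n)) s) * exp (- dseries log_zeta_coeff s) + zeta s * (exp (- dseries log_zeta_coeff s) * dseries mangoldt s) = 0"
      unfolding mangoldt_convolution[OF s, symmetric] by (simp add: mult_ac)
    ultimately show "((\<lambda>s. zeta s * exp (- dseries log_zeta_coeff s)) has_field_derivative 0) (at s within {s. Re s > 1})"
      by (simp only:)
  qed
  then obtain c where c: "\<And>s. Re s > 1 \<Longrightarrow> zeta s * exp (- dseries log_zeta_coeff s) = c" by auto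
  have eq: "zeta s = c * exp (dseries log_zeta_coeff s)" if "Re s > 1" for s
    using c[OF that] by (auto simp: exp_minus field_simps)
  have "c \<noteq> 0"
  proof
    assume "c = 0"
    then have z: "zeta 2 = 0" using eq[of 2] by simp
    have "(\<lambda>n. one_coeff n * exp (- 2 * ln (real n))) sums 0"
      using Re_dseries[OF dconv_one_coeff, of 2] z by simp
    then have "summable (\<lambda>n. one_coeff n * exp (- 2 * ln (real n)))" "(\<Sum>n. one_coeff n * exp (- 2 * ln (real n))) = 0"
      by (auto simp: sums_iff)
    moreover have "one_coeff n * exp (- 2 * ln (real n)) \<ge> 0" for n by (auto simp: one_coeff_def)
    ultimately have "one_coeff 1 * exp (- 2 * ln (real 1)) = 0" using suminf_eq_zero_iff by blast
    then show False by (simp add: one_coeff_def)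
  qed
  then show ?thesis using eq by blast
qed

text \<open>On taking logarithms the nonnegative coefficients are multiplied by \<open>3 + 4 cos
  \<theta> + cos (2 \<theta>) = 2 (1 + cos \<theta>)^2\<close>. The constant is the eighth power of
  the one from \<open>zeta_exp\<close>, since 3 + 4 + 1 = 8.\<close>

lemma zeta_341: "\<exists>c>0. \<forall>\<sigma>>1. \<forall>t. norm (zeta (of_real \<sigma>)) ^ 3 * norm (zeta (Complex \<sigma> t)) ^ 4 * norm (zeta (Complex \<sigma> (2 * t))) \<ge> c"
proof -
  obtain c where c: "c \<noteq> 0" "\<And>s. Re s > 1 \<Longrightarrow> zeta s = c * exp (dseries log_zeta_coeff s)" using zeta_exp by blast
  have "norm (zeta (of_real \<sigma>)) ^ 3 * norm (zeta (Complex \<sigma> t)) ^ 4 * norm (zeta (Complex \<sigma> (2 * t))) \<ge> norm c ^ 8"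
    if \<sigma>: "\<sigma> > 1" for \<sigma> t
  proof -
    let ?w = "\<lambda>n. log_zeta_coeff n * exp (- \<sigma> * ln (real n))"
    define A where "A = Re (dseries log_zeta_coeff (of_real \<sigma>))"
    define B where "B = Re (dseries log_zeta_coeff (Complex \<sigma> t))"
    define D where "D = Re (dseries log_zeta_coeff (Complex \<sigma> (2*t)))"
    have 1: "?w sums A"
      using Re_dseries[OF dconv_log_zeta_coeff, of "of_real \<sigma>"] \<sigma> by (simp add: A_def)
    have 2: "(\<lambda>n. ?w n * cos (t * ln (real n))) sums B"
      using Re_dseries[OF dconv_log_zeta_coeff, of "Complex \<sigma> t"] \<sigma> by (simp add: B_def)
    have 3: "(\<lambda>n. ?w n * cos (2 * t * ln (real n))) sums D"
      using Re_dseries[OF dconv_log_zeta_coeff, of "Complex \<sigma> (2*t)"] \<sigma> by (simp add: D_def)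
    have "(\<lambda>n. 3 * ?w n + 4 * (?w n * cos (t * ln (real n))) + ?w n * cos (2 * t * ln (real n))) sums (3 * A + 4 * B + D)"
      by (intro sums_add sums_mult 1 2 3)
    moreover have nn: "3 * ?w n + 4 * (?w n * cos (t * ln (real n))) + ?w n * cos (2 * t * ln (real n)) \<ge> 0" for n
    proof -
      define y where "y = cos (t * ln (real n))"
      define w where "w = ?w n"
      have y2: "cos (2 * t * ln (real n)) = 2 * y ^ 2 - 1"
        using cos_double_cos[of "t * ln (real n)"] by (simp add: mult_ac y_def)
      have "3 * w + 4 * (w * y) + w * (2 * y ^ 2 - 1) = w * (2 * (1 + y)^2)"
        by (simp add: algebra_simps power2_eq_square)
      then have "3 * ?w n + 4 * (?w n * cos (t * ln (real n))) + ?w n * cos (2 * t * ln (real n)) = ?w n * (2 * (1 + y)^2)"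
        unfolding y2 y_def[symmetric] w_def[symmetric] .
      also have "\<dots> \<ge> 0" using log_zeta_coeff_nonneg by (intro mult_nonneg_nonneg) auto
      finally show ?thesis .
    qed
    ultimately have pos: "3 * A + 4 * B + D \<ge> 0" by (intro sums_le[OF nn sums_zero])
    have "norm (zeta (of_real \<sigma>)) = norm c * exp A" "norm (zeta (Complex \<sigma> t)) = norm c * exp B" "norm (zeta (Complex \<sigma> (2*t))) = norm c * exp D"
      using c(2) \<sigma> by (simp_all add: norm_mult A_def B_def D_def)
    then have "norm (zeta (of_real \<sigma>)) ^ 3 * norm (zeta (Complex \<sigma> t)) ^ 4 * norm (zeta (Complex \<sigma> (2 * t))) = norm c ^ 8 * (exp A ^ 3 * exp B ^ 4 * exp D)"
      by (simp add: power_mult_distrib eval_nat_numeral)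
    also have "exp A ^ 3 * exp B ^ 4 * exp D = exp (3 * A + 4 * B + D)"
      by (simp add: exp_add flip: exp_of_nat_mult)
    finally show ?thesis using pos by (simp add: mult_le_cancel_left1)
  qed
  then show ?thesis using c(1) by (intro exI[of _ "norm c ^ 8"]) auto
qed

lemma zeta_nonzero: "Re s > 1 \<Longrightarrow> zeta s \<noteq> 0"
  using zeta_exp by (metis exp_not_eq_zero no_zero_divisors)

subsection \<open>Lower bounds for the zeta function\<close>

lemma zeta_ext_holomorphic: "zeta_ext holomorphic_on ({s. Re s > 0} - {1})"
  unfolding zeta_ext_def
  by (intro holomorphic_intros holomorphic_on_subset[OF zeta_E_holomorphic]) auto

lemma open_Re_minus1: "open ({s. Re s > 0} - {1})"
  by (intro open_Diff open_halfspace_Re_gt) auto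

lemma powr_scale_bound:
  fixes x y :: real
  assumes "0 \<le> y" "y \<le> k * x" "0 \<le> x" "1 \<le> k" "0 < \<eta>" "\<eta> \<le> 1"
  shows "y powr \<eta> \<le> k * x powr \<eta>"
proof -
  have "y powr \<eta> \<le> (k * x) powr \<eta>" using assms by (intro powr_mono2) auto
  also have "\<dots> = k powr \<eta> * x powr \<eta>" using assms by (simp add: powr_mult)
  also have "\<dots> \<le> k powr 1 * x powr \<eta>" using assms by (intro mult_right_mono powr_mono) auto
  finally show ?thesis using assms by simp
qed

text \<open>All upper bounds consumed by \<open>zeta_ext_lower\<close>, under one common
  \<open>M\<close>. It ranges over everything above the threshold, so that a single value can later
  serve all points of a disc.\<close>

lemma zeta_ext_bounds:
  assumes \<eta>: "0 < \<eta>" "\<eta> \<le> 1" and \<tau>: "0 < \<tau>" "\<tau> \<le> 1"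
  shows "\<exists>K\<ge>1. \<forall>M s. \<bar>Im s\<bar> \<ge> \<tau> \<longrightarrow> K * (1 + \<bar>Im s\<bar>) powr \<eta> \<le> M \<longrightarrow> 1 - \<eta> / 4 \<le> Re s \<longrightarrow> Re s \<le> 3 \<longrightarrow>
     norm (zeta_ext s) \<le> M \<and> norm (deriv zeta_ext s) \<le> M \<and> norm (zeta_ext (Complex (Re s) (2 * Im s))) \<le> M \<and>
     (Re s > 1 \<longrightarrow> norm (zeta_ext (of_real (Re s))) \<le> M / (Re s - 1))"
proof -
  obtain A where A: "A > 0" "\<And>s. Re s \<ge> 1 - \<eta> / 2 \<Longrightarrow> s \<noteq> 1 \<Longrightarrow> norm (zeta_ext s - 1 / (s - 1)) \<le> A * norm s powr \<eta>"
    using zeta_ext_growth[OF \<eta>] by blast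
  define K1 where "K1 = 2 / \<tau> + 5 * A"
  \<comment> \<open>The radius for Cauchy's inequality: \<open>\<eta> / 4\<close> keeps the disc
    inside \<open>Re s \<ge> 1 - \<eta> / 2\<close>, and \<open>\<tau> / 2\<close> keeps it away
    from the pole.\<close>
  define \<rho> where "\<rho> = min (\<eta> / 4) (\<tau> / 2)"
  define K where "K = 1 + 2 * K1 + 2 * K1 / \<rho> + 6 * A"
  have \<rho>: "\<rho> > 0" "\<rho> \<le> \<eta> / 4" "\<rho> \<le> \<tau> / 2" "\<rho> \<le> 1" using \<eta> \<tau> by (auto simp: \<rho>_def)
  have K1: "K1 > 0" using A \<tau> by (auto simp: K1_def intro!: add_pos_pos)
  have K: "K \<ge> 1" "K \<ge> 2 * K1" "K \<ge> 2 * K1 / \<rho>" "K \<ge> 1 + 6 * A" 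
    using K1 \<rho> A by (auto simp: K_def)
  have b1: "norm (zeta_ext s) \<le> K1 * (1 + \<bar>Im s\<bar>) powr \<eta>" if s: "1 - \<eta> / 2 \<le> Re s" "Re s \<le> 4" "\<bar>Im s\<bar> \<ge> \<tau> / 2" for s
  proof -
    have s1: "s \<noteq> 1" using s \<tau> by auto
    have "\<tau> / 2 \<le> norm (s - 1)" using abs_Im_le_cmod[of "s - 1"] s by auto
    then have "norm (1 / (s - 1)) \<le> 2 / \<tau>" using \<tau> s1 by (simp add: norm_divide field_simps)
    moreover have "norm s powr \<eta> \<le> 5 * (1 + \<bar>Im s\<bar>) powr \<eta>"
    proof (rule powr_scale_bound)
      have "norm s \<le> \<bar>Re s\<bar> + \<bar>Im s\<bar>" by (rule cmod_le)
      also have "\<dots> \<le> 4 + \<bar>Im s\<bar>" using s \<eta> by auto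
      finally show "norm s \<le> 5 * (1 + \<bar>Im s\<bar>)" by auto
    qed (use \<eta> in auto)
    moreover have "norm (zeta_ext s) \<le> norm (zeta_ext s - 1 / (s - 1)) + norm (1 / (s - 1))"
      by (metis diff_add_cancel norm_triangle_ineq)
    moreover have "1 \<le> (1 + \<bar>Im s\<bar>) powr \<eta>" using \<eta> by (intro ge_one_powr_ge_zero) auto
    ultimately have "norm (zeta_ext s) \<le> A * (5 * (1 + \<bar>Im s\<bar>) powr \<eta>) + 2 / \<tau> * 1"
      using A(2)[OF s(1) s1] A(1) by (smt (verit) mult_left_mono)
    also have "\<dots> \<le> A * (5 * (1 + \<bar>Im s\<bar>) powr \<eta>) + 2 / \<tau> * (1 + \<bar>Im s\<bar>) powr \<eta>"
      using \<open>1 \<le> (1 + \<bar>Im s\<bar>) powr \<eta>\<close> \<tau> by (intro add_left_mono mult_left_mono) auto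
    finally show ?thesis by (simp add: K1_def algebra_simps)
  qed
  have "norm (zeta_ext s) \<le> M \<and> norm (deriv zeta_ext s) \<le> M \<and> norm (zeta_ext (Complex (Re s) (2 * Im s))) \<le> M \<and>
     (Re s > 1 \<longrightarrow> norm (zeta_ext (of_real (Re s))) \<le> M / (Re s - 1))"
    if t: "\<bar>Im s\<bar> \<ge> \<tau>" and M: "K * (1 + \<bar>Im s\<bar>) powr \<eta> \<le> M" and s: "1 - \<eta> / 4 \<le> Re s" "Re s \<le> 3" for M s
  proof (intro conjI impI)
    let ?p = "(1 + \<bar>Im s\<bar>) powr \<eta>"
    have p: "?p \<ge> 1" using \<eta> by (intro ge_one_powr_ge_zero) auto
    have KM: "k * ?p \<le> M" if "k \<le> K" for k
      using M mult_right_mono[OF that, of ?p] p by linarith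
    show "norm (zeta_ext s) \<le> M"
      using b1[of s] s t \<eta> \<tau> KM[of K1] K K1 by auto
    have "norm (zeta_ext (Complex (Re s) (2 * Im s))) \<le> K1 * (1 + \<bar>2 * Im s\<bar>) powr \<eta>"
      using b1[of "Complex (Re s) (2 * Im s)"] s t \<eta> \<tau> by auto
    also have "\<dots> \<le> K1 * (2 * ?p)"
      using K1 \<eta> by (intro mult_left_mono powr_scale_bound) auto
    finally show "norm (zeta_ext (Complex (Re s) (2 * Im s))) \<le> M" using KM[of "2 * K1"] K by auto
    have "norm ((deriv ^^ 1) zeta_ext s) \<le> fact 1 * (K1 * (2 * ?p)) / \<rho> ^ 1"
    proof (rule Cauchy_inequality)
      have inb: "1 - \<eta> / 2 \<le> Re w \<and> Re w \<le> 4 \<and> \<bar>Im w\<bar> \<ge> \<tau> / 2 \<and> \<bar>Im w\<bar> \<le> \<bar>Im s\<bar> + 1" if "norm (s - w) \<le> \<rho>" for w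
        using abs_Re_le_cmod[of "s - w"] abs_Im_le_cmod[of "s - w"] that s t \<rho> \<eta> \<tau> 
        by (auto simp: abs_if split: if_splits)
      have sub: "cball s \<rho> \<subseteq> {s. Re s > 0} - {1}"
      proof
        fix w assume "w \<in> cball s \<rho>"
        then show "w \<in> {s. Re s > 0} - {1}" using inb[of w] \<eta> \<tau> by (auto simp: dist_norm)
      qed
      show "zeta_ext holomorphic_on ball s \<rho>"
        by (rule holomorphic_on_subset[OF zeta_ext_holomorphic]) (use sub ball_subset_cball in blast)
      show "continuous_on (cball s \<rho>) zeta_ext"
        using continuous_on_subset[OF holomorphic_on_imp_continuous_on[OF zeta_ext_holomorphic] sub] .
      fix w assume w: "norm (s - w) = \<rho>"
      have "norm (zeta_ext w) \<le> K1 * (1 + \<bar>Im w\<bar>) powr \<eta>" using inb[of w] w by (intro b1) auto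
      also have "\<dots> \<le> K1 * (2 * ?p)"
        using K1 \<eta> inb[of w] w by (intro mult_left_mono powr_scale_bound) auto
      finally show "norm (zeta_ext w) \<le> K1 * (2 * ?p)" .
    qed (use \<rho> in auto)
    then show "norm (deriv zeta_ext s) \<le> M" using KM[of "2 * K1 / \<rho>"] K by (simp add: mult_ac)
    assume s1: "Re s > 1"
    have "norm (zeta_ext (of_real (Re s))) \<le> norm (zeta_ext (of_real (Re s)) - 1 / (of_real (Re s) - 1)) + norm (1 / (of_real (Re s) - 1 :: complex))"
      by (metis diff_add_cancel norm_triangle_ineq)
    moreover have "norm (1 / (of_real (Re s) - 1 :: complex)) = 1 / (Re s - 1)"
      using s1 by (metis abs_of_pos diff_gt_0_iff_gt norm_divide norm_of_real norm_one of_real_1 of_real_diff)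
    moreover have "norm (zeta_ext (of_real (Re s)) - 1 / (of_real (Re s) - 1)) \<le> A * norm (of_real (Re s) :: complex) powr \<eta>"
      using s1 \<eta> by (intro A(2)) (auto simp: complex_eq_iff)
    moreover have "Re s powr \<eta> \<le> Re s powr 1" using s1 \<eta> by (intro powr_mono) auto
    then have "A * norm (of_real (Re s) :: complex) powr \<eta> \<le> A * 3" using s1 s A(1) by (intro mult_left_mono) auto
    moreover have "A * 3 \<le> 6 * A / (Re s - 1)" using s1 s A(1) by (simp add: field_simps)
    ultimately have "norm (zeta_ext (of_real (Re s))) \<le> (1 + 6 * A) / (Re s - 1)" by (simp add: add_divide_distrib)
    also have "\<dots> \<le> M / (Re s - 1)" using KM[of "1 + 6 * A"] K p s1 A
      by (intro divide_right_mono) (smt (verit) mult_left_mono mult_le_cancel_left1)+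
    finally show "norm (zeta_ext (of_real (Re s))) \<le> M / (Re s - 1)" .
  qed
  then show ?thesis using K(1) by blast
qed

text \<open>
  The 3-4-1 inequality bounds \<open>\<zeta>\<close> from below at distance \<open>v\<close> to the right of the line \<open>Re s = 1\<close>; the
  derivative bound \<open>M\<close> then carries the estimate across the line. The choice \<open>v = 1 / (256 M\<^bsup>12\<^esup>)\<close> balances the two.
\<close>
lemma zeta_ext_lower:
  assumes \<eta>: "0 < \<eta>" "\<eta> \<le> 1" and \<tau>: "0 < \<tau>" "\<tau> \<le> 1"
  shows "\<exists>K\<ge>1. \<forall>M s. \<bar>Im s\<bar> \<ge> \<tau> \<longrightarrow> K * (1 + \<bar>Im s\<bar>) powr \<eta> \<le> M \<longrightarrow> 1 - 1 / (256 * M ^ 12) \<le> Re s \<longrightarrow> Re s \<le> 3 \<longrightarrow>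
     norm (zeta_ext s) \<le> M \<and> norm (deriv zeta_ext s) \<le> M \<and> norm (zeta_ext s) \<ge> 1 / (128 * M ^ 11) \<and> Re s > 0"
proof -
  obtain K1 where K1: "K1 \<ge> 1" and b: "\<And>M s. \<bar>Im s\<bar> \<ge> \<tau> \<Longrightarrow> K1 * (1 + \<bar>Im s\<bar>) powr \<eta> \<le> M \<Longrightarrow> 1 - \<eta> / 4 \<le> Re s \<Longrightarrow> Re s \<le> 3 \<Longrightarrow>
     norm (zeta_ext s) \<le> M \<and> norm (deriv zeta_ext s) \<le> M \<and> norm (zeta_ext (Complex (Re s) (2 * Im s))) \<le> M \<and>
     (Re s > 1 \<longrightarrow> norm (zeta_ext (of_real (Re s))) \<le> M / (Re s - 1))"
    using zeta_ext_bounds[OF \<eta> \<tau>] by metis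
  obtain c where c: "c > 0" "\<And>\<sigma> t. \<sigma> > 1 \<Longrightarrow> norm (zeta (of_real \<sigma>)) ^ 3 * norm (zeta (Complex \<sigma> t)) ^ 4 * norm (zeta (Complex \<sigma> (2 * t))) \<ge> c"
    using zeta_341 by blast
  \<comment> \<open>The extra summands give \<open>c * M \<ge> 1\<close>, which absorbs the constant
    of the 3-4-1 inequality, and \<open>\<eta> * M \<ge> 1\<close>, which keeps \<open>1 - v\<close>
    in the region where the upper bounds hold.\<close>
  define K where "K = K1 + 1 / c + 1 / \<eta>"
  have K: "K \<ge> K1" "K \<ge> 1" "K \<ge> 1 / c" "K \<ge> 1 / \<eta>" 
  proof -
    have "1 / c > 0" "1 / \<eta> > 0" using c \<eta> by auto
    then show "K \<ge> K1" "K \<ge> 1" "K \<ge> 1 / c" "K \<ge> 1 / \<eta>" using K1 unfolding K_def by linarith+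
  qed
  have "norm (zeta_ext s) \<le> M \<and> norm (deriv zeta_ext s) \<le> M \<and> norm (zeta_ext s) \<ge> 1 / (128 * M ^ 11) \<and> Re s > 0"
    if t: "\<bar>Im s\<bar> \<ge> \<tau>" and M: "K * (1 + \<bar>Im s\<bar>) powr \<eta> \<le> M" and s: "1 - 1 / (256 * M ^ 12) \<le> Re s" "Re s \<le> 3" for M s
  proof -
    have p: "(1 + \<bar>Im s\<bar>) powr \<eta> \<ge> 1" using \<eta> by (intro ge_one_powr_ge_zero) auto
    have M0: "K \<le> M" using M mult_left_mono[OF p, of K] K(2) by linarith
    have M1: "M \<ge> 1" "M \<ge> 1 / c" "M \<ge> 1 / \<eta>" using M0 K by auto
    have MK1: "K1 * (1 + \<bar>Im s\<bar>) powr \<eta> \<le> M" using M mult_right_mono[OF K(1), of "(1 + \<bar>Im s\<bar>) powr \<eta>"] by auto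
    \<comment> \<open>The distance \<open>v\<close> is made a fourth power because the 3-4-1
      inequality yields \<open>v ^ 3 \<le> (M ^ 2 * norm (zeta_ext z)) ^ 4\<close>, whose fourth
      root is then \<open>w ^ 3 \<le> M ^ 2 * norm (zeta_ext z)\<close>.\<close>
    define w where "w = 1 / (4 * M ^ 3)"
    define v where "v = w ^ 4"
    have M3: "1 \<le> M ^ 3" using M1(1) by (rule one_le_power)
    have M0': "M > 0" using M1(1) by linarith
    have w: "w > 0" "w \<le> 1" using M3 M0' by (simp_all add: w_def divide_le_eq_1)
    have v_eq: "v = 1 / (256 * M ^ 12)" by (simp add: v_def w_def power_divide power_mult_distrib flip: power_mult)
    have v: "v > 0" "v \<le> 1" using w by (auto simp: v_def power_le_one)
    have "M ^ 1 \<le> M ^ 12" using M1 by (intro power_increasing) auto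
    then have "\<eta> * M \<le> \<eta> * M ^ 12" using \<eta> by (intro mult_left_mono) auto
    moreover have "1 \<le> \<eta> * M" using M1(3) \<eta> by (simp add: field_simps)
    ultimately have "1 \<le> \<eta> * M ^ 12" by linarith
    then have v\<eta>: "v \<le> \<eta> / 4" using M0' unfolding v_eq by (simp add: field_simps)
    have s': "1 - v \<le> Re s" using s v_eq by simp
    have bb: "norm (zeta_ext z) \<le> M \<and> norm (deriv zeta_ext z) \<le> M \<and> norm (zeta_ext (Complex (Re z) (2 * Im z))) \<le> M \<and>
        (Re z > 1 \<longrightarrow> norm (zeta_ext (of_real (Re z))) \<le> M / (Re z - 1))" if "Im z = Im s" "1 - v \<le> Re z" "Re z \<le> 3" for z
      using b[of z M] that t MK1 v\<eta> by auto
    have far: "norm (zeta_ext z) \<ge> 1 / (64 * M ^ 11)" if z: "Im z = Im s" "1 + v \<le> Re z" "Re z \<le> 3" for z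
    proof -
      have r: "Re z > 1" using z v by auto
      have nz: "norm (zeta_ext (of_real (Re z))) \<le> M / v"
      proof -
        have "norm (zeta_ext (of_real (Re z))) \<le> M / (Re z - 1)" using bb[of z] z v r by auto
        also have "\<dots> \<le> M / v" using z v M1 by (intro divide_left_mono) auto
        finally show ?thesis .
      qed
      have "c \<le> norm (zeta_ext (of_real (Re z))) ^ 3 * norm (zeta_ext z) ^ 4 * norm (zeta_ext (Complex (Re z) (2 * Im z)))"
        using c(2)[OF r, of "Im z"] r by (simp add: zeta_ext_eq)
      also have "\<dots> \<le> (M / v) ^ 3 * norm (zeta_ext z) ^ 4 * M"
        using bb[of z] z v nz M0' by (intro mult_mono power_mono) (auto intro!: mult_nonneg_nonneg divide_nonneg_nonneg)
      finally have 1: "c * v ^ 3 \<le> M ^ 4 * norm (zeta_ext z) ^ 4" using v by (simp add: field_simps eval_nat_numeral)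
      have "1 \<le> c * M ^ 4"
      proof -
        have "1 \<le> c * M" using M1 c by (simp add: field_simps)
        moreover have "M ^ 1 \<le> M ^ 4" using M1 by (intro power_increasing) auto
        ultimately show ?thesis using c by (smt (verit) mult_left_mono power_one_right)
      qed
      then have "v ^ 3 * 1 \<le> v ^ 3 * (c * M ^ 4)" using v by (intro mult_left_mono) auto
      also have "\<dots> \<le> M ^ 4 * (M ^ 4 * norm (zeta_ext z) ^ 4)" using mult_left_mono[OF 1, of "M ^ 4"] M1 by (simp add: mult_ac)
      finally have 2: "v ^ 3 \<le> M ^ 4 * (M ^ 4 * norm (zeta_ext z) ^ 4)" by simp
      have "(w ^ 3) ^ 4 = v ^ 3" by (simp add: v_def flip: power_mult)
      moreover have "(M ^ 2 * norm (zeta_ext z)) ^ 4 = M ^ 4 * (M ^ 4 * norm (zeta_ext z) ^ 4)"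
        by (simp add: eval_nat_numeral mult_ac)
      ultimately have "(w ^ 3) ^ Suc 3 \<le> (M ^ 2 * norm (zeta_ext z)) ^ Suc 3" using 2 by simp
      then have "w ^ 3 \<le> M ^ 2 * norm (zeta_ext z)" by (rule power_le_imp_le_base) simp
      moreover have "w ^ 3 = 1 / (64 * M ^ 9)" by (simp add: w_def power_divide power_mult_distrib flip: power_mult)
      ultimately have "1 / (64 * M ^ 9) / M ^ 2 \<le> norm (zeta_ext z)" using M1 by (simp add: field_simps)
      moreover have "1 / (64 * M ^ 9) / M ^ 2 = 1 / (64 * M ^ 11)" by (simp add: eval_nat_numeral mult_ac)
      ultimately show ?thesis by linarith
    qed
    have low: "norm (zeta_ext s) \<ge> 1 / (128 * M ^ 11)"
    proof (cases "Re s \<ge> 1 + v")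
      case True
      then have "1 / (64 * M ^ 11) \<le> norm (zeta_ext s)" using s by (intro far) auto
      moreover have "1 / (128 * M ^ 11) \<le> 1 / (64 * M ^ 11)" using M1 by (intro divide_left_mono) auto
      ultimately show ?thesis by linarith
    next
      case False
      \<comment> \<open>The point at distance \<open>v\<close> to the right of the line, at the same
        height. Moving from it to \<open>s\<close> costs at most \<open>2 * v * M\<close>, half of
        the lower bound that \<open>far\<close> gives there.\<close>
      define s1 where "s1 = Complex (1 + v) (Im s)"
      let ?S = "{z. 1 - v \<le> Re z} \<inter> {z. Re z \<le> 3} \<inter> {z. Im z \<le> Im s} \<inter> {z. Im z \<ge> Im s}"
      have "norm (zeta_ext s - zeta_ext s1) \<le> M * norm (s - s1)"
      proof (rule field_differentiable_bound)
        show "convex ?S"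
          by (intro convex_Int convex_halfspace_Re_ge convex_halfspace_Re_le convex_halfspace_Im_le convex_halfspace_Im_ge)
        show "s \<in> ?S" "s1 \<in> ?S" using s s' v by (auto simp: s1_def)
        fix z assume z: "z \<in> ?S"
        then show "norm (deriv zeta_ext z) \<le> M" using bb[of z] by auto
        have "z \<in> {s. Re s > 0} - {1}" using z t \<tau> v v\<eta> \<eta> by auto
        from holomorphic_derivI[OF zeta_ext_holomorphic open_Re_minus1 this]
        show "(zeta_ext has_field_derivative deriv zeta_ext z) (at z within ?S)" .
      qed
      moreover have "norm (s - s1) \<le> 2 * v"
      proof -
        have "s - s1 = of_real (Re s - (1 + v))" by (simp add: s1_def complex_eq_iff)
        then have "norm (s - s1) = \<bar>Re s - (1 + v)\<bar>" by (simp only: norm_of_real)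
        then show ?thesis using False s s' by auto
      qed
      ultimately have "norm (zeta_ext s - zeta_ext s1) \<le> M * (2 * v)" using M1 by (smt (verit) mult_left_mono)
      also have "M * (2 * v) = 1 / (128 * M ^ 11)" using M1 unfolding v_eq by (simp add: field_simps eval_nat_numeral)
      finally have "norm (zeta_ext s - zeta_ext s1) \<le> 1 / (128 * M ^ 11)" .
      moreover have "1 / (64 * M ^ 11) \<le> norm (zeta_ext s1)" using v by (intro far) (auto simp: s1_def)
      moreover have "1 / (64 * M ^ 11) = 2 * (1 / (128 * M ^ 11))" by simp
      moreover have "norm (zeta_ext s1) \<le> norm (zeta_ext s) + norm (zeta_ext s - zeta_ext s1)"
        by (metis norm_triangle_sub norm_minus_commute)
      ultimately show ?thesis by linarith
    qed
    have "Re s > 0" using s' v\<eta> \<eta> by linarith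
    then show ?thesis using low bb[of s] s s' by auto
  qed
  then show ?thesis using K(2) by blast
qed

text \<open>Three cases: the exponential formula for \<open>Re s > 1\<close>, the value 1 at
  \<open>s = 1\<close>, and elsewhere on the line the quantitative lower bound, with
  \<open>\<tau>\<close> adapted to the height of the point.\<close>

lemma zeta_E_nonzero:
  assumes "Re s \<ge> 1" shows "zeta_E s \<noteq> 0"
proof (cases "Re s > 1")
  case True
  then show ?thesis using zeta_E_eq_zeta[OF True] zeta_nonzero[OF True] by auto
next
  case False
  then have r: "Re s = 1" using assms by auto
  show ?thesis
  proof (cases "s = 1")
    case False
    then have i: "Im s \<noteq> 0" using r by (auto simp: complex_eq_iff)
    obtain K where K: "K \<ge> 1" "\<And>M s'. \<bar>Im s'\<bar> \<ge> min 1 \<bar>Im s\<bar> \<Longrightarrow> K * (1 + \<bar>Im s'\<bar>) powr 1 \<le> M \<Longrightarrow> 1 - 1 / (256 * M ^ 12) \<le> Re s' \<Longrightarrow> Re s' \<le> 3 \<Longrightarrow>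
     norm (zeta_ext s') \<le> M \<and> norm (deriv zeta_ext s') \<le> M \<and> norm (zeta_ext s') \<ge> 1 / (128 * M ^ 11) \<and> Re s' > 0"
      using zeta_ext_lower[of 1 "min 1 \<bar>Im s\<bar>"] i by (auto simp del: powr_one)
    define M where "M = K * (1 + \<bar>Im s\<bar>)"
    have "M > 0" using K(1) by (auto simp: M_def intro!: mult_pos_pos)
    then have "norm (zeta_ext s) \<ge> 1 / (128 * M ^ 11)" using K(2)[of s M] r K(1) by (auto simp: M_def)
    moreover have "1 / (128 * M ^ 11) > 0" using \<open>M > 0\<close> by simp
    ultimately have "zeta_ext s \<noteq> 0" by auto
    then show ?thesis by (auto simp: zeta_ext_def)
  qed simp
qed

section \<open>The difference of the logarithmic derivative and zeta, regular at 1\<close>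

definition zeta_reg :: "complex \<Rightarrow> complex" where
  "zeta_reg s = (if s = 1 then deriv zeta_E 1 else (zeta_E s - zeta_E 1) / (s - 1))"

text \<open>This is \<open>- \<zeta>'/\<zeta> - \<zeta>\<close> with the pole removed. In terms of
  \<open>zeta_E\<close> the first summand is \<open>- deriv zeta_E / zeta_E + 1 / (s - 1)\<close>,
  and \<open>zeta_reg\<close> is \<open>zeta_ext s - 1 / (s - 1)\<close> with its removable
  singularity filled in, so the two polar parts cancel.\<close>

definition zdiff :: "complex \<Rightarrow> complex" where "zdiff s = - deriv zeta_E s / zeta_E s - zeta_reg s"

text \<open>An open set which by \<open>zeta_E_nonzero\<close> contains the closed half-plane
  \<open>Re s \<ge> 1\<close>, so that derivatives on the boundary line make sense.\<close>

definition zdom :: "complex set" where "zdom = {s. Re s > 0} \<inter> zeta_E -` (- {0})"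

lemma open_zdom: "open zdom"
  unfolding zdom_def
  by (rule continuous_open_preimage[OF holomorphic_on_imp_continuous_on[OF zeta_E_holomorphic] open_halfspace_Re_gt]) auto

lemma zdiff_holomorphic: "zdiff holomorphic_on zdom"
proof -
  have sub: "zdom \<subseteq> {s. Re s > 0}" by (auto simp: zdom_def)
  have g: "zeta_reg holomorphic_on zdom"
    by (rule holomorphic_on_subset[OF _ sub])
      (unfold zeta_reg_def[abs_def], rule pole_lemma_open[OF zeta_E_holomorphic open_halfspace_Re_gt])
  have d: "deriv zeta_E holomorphic_on zdom"
    by (rule holomorphic_on_subset[OF holomorphic_deriv[OF zeta_E_holomorphic open_halfspace_Re_gt] sub])
  have e: "zeta_E holomorphic_on zdom" by (rule holomorphic_on_subset[OF zeta_E_holomorphic sub])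
  show ?thesis
    unfolding zdiff_def[abs_def] by (intro holomorphic_intros g d e) (auto simp: zdom_def)
qed

lemma zdiff_eq:
  assumes "s \<in> zdom" "s \<noteq> 1"
  shows "zdiff s = - deriv zeta_ext s / zeta_ext s - zeta_ext s"
proof -
  have s: "Re s > 0" "zeta_E s \<noteq> 0" using assms by (auto simp: zdom_def)
  have "(zeta_E has_field_derivative deriv zeta_E s) (at s)"
    by (rule holomorphic_derivI[OF zeta_E_holomorphic open_halfspace_Re_gt]) (use s in auto)
  then have "(zeta_ext has_field_derivative (deriv zeta_E s * (s - 1) - zeta_E s) / ((s - 1) * (s - 1))) (at s)"
    unfolding zeta_ext_def[abs_def] using assms(2) by (auto intro!: derivative_eq_intros)
  then have "deriv zeta_ext s = (deriv zeta_E s * (s - 1) - zeta_E s) / ((s - 1) * (s - 1))" by (rule DERIV_imp_deriv)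
  then show ?thesis using s assms(2)
    by (simp add: zdiff_def zeta_reg_def zeta_ext_def divide_simps) (simp add: algebra_simps)?
qed

lemma zdiff_dseries:
  assumes "Re s > 1" shows "zdiff s = dseries (\<lambda>n. mangoldt n - one_coeff n) s"
proof -
  have "s \<in> zdom" "s \<noteq> 1" using assms zeta_E_nonzero[of s] by (auto simp: zdom_def)
  then have 1: "zdiff s = - deriv zeta_ext s / zeta_ext s - zeta_ext s" by (rule zdiff_eq)
  have "(zeta_ext has_field_derivative - dseries (\<lambda>n. ln (real n)) s) (at s)"
    by (rule has_field_derivative_transform_within_open[OF zeta_deriv[OF assms] open_Re_gt[of 1]])
      (use assms in \<open>auto simp: zeta_ext_eq\<close>)
  then have 2: "deriv zeta_ext s = - dseries (\<lambda>n. ln (real n)) s" by (rule DERIV_imp_deriv)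
  show ?thesis unfolding 1 2 dseries_diff[OF dconv_mangoldt dconv_one_coeff assms] zeta_ext_eq[OF assms] 
    using mangoldt_convolution[OF assms] zeta_nonzero[OF assms] by (simp add: field_simps)
qed

lemma dconv_mangoldt_minus_one: "dconv (\<lambda>n. mangoldt n - one_coeff n)"
  using dconv_add[OF dconv_mangoldt dconv_uminus[OF dconv_one_coeff]] by simp

definition mdiff :: "nat \<Rightarrow> real" where "mdiff n = (mangoldt n - one_coeff n) * (ln (real n))^2"

lemma mdiff_eq: "(\<lambda>n. - (- (mangoldt n - one_coeff n) * ln (real n)) * ln (real n)) = mdiff"
  by (simp add: mdiff_def fun_eq_iff power2_eq_square algebra_simps)

lemma dconv_mdiff: "dconv mdiff"
  using dconv_ln[OF dconv_ln[OF dconv_mangoldt_minus_one]] unfolding mdiff_eq .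

lemma zdiff_deriv2:
  assumes "Re s > 1" shows "(deriv ^^ 2) zdiff s = dseries mdiff s"
proof -
  let ?S = "{s. Re s > 1}"
  let ?a = "\<lambda>n. mangoldt n - one_coeff n :: real"
  have sub: "?S \<subseteq> zdom" using zeta_E_nonzero by (auto simp: zdom_def)
  have d: "deriv (dseries ?a) z = dseries (\<lambda>n. - ?a n * ln (real n)) z" if "z \<in> ?S" for z
    using that by (intro DERIV_imp_deriv dseries_deriv[OF dconv_mangoldt_minus_one]) auto
  have "(deriv ^^ 2) zdiff s = (deriv ^^ 2) (dseries ?a) s"
  proof (rule higher_deriv_transform_within_open[of _ ?S])
    show "zdiff holomorphic_on ?S" using holomorphic_on_subset[OF zdiff_holomorphic sub] .
    show "dseries ?a holomorphic_on ?S"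
      using dseries_deriv[OF dconv_mangoldt_minus_one] by (auto simp: holomorphic_on_open open_Re_gt)
  qed (use assms zdiff_dseries open_Re_gt in auto)
  also have "\<dots> = deriv (deriv (dseries ?a)) s" by (simp add: eval_nat_numeral)
  also have "\<dots> = dseries (\<lambda>n. - (- ?a n * ln (real n)) * ln (real n)) s"
  proof (rule DERIV_imp_deriv)
    show "(deriv (dseries ?a) has_field_derivative dseries (\<lambda>n. - (- ?a n * ln (real n)) * ln (real n)) s) (at s)"
      by (rule has_field_derivative_transform_within_open[OF dseries_deriv[OF dconv_ln[OF dconv_mangoldt_minus_one] assms] open_Re_gt[of 1]])
        (use assms d in auto)
  qed
  finally show ?thesis unfolding mdiff_eq .
qed

text \<open>
  Cauchy's inequality on a disc of radius \<open>1 / (512 M\<^bsup>12\<^esup>)\<close> costs \<open>M\<^bsup>36\<^esup>\<close> in all, which is \<open>\<bar>t\<bar>\<^bsup>1/2\<^esup>\<close> for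
  the exponent \<open>\<eta> = 1/72\<close>.
\<close>
theorem dseries_mdiff_bound:
  "\<exists>C. \<forall>s. 1 < Re s \<longrightarrow> Re s \<le> 2 \<longrightarrow> norm (dseries mdiff s) \<le> C * (1 + \<bar>Im s\<bar>) powr (1/2)"
proof -
  \<comment> \<open>At heights below 1 the bounds for zeta degenerate near its pole, but
    \<open>zdiff\<close> is holomorphic around this compact rectangle, closed at
    \<open>Re s = 1\<close>, and a constant suffices.\<close>
  define X where "X = cbox (Complex 1 (-1)) (Complex 2 1)"
  have X: "s \<in> X \<longleftrightarrow> 1 \<le> Re s \<and> Re s \<le> 2 \<and> \<bar>Im s\<bar> \<le> 1" for s
    by (auto simp: X_def in_cbox_complex_iff)
  have "X \<subseteq> zdom" using zeta_E_nonzero by (auto simp: X zdom_def)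
  then have "continuous_on X ((deriv ^^ 2) zdiff)"
    by (intro holomorphic_on_imp_continuous_on holomorphic_on_subset[OF holomorphic_higher_deriv[OF zdiff_holomorphic open_zdom]])
  then have "bounded ((deriv ^^ 2) zdiff ` X)"
    by (intro compact_imp_bounded compact_continuous_image) (auto simp: X_def)
  then obtain C0 where C0: "\<And>s. s \<in> X \<Longrightarrow> norm ((deriv ^^ 2) zdiff s) \<le> C0" by (auto simp: bounded_iff)
  define \<eta> where "\<eta> = (1/72 :: real)"
  have \<eta>: "0 < \<eta>" "\<eta> \<le> 1" by (auto simp: \<eta>_def)
  obtain K where K: "K \<ge> 1" "\<And>M s. \<bar>Im s\<bar> \<ge> 1/2 \<Longrightarrow> K * (1 + \<bar>Im s\<bar>) powr \<eta> \<le> M \<Longrightarrow> 1 - 1 / (256 * M ^ 12) \<le> Re s \<Longrightarrow> Re s \<le> 3 \<Longrightarrow>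
     norm (zeta_ext s) \<le> M \<and> norm (deriv zeta_ext s) \<le> M \<and> norm (zeta_ext s) \<ge> 1 / (128 * M ^ 11) \<and> Re s > 0"
    using zeta_ext_lower[OF \<eta>, of "1/2"] by auto
  \<comment> \<open>Here 2 is \<open>fact 2\<close>; 129 bounds \<open>zdiff\<close> by
    \<open>129 * M ^ 12\<close>, with 128 from the quotient and 1 from zeta; \<open>512^2\<close>
    comes from the squared radius; and 3 from comparing \<open>3 + |t|\<close> with
    \<open>1 + |t|\<close>.\<close>
  define C1 where "C1 = 2 * 129 * 512^2 * K ^ 36 * 3"
  have big: "norm ((deriv ^^ 2) zdiff s) \<le> C1 * (1 + \<bar>Im s\<bar>) powr (1/2)" if s: "1 < Re s" "Re s \<le> 2" "\<bar>Im s\<bar> \<ge> 1" for s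
  proof -
    \<comment> \<open>The 3 in place of 1 leaves room for heights to vary, so that this
      \<open>M\<close> is admissible on the whole disc around \<open>s\<close>.\<close>
    define M where "M = K * (3 + \<bar>Im s\<bar>) powr \<eta>"
    have p: "(3 + \<bar>Im s\<bar>) powr \<eta> \<ge> 1" using \<eta> by (intro ge_one_powr_ge_zero) auto
    have M1: "M \<ge> 1" unfolding M_def using K(1) p by (metis mult_mono' mult_1 zero_le_one)
    define r where "r = 1 / (512 * M ^ 12)"
    have M12: "M ^ 12 \<ge> 1" using M1 by simp
    have r: "r > 0" "r \<le> 1 / 512" "r \<le> 1 / (256 * M ^ 12)" using M12 by (auto simp: r_def divide_simps)
    have all: "norm (zeta_ext w) \<le> M \<and> norm (deriv zeta_ext w) \<le> M \<and> norm (zeta_ext w) \<ge> 1 / (128 * M ^ 11) \<and> Re w > 0 \<and> w \<noteq> 1"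
      if w: "norm (s - w) \<le> r" for w
    proof -
      have "\<bar>Re s - Re w\<bar> \<le> r" "\<bar>Im s - Im w\<bar> \<le> r" using abs_Re_le_cmod[of "s - w"] abs_Im_le_cmod[of "s - w"] w by auto
      then have h: "1 - r \<le> Re w" "Re w \<le> 3" "\<bar>Im w\<bar> \<ge> 1/2" "\<bar>Im w\<bar> \<le> \<bar>Im s\<bar> + 1" using s r by auto
      have "(1 + \<bar>Im w\<bar>) powr \<eta> \<le> (3 + \<bar>Im s\<bar>) powr \<eta>" using h \<eta> by (intro powr_mono2) auto
      then have "K * (1 + \<bar>Im w\<bar>) powr \<eta> \<le> M" unfolding M_def using K(1) by (intro mult_left_mono) auto
      then show ?thesis using K(2)[of w M] h r by auto
    qed
    have pos: "1 / (128 * M ^ 11) > 0" using M1 by auto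
    have sub: "cball s r \<subseteq> zdom"
    proof
      fix w assume "w \<in> cball s r"
      then have "norm (s - w) \<le> r" by (simp add: dist_norm)
      from all[OF this] pos show "w \<in> zdom" by (auto simp: zdom_def zeta_ext_def)
    qed
    have "norm ((deriv ^^ 2) zdiff s) \<le> fact 2 * (129 * M ^ 12) / r ^ 2"
    proof (rule Cauchy_inequality)
      show "zdiff holomorphic_on ball s r"
        by (rule holomorphic_on_subset[OF zdiff_holomorphic]) (use sub ball_subset_cball in blast)
      show "continuous_on (cball s r) zdiff"
        using continuous_on_subset[OF holomorphic_on_imp_continuous_on[OF zdiff_holomorphic] sub] .
      fix w assume w: "norm (s - w) = r"
      then have a: "norm (zeta_ext w) \<le> M" "norm (deriv zeta_ext w) \<le> M" "norm (zeta_ext w) \<ge> 1 / (128 * M ^ 11)" "w \<noteq> 1" "w \<in> zdom"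
        using all[of w] sub by (auto simp: dist_norm)
      have "norm (zdiff w) \<le> norm (deriv zeta_ext w) / norm (zeta_ext w) + norm (zeta_ext w)"
        unfolding zdiff_eq[OF a(5,4)] by (metis norm_divide norm_minus_cancel norm_triangle_ineq4)
      also have "\<dots> \<le> M / (1 / (128 * M ^ 11)) + M"
        using a pos M1 by (intro add_mono frac_le) auto
      finally have "norm (zdiff w) \<le> M / (1 / (128 * M ^ 11)) + M" .
      moreover have "M / (1 / (128 * M ^ 11)) = 128 * M ^ 12" by (simp add: eval_nat_numeral)
      moreover have "M \<le> M ^ 12" using power_increasing[of 1 12 M] M1 by simp
      ultimately show "norm (zdiff w) \<le> 129 * M ^ 12" by linarith
    qed (use r in auto)
    also have "\<dots> = 2 * 129 * 512^2 * M ^ 36"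
      by (simp add: r_def power_divide power_mult_distrib flip: power_mult power_add) (simp flip: power_add)?
    also have "M ^ 36 = K ^ 36 * (3 + \<bar>Im s\<bar>) powr (1/2)"
      by (simp add: M_def power_mult_distrib \<eta>_def powr_power)
    also have "(3 + \<bar>Im s\<bar>) powr (1/2) \<le> 3 * (1 + \<bar>Im s\<bar>) powr (1/2)"
      by (rule powr_scale_bound) auto
    finally show ?thesis using K(1) by (simp add: C1_def mult_ac)
  qed
  have "norm (dseries mdiff s) \<le> max C0 C1 * (1 + \<bar>Im s\<bar>) powr (1/2)" if s: "1 < Re s" "Re s \<le> 2" for s
  proof -
    have p: "(1 + \<bar>Im s\<bar>) powr (1/2) \<ge> 1" by (intro ge_one_powr_ge_zero) auto
    have C1: "C1 \<ge> 0" using K(1) by (simp add: C1_def)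
    show ?thesis
    proof (cases "\<bar>Im s\<bar> \<ge> 1")
      case True
      then show ?thesis using big[OF s True] p zdiff_deriv2[OF s(1)]
        by (smt (verit) mult_right_mono)
    next
      case False
      then have "norm (dseries mdiff s) \<le> C0" using C0[of s] s zdiff_deriv2[OF s(1)] by (simp add: X)
      then show ?thesis using p C1 by (smt (verit) mult_left_mono mult_cancel_left2)
    qed
  qed
  then show ?thesis by blast
qed

subsection \<open>Fourier inversion and the smoothed sum\<close>

lemma gauss_transform:
  "(\<integral>x. iexp (t * x) * of_real (std_normal_density x) \<partial>lborel) = of_real (exp (- t\<^sup>2 / 2))"
proof -
  have "char std_normal_distribution t = (CLINT x|std_normal_distribution. iexp (t * x))"
    by (simp add: char_def)
  also have "\<dots> = (\<integral>x. std_normal_density x *\<^sub>R iexp (t * x) \<partial>lborel)"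
    by (rule integral_density) (auto simp: normal_density_nonneg)
  also have "\<dots> = (\<integral>x. iexp (t * x) * of_real (std_normal_density x) \<partial>lborel)"
    by (simp add: scaleR_conv_of_real mult.commute)
  finally show ?thesis by (simp add: char_std_normal_distribution)
qed

lemma std_normal_density_le: "std_normal_density x \<le> 1 / sqrt (2 * pi)"
  by (simp add: std_normal_density_def divide_simps)

text \<open>
  Damping the integral by a Gaussian of growing width turns it into a Gaussian average of \<open>k\<close>;
  dominated convergence applies on both sides.
\<close>
theorem fourier_inversion:
  fixes k :: "real \<Rightarrow> complex"
  assumes k: "integrable lborel k" and bd: "\<And>v. norm (k v) \<le> B" and cont: "isCont k u"
    and hat: "\<And>t. kh t = (\<integral>v. k v * iexp (- (t * v)) \<partial>lborel)" and kh: "integrable lborel kh"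
  shows "(\<integral>t. kh t * iexp (t * u) \<partial>lborel) = of_real (2 * pi) * k u"
proof -
  note [measurable] = borel_measurable_integrable[OF k] borel_measurable_integrable[OF kh]
  let ?\<phi> = std_normal_density
  define J where "J n = (\<integral>t. kh t * iexp (t * u) * of_real (?\<phi> (t / real (Suc n))) \<partial>lborel)" for n :: nat
  have J1: "J \<longlonglongrightarrow> (\<integral>t. kh t * iexp (t * u) * of_real (1 / sqrt (2 * pi)) \<partial>lborel)"
    unfolding J_def
  proof (rule integral_dominated_convergence[where w = "\<lambda>t. norm (kh t) * (1 / sqrt (2 * pi))"])
    show "integrable lborel (\<lambda>t. norm (kh t) * (1 / sqrt (2 * pi)))" using kh by auto
    show "AE t in lborel. (\<lambda>n. kh t * iexp (t * u) * of_real (?\<phi> (t / real (Suc n)))) \<longlonglongrightarrow> kh t * iexp (t * u) * of_real (1 / sqrt (2 * pi))"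
    proof (rule AE_I2, intro tendsto_intros)
      fix t :: real
      have "(\<lambda>n. t / real (Suc n)) \<longlonglongrightarrow> 0" by real_asymp
      then have "(\<lambda>n. ?\<phi> (t / real (Suc n))) \<longlonglongrightarrow> 1 / sqrt (2 * pi) * exp (- 0\<^sup>2 / 2)"
        unfolding std_normal_density_def by (intro tendsto_intros) simp_all
      then show "(\<lambda>n. ?\<phi> (t / real (Suc n))) \<longlonglongrightarrow> 1 / sqrt (2 * pi)" by simp
    qed
    show "AE t in lborel. norm (kh t * iexp (t * u) * of_real (?\<phi> (t / real (Suc n)))) \<le> norm (kh t) * (1 / sqrt (2 * pi))" for n
      unfolding norm_mult norm_exp_i_times norm_of_real mult_1_right
      by (intro AE_I2 mult_left_mono) (simp_all only: abs_of_nonneg[OF normal_density_nonneg] std_normal_density_le norm_ge_zero)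
  qed measurable
  \<comment> \<open>By Fubini \<open>kh\<close> is traded for the transform of the widening
    Gaussian, which is a Gaussian of width \<open>1 / Suc n\<close> in \<open>v - u\<close>. The
    substitution \<open>v = u + w / Suc n\<close> then moves the scale into the argument of
    \<open>k\<close>.\<close>
  have J2: "J n = of_real (sqrt (2 * pi)) * (\<integral>w. k (u + w / real (Suc n)) * of_real (?\<phi> w) \<partial>lborel)" for n
  proof -
    let ?n = "real (Suc n)"
    have i\<phi>: "integrable lborel (\<lambda>t. ?\<phi> (t / ?n))"
    proof -
      have "integrable lborel (\<lambda>t. ?\<phi> (0 + (1 / ?n) * t))"
        by (rule lborel_integrable_real_affine[OF integrable_normal_density]) simp_all
      then show ?thesis by (simp del: of_nat_Suc)
    qed
    have "J n = (\<integral>t. (\<integral>v. k v * iexp (t * (u - v)) * of_real (?\<phi> (t / ?n)) \<partial>lborel) \<partial>lborel)"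
      unfolding J_def
    proof (intro Bochner_Integration.integral_cong refl)
      fix t :: real
      have "kh t * iexp (t * u) * of_real (?\<phi> (t / ?n)) = (\<integral>v. k v * iexp (- (t * v)) * (iexp (t * u) * of_real (?\<phi> (t / ?n))) \<partial>lborel)"
        unfolding hat Bochner_Integration.integral_mult_left_zero by (rule mult.assoc)
      also have "\<dots> = (\<integral>v. k v * iexp (t * (u - v)) * of_real (?\<phi> (t / ?n)) \<partial>lborel)"
        by (intro Bochner_Integration.integral_cong refl) (simp add: right_diff_distrib mult_exp_exp)
      finally show "kh t * iexp (t * u) * of_real (?\<phi> (t / ?n)) = (\<integral>v. k v * iexp (t * (u - v)) * of_real (?\<phi> (t / ?n)) \<partial>lborel)" .
    qed
    also have "\<dots> = (\<integral>v. (\<integral>t. k v * iexp (t * (u - v)) * of_real (?\<phi> (t / ?n)) \<partial>lborel) \<partial>lborel)"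
    proof (rule lborel_pair.Fubini_integral, rule lborel_pair.Fubini_integrable, goal_cases)
      case 1
      show ?case by measurable
    next
      case 2
      have "(\<lambda>v. \<integral>t. norm (k v) * ?\<phi> (t / ?n) \<partial>lborel) = (\<lambda>v. norm (k v) * (\<integral>t. ?\<phi> (t / ?n) \<partial>lborel))"
        by simp
      then show ?case using k by (simp add: norm_mult normal_density_nonneg)
    next
      case 3
      show ?case
      proof (rule AE_I2)
        fix v :: real
        have "integrable lborel (\<lambda>t. norm (k v) * ?\<phi> (t / ?n))" using i\<phi> by simp
        then show "integrable lborel (\<lambda>t. case (v, t) of (v, t) \<Rightarrow> k v * iexp (t * (u - v)) * of_real (?\<phi> (t / ?n)))"
          by (rule Bochner_Integration.integrable_bound) (auto simp: norm_mult normal_density_nonneg)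
      qed
    qed
    also have "\<dots> = (\<integral>v. k v * of_real (?n * sqrt (2 * pi) * ?\<phi> (?n * (v - u))) \<partial>lborel)"
    proof (intro Bochner_Integration.integral_cong refl)
      fix v :: real
      have "(\<integral>t. iexp (t * (u - v)) * of_real (?\<phi> (t / ?n)) \<partial>lborel)
        = ?n *\<^sub>R (\<integral>x. iexp ((0 + ?n * x) * (u - v)) * of_real (?\<phi> ((0 + ?n * x) / ?n)) \<partial>lborel)"
        using lborel_integral_real_affine[of ?n "\<lambda>t. iexp (t * (u - v)) * of_real (?\<phi> (t / ?n))" 0] by (simp del: of_nat_Suc)
      also have "\<dots> = ?n *\<^sub>R (\<integral>x. iexp ((?n * (u - v)) * x) * of_real (?\<phi> x) \<partial>lborel)"
        by (intro arg_cong2[where f = scaleR] refl Bochner_Integration.integral_cong) (simp add: mult_ac del: of_nat_Suc)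
      also have "\<dots> = of_real (?n * exp (- (?n * (u - v))\<^sup>2 / 2))"
        unfolding gauss_transform by (simp add: scaleR_conv_of_real del: of_nat_Suc)
      also have "exp (- (?n * (u - v))\<^sup>2 / 2) = sqrt (2 * pi) * ?\<phi> (?n * (v - u))"
      proof -
        have "(?n * (u - v))\<^sup>2 = (?n * (v - u))\<^sup>2" by (simp add: power_mult_distrib power2_commute)
        then show ?thesis by (simp add: std_normal_density_def)
      qed
      finally show "(\<integral>t. k v * iexp (t * (u - v)) * of_real (?\<phi> (t / ?n)) \<partial>lborel) = k v * of_real (?n * sqrt (2 * pi) * ?\<phi> (?n * (v - u)))"
        by (simp add: mult.assoc)
    qed
    also have "\<dots> = \<bar>1 / ?n\<bar> *\<^sub>R (\<integral>w. k (u + 1 / ?n * w) * of_real (?n * sqrt (2 * pi) * ?\<phi> (?n * (u + 1 / ?n * w - u))) \<partial>lborel)"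
      by (rule lborel_integral_real_affine) simp
    also have "\<dots> = (1 / ?n) *\<^sub>R (\<integral>w. of_real (?n * sqrt (2 * pi)) * (k (u + w / ?n) * of_real (?\<phi> w)) \<partial>lborel)"
      by (intro arg_cong2[where f = scaleR] Bochner_Integration.integral_cong) (simp_all add: mult_ac del: of_nat_Suc)
    also have "\<dots> = of_real (sqrt (2 * pi)) * (\<integral>w. k (u + w / ?n) * of_real (?\<phi> w) \<partial>lborel)"
      by (simp add: scaleR_conv_of_real del: of_nat_Suc)
    finally show ?thesis .
  qed
  have "(\<lambda>n. \<integral>w. k (u + w / real (Suc n)) * of_real (?\<phi> w) \<partial>lborel) \<longlonglongrightarrow> (\<integral>w. k u * of_real (?\<phi> w) \<partial>lborel)"
  proof (rule integral_dominated_convergence[where w = "\<lambda>w. B * ?\<phi> w"])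
    show "integrable lborel (\<lambda>w. B * ?\<phi> w)" by auto
    show "AE w in lborel. (\<lambda>n. k (u + w / real (Suc n)) * of_real (?\<phi> w)) \<longlonglongrightarrow> k u * of_real (?\<phi> w)"
    proof (rule AE_I2, intro tendsto_intros)
      fix w :: real
      have "(\<lambda>n. u + w / real (Suc n)) \<longlonglongrightarrow> u" by real_asymp
      then show "(\<lambda>n. k (u + w / real (Suc n))) \<longlonglongrightarrow> k u" by (rule isCont_tendsto_compose[OF cont])
    qed
    show "AE w in lborel. norm (k (u + w / real (Suc n)) * of_real (?\<phi> w)) \<le> B * ?\<phi> w" for n
      using bd by (intro AE_I2) (auto simp: norm_mult normal_density_nonneg intro!: mult_right_mono)
  qed measurable
  also have "(\<integral>w. k u * of_real (?\<phi> w) \<partial>lborel) = k u"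
    unfolding Bochner_Integration.integral_mult_right_zero integral_complex_of_real by simp
  finally have "J \<longlonglongrightarrow> of_real (sqrt (2 * pi)) * k u" unfolding J2[abs_def] by (intro tendsto_intros)
  from LIMSEQ_unique[OF J1 this]
  have "(\<integral>t. kh t * iexp (t * u) \<partial>lborel) * of_real (1 / sqrt (2 * pi)) = of_real (sqrt (2 * pi)) * k u" by simp
  then have "(\<integral>t. kh t * iexp (t * u) \<partial>lborel) = of_real (sqrt (2 * pi)) * of_real (sqrt (2 * pi)) * k u"
    by (simp add: field_simps)
  then show ?thesis by (simp flip: of_real_mult)
qed

section \<open>The kernel of the smoothed sum and its transform\<close>

lemma integrable_exp_half:
  assumes "a > 0" shows "integrable lborel (\<lambda>v. indicator {0<..} v *\<^sub>R exp (- a * v) :: real)"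
proof -
  have "(\<integral>\<^sup>+v. ennreal (exp (- a * v)) * indicator {0..} v \<partial>lborel) = ennreal (0 - (- exp (- a * 0) / a))"
  proof (rule nn_integral_FTC_atLeast)
    show "((\<lambda>v. - exp (- a * v) / a) has_real_derivative exp (- a * v)) (at v)" for v
      using assms by (auto intro!: derivative_eq_intros)
    show "((\<lambda>v. - exp (- a * v) / a) \<longlongrightarrow> 0) at_top" using assms by real_asymp
  qed auto
  then have fin: "(\<integral>\<^sup>+v. ennreal (exp (- a * v)) * indicator {0..} v \<partial>lborel) < \<infinity>" by simp
  show ?thesis
  proof (rule integrableI_bounded)
    have "(\<integral>\<^sup>+v. ennreal (norm (indicator {0<..} v *\<^sub>R exp (- a * v) :: real)) \<partial>lborel) \<le> (\<integral>\<^sup>+v. ennreal (exp (- a * v)) * indicator {0..} v \<partial>lborel)"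
      by (intro nn_integral_mono) (auto split: split_indicator)
    then show "(\<integral>\<^sup>+v. ennreal (norm (indicator {0<..} v *\<^sub>R exp (- a * v) :: real)) \<partial>lborel) < \<infinity>"
      using fin by (rule le_less_trans)
  qed measurable
qed

lemma integral_exp_half:
  assumes "Re s > 0"
  shows "integrable lborel (\<lambda>v. indicator {0<..} v *\<^sub>R exp (- s * of_real v))"
    "(\<integral>v. indicator {0<..} v *\<^sub>R exp (- s * of_real v) \<partial>lborel) = 1 / s"
proof -
  have s0: "s \<noteq> 0" using assms by auto
  show i: "integrable lborel (\<lambda>v. indicator {0<..} v *\<^sub>R exp (- s * of_real v))"
    by (rule Bochner_Integration.integrable_bound[OF integrable_exp_half[OF assms]])
      (auto split: split_indicator)
  have "(LBINT v=ereal 0..\<infinity>. exp (- s * of_real v)) = 0 - (- exp (- s * of_real 0) / s)"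
  proof (rule interval_integral_FTC_integrable)
    show "((\<lambda>v. - exp (- s * of_real v) / s) has_vector_derivative exp (- s * of_real x)) (at x)" for x
    proof -
      have "((\<lambda>z. - exp (- s * z) / s) has_field_derivative exp (- s * of_real x)) (at (of_real x))"
        using s0 by (auto intro!: derivative_eq_intros)
      from has_vector_derivative_real_field[OF this] show ?thesis .
    qed
    show "isCont (\<lambda>v. exp (- s * of_real v)) x" for x by (intro continuous_intros)
    show "set_integrable lborel (einterval (ereal 0) \<infinity>) (\<lambda>v. exp (- s * of_real v))"
      using i by (simp add: set_integrable_def)
    have "((\<lambda>v. - exp (- s * of_real v) / s) \<longlongrightarrow> - exp (- s * of_real 0) / s) (at_right 0)"
      using s0 by (intro tendsto_intros) auto
    then show "(((\<lambda>v. - exp (- s * of_real v) / s) \<circ> real_of_ereal) \<longlongrightarrow> - exp (- s * of_real 0) / s) (at_right (ereal 0))"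
      by (simp only: ereal_tendsto_simps)
    have "((\<lambda>v. norm (- exp (- s * of_real v) / s)) \<longlongrightarrow> 0) at_top"
    proof -
      have "((\<lambda>v. exp (- Re s * v) / norm s) \<longlongrightarrow> 0) at_top" using assms s0 by real_asymp
      then show ?thesis by (simp add: norm_divide)
    qed
    then have "((\<lambda>v. - exp (- s * of_real v) / s) \<longlongrightarrow> 0) at_top" by (rule tendsto_norm_zero_cancel)
    then show "(((\<lambda>v. - exp (- s * of_real v) / s) \<circ> real_of_ereal) \<longlongrightarrow> 0) (at_left \<infinity>)"
      by (simp only: ereal_tendsto_simps)
  qed auto
  then show "(\<integral>v. indicator {0<..} v *\<^sub>R exp (- s * of_real v) \<partial>lborel) = 1 / s"
    by (simp add: interval_integral_to_infinity_eq set_lebesgue_integral_def)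
qed

lemma integrable_powr_32: "integrable lborel (\<lambda>t::real. (1 + \<bar>t\<bar>) powr (-3/2))"
proof -
  let ?f = "\<lambda>t::real. indicator {0..} t *\<^sub>R (1 + t) powr (-3/2)"
  have "(\<integral>\<^sup>+t. ennreal ((1 + t) powr (-3/2)) * indicator {0..} t \<partial>lborel) = ennreal (0 - (- 2 * (1 + 0) powr (-1/2)))"
  proof (rule nn_integral_FTC_atLeast)
    show "((\<lambda>t. - 2 * (1 + t) powr (-1/2)) has_real_derivative (1 + t) powr (-3/2)) (at t)" if "0 \<le> t" for t :: real
      using that by (auto intro!: derivative_eq_intros)
    show "((\<lambda>t::real. - 2 * (1 + t) powr (-1/2)) \<longlongrightarrow> 0) at_top" by real_asymp
  qed auto
  then have fin: "(\<integral>\<^sup>+t. ennreal ((1 + t) powr (-3/2)) * indicator {0..} t \<partial>lborel) < \<infinity>" by simp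
  have f: "integrable lborel ?f"
  proof (rule integrableI_bounded)
    have "(\<integral>\<^sup>+t. ennreal (norm (?f t)) \<partial>lborel) = (\<integral>\<^sup>+t. ennreal ((1 + t) powr (-3/2)) * indicator {0..} t \<partial>lborel)"
      by (intro nn_integral_cong) (auto split: split_indicator)
    then show "(\<integral>\<^sup>+t. ennreal (norm (?f t)) \<partial>lborel) < \<infinity>" using fin by simp
  qed measurable
  have "integrable lborel (\<lambda>t. ?f (0 + (-1) * t))" by (rule lborel_integrable_real_affine[OF f]) simp
  then have "integrable lborel (\<lambda>t. ?f t + ?f (- t))" using f by simp
  then show ?thesis
    by (rule Bochner_Integration.integrable_bound) (auto split: split_indicator)
qed

lemma Complex_prod_bound:
  assumes "\<sigma> \<ge> 1"
  shows "norm (1 / (Complex \<sigma> t * (Complex \<sigma> t + 1))) \<le> 1 / (1 + t\<^sup>2)"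
proof -
  have "1 + t\<^sup>2 \<le> norm (Complex \<sigma> t) ^ 2" using assms by (simp add: cmod_def)
  also have "\<dots> \<le> norm (Complex \<sigma> t) * norm (Complex \<sigma> t + 1)"
    unfolding power2_eq_square using assms
    by (intro mult_left_mono) (auto simp: cmod_def intro!: real_sqrt_le_mono)
  finally have "1 + t\<^sup>2 \<le> norm (Complex \<sigma> t * (Complex \<sigma> t + 1))" by (simp add: norm_mult)
  moreover have "1 + t\<^sup>2 > 0" by (simp add: add_pos_nonneg)
  ultimately show ?thesis unfolding norm_divide norm_one by (intro frac_le) auto
qed

text \<open>Growth with exponent 1/2 against the quadratic decay of the kernel leaves the integrable
  weight \<open>(1 + \<bar>t\<bar>) powr (-3/2)\<close>.\<close>

lemma weight_bound: "(1 + \<bar>t\<bar>) powr (1/2) * (1 / (1 + t\<^sup>2)) \<le> 2 * (1 + \<bar>t\<bar>) powr (-3/2)" for t :: real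
proof -
  have "0 \<le> (1 - \<bar>t\<bar>)\<^sup>2" by simp
  then have "(1 + \<bar>t\<bar>)\<^sup>2 \<le> 2 * (1 + t\<^sup>2)" by (simp add: power2_eq_square algebra_simps)
  moreover have p: "1 + t\<^sup>2 > 0" by (simp add: add_pos_nonneg)
  ultimately have "1 / (1 + t\<^sup>2) \<le> 2 / (1 + \<bar>t\<bar>)\<^sup>2" by (simp add: divide_simps) 
  also have "\<dots> = 2 * (1 + \<bar>t\<bar>) powr (-2)" by (simp add: powr_minus powr_numeral divide_inverse)
  finally have "(1 + \<bar>t\<bar>) powr (1/2) * (1 / (1 + t\<^sup>2)) \<le> (1 + \<bar>t\<bar>) powr (1/2) * (2 * (1 + \<bar>t\<bar>) powr (-2))"
    by (intro mult_left_mono) auto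
  also have "\<dots> = 2 * (1 + \<bar>t\<bar>) powr (-3/2)" by (simp flip: powr_add)
  finally show ?thesis .
qed

text \<open>At \<open>u = ln (x / n)\<close>, after multiplication by
  \<open>exp (\<sigma> * u)\<close>, the right-hand side is \<open>2 * pi\<close> times
  \<open>1 - n / x\<close> for \<open>n < x\<close> and 0 otherwise, so the kernel truncates the
  series at \<open>x\<close>. By partial fractions the kernel is the Fourier transform of this
  function, and inversion applies.\<close>

lemma kernel_identity:
  assumes \<sigma>: "\<sigma> > 1"
  shows "integrable lborel (\<lambda>t. 1 / (Complex \<sigma> t * (Complex \<sigma> t + 1)))"
    "(\<integral>t. 1 / (Complex \<sigma> t * (Complex \<sigma> t + 1)) * iexp (t * u) \<partial>lborel)
      = of_real (2 * pi * (if u > 0 then (1 - exp (- u)) * exp (- \<sigma> * u) else 0))"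
proof -
  define k :: "real \<Rightarrow> complex" where "k u = of_real (if u > 0 then (1 - exp (- u)) * exp (- \<sigma> * u) else 0)" for u :: real
  let ?s = "\<lambda>t. Complex \<sigma> t"
  have k_eq: "k v * iexp (- (t * v)) = indicator {0<..} v *\<^sub>R exp (- ?s t * of_real v) - indicator {0<..} v *\<^sub>R exp (- (?s t + 1) * of_real v)" for t v
  proof (cases "v > 0")
    case True
    have "exp (- ?s t * of_real v) = of_real (exp (- \<sigma> * v)) * iexp (- (t * v))"
      "exp (- (?s t + 1) * of_real v) = of_real (exp (- v)) * of_real (exp (- \<sigma> * v)) * iexp (- (t * v))"
      by (simp_all add: Complex_eq algebra_simps flip: exp_add exp_of_real) 
    then show ?thesis using True by (simp add: k_def algebra_simps)
  qed (auto simp: k_def)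
  have i: "integrable lborel (\<lambda>v. k v * iexp (- (t * v)))" for t
    unfolding k_eq using \<sigma> by (intro Bochner_Integration.integrable_diff integral_exp_half(1)) auto
  have hat: "1 / (?s t * (?s t + 1)) = (\<integral>v. k v * iexp (- (t * v)) \<partial>lborel)" for t
  proof -
    have r1: "Re (?s t) > 0" and r2: "Re (?s t + 1) > 0" using \<sigma> by auto
    have "(\<integral>v. k v * iexp (- (t * v)) \<partial>lborel) = 1 / ?s t - 1 / (?s t + 1)"
      unfolding k_eq Bochner_Integration.integral_diff[OF integral_exp_half(1)[OF r1] integral_exp_half(1)[OF r2]]
        integral_exp_half(2)[OF r1] integral_exp_half(2)[OF r2] ..
    also have "\<dots> = 1 / (?s t * (?s t + 1))"
    proof -
      have "?s t \<noteq> 0" "?s t + 1 \<noteq> 0" using \<sigma> by (auto simp: complex_eq_iff)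
      then show ?thesis by (simp add: field_simps)
    qed
    finally show ?thesis ..
  qed
  show kh: "integrable lborel (\<lambda>t. 1 / (?s t * (?s t + 1)))"
  proof (rule Bochner_Integration.integrable_bound[of _ "\<lambda>t. 2 * (1 + \<bar>t\<bar>) powr (-3/2)"])
    show "integrable lborel (\<lambda>t::real. 2 * (1 + \<bar>t\<bar>) powr (-3/2))" using integrable_powr_32 by auto
    have "continuous_on UNIV (\<lambda>t. 1 / (?s t * (?s t + 1)))"
    proof -
      have n1: "?s t \<noteq> 0" "?s t + 1 \<noteq> 0" for t using \<sigma> by (auto simp: complex_eq_iff)
      have n: "?s t * (?s t + 1) \<noteq> 0" for t using no_zero_divisors[OF n1(1)[of t] n1(2)[of t]] .
      have "continuous_on UNIV ?s" unfolding Complex_eq by (intro continuous_intros)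
      then show ?thesis using n by (intro continuous_on_divide continuous_on_mult continuous_on_add continuous_on_const ballI)
    qed
    then show "(\<lambda>t. 1 / (?s t * (?s t + 1))) \<in> borel_measurable lborel"
      using borel_measurable_continuous_onI by auto
    show "AE t in lborel. norm (1 / (?s t * (?s t + 1))) \<le> norm (2 * (1 + \<bar>t\<bar>) powr (-3/2))"
    proof (rule AE_I2)
      fix t :: real
      have "norm (1 / (?s t * (?s t + 1))) \<le> 1 * (1 / (1 + t\<^sup>2))" using Complex_prod_bound[of \<sigma> t] \<sigma> by simp
      also have "\<dots> \<le> (1 + \<bar>t\<bar>) powr (1/2) * (1 / (1 + t\<^sup>2))"
        by (intro mult_right_mono ge_one_powr_ge_zero) auto
      also have "\<dots> \<le> 2 * (1 + \<bar>t\<bar>) powr (-3/2)" by (rule weight_bound)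
      finally show "norm (1 / (?s t * (?s t + 1))) \<le> norm (2 * (1 + \<bar>t\<bar>) powr (-3/2))" by simp
    qed
  qed
  have "(\<integral>t. 1 / (?s t * (?s t + 1)) * iexp (t * u) \<partial>lborel) = of_real (2 * pi) * k u"
  proof (rule fourier_inversion[OF _ _ _ hat kh])
    show "integrable lborel k" using i[of 0] by simp
    show "norm (k v) \<le> 1" for v
      using \<sigma> by (auto simp: k_def simp del: of_real_mult intro!: mult_le_one)
    show "isCont k u"
    proof -
      \<comment> \<open>Inversion needs continuity: \<open>1 - exp (- u)\<close> vanishes at 0, and
        writing the cut-off with \<open>max 0 u\<close> makes this visible. An unsmoothed cut-off
        would jump here.\<close>
      have "k = (\<lambda>u. of_real ((1 - exp (- max 0 u)) * exp (- \<sigma> * max 0 u)))" by (auto simp: k_def fun_eq_iff max_def)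
      then show ?thesis by (simp only: ) (intro continuous_intros)
    qed
  qed
  then show "(\<integral>t. 1 / (?s t * (?s t + 1)) * iexp (t * u) \<partial>lborel)
      = of_real (2 * pi * (if u > 0 then (1 - exp (- u)) * exp (- \<sigma> * u) else 0))" by (simp add: k_def)
qed

text \<open>A Perron formula: the kernel is integrated against the series term by term, which
  absolute convergence permits, and the integrand is
  \<open>O(x * (1 + \<bar>t\<bar>) powr (-3/2))\<close>. This bounds the sum with weights
  \<open>1 - n / x\<close> by a multiple of \<open>x\<close>.\<close>

theorem smoothed_sum_bound:
  assumes b: "dconv b" "b 0 = 0"
    and C: "\<And>s. 1 < Re s \<Longrightarrow> Re s \<le> 2 \<Longrightarrow> norm (dseries b s) \<le> C * (1 + \<bar>Im s\<bar>) powr (1/2)"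
  shows "\<exists>C'. \<forall>x\<ge>3. \<bar>\<Sum>n\<in>{n. real n \<le> x}. b n * (x - real n)\<bar> \<le> C' * x\<^sup>2"
proof -
  define I where "I = (\<integral>t. (1 + \<bar>t\<bar>) powr (-3/2) \<partial>lborel :: real)"
  have C0: "C \<ge> 0" using C[of 2] norm_ge_zero[of "dseries b 2"] by (simp del: norm_ge_zero)
  have "\<bar>\<Sum>n\<in>{n. real n \<le> x}. b n * (x - real n)\<bar> \<le> (exp 1 * (2 * C) * I) * x\<^sup>2" if x: "x \<ge> 3" for x
  proof -
    have "exp 1 < (3::real)" using e_less_272 by simp
    then have lx: "ln x \<ge> 1" using x by (metis exp_gt_zero less_imp_le ln_exp ln_mono order_trans)
    \<comment> \<open>On this line \<open>x powr \<sigma>\<close> is \<open>exp 1 * x\<close>. The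
      line approaches \<open>Re s = 1\<close> as \<open>x\<close> grows, which is harmless because
      the constant \<open>C\<close> is uniform.\<close>
    define \<sigma> where "\<sigma> = 1 + 1 / ln x"
    have \<sigma>: "\<sigma> > 1" "\<sigma> \<le> 2" using lx by (auto simp: \<sigma>_def)
    let ?s = "\<lambda>t. Complex \<sigma> t"
    define K where "K t = 1 / (?s t * (?s t + 1))" for t
    define f where "f n t = of_real (b n * exp (\<sigma> * (ln x - ln (real n)))) * (K t * iexp (t * (ln x - ln (real n))))" for n t
    define S where "S = (\<lambda>t. \<Sum>n. f n t)"
    have Ki: "integrable lborel K" unfolding K_def[abs_def] by (rule kernel_identity(1)[OF \<sigma>(1)])
    note [measurable] = borel_measurable_integrable[OF Ki]
    have Kb: "norm (K t) \<le> 1 / (1 + t\<^sup>2)" for t using Complex_prod_bound[of \<sigma> t] \<sigma> by (simp add: K_def)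
    have Kn: "norm (K t * iexp r) = norm (K t)" for t r by (subst norm_mult) simp
    have f_eq: "f n t = exp (?s t * of_real (ln x)) * K t * (of_real (b n) * exp (- ?s t * of_real (ln (real n))))" for n t
    proof -
      have "of_real (exp (\<sigma> * (ln x - ln (real n)))) * iexp (t * (ln x - ln (real n))) = exp (?s t * of_real (ln x)) * exp (- ?s t * of_real (ln (real n)))"
        by (simp add: Complex_eq algebra_simps flip: exp_add exp_of_real)
      then have "of_real (b n) * K t * (of_real (exp (\<sigma> * (ln x - ln (real n)))) * iexp (t * (ln x - ln (real n))))
        = of_real (b n) * K t * (exp (?s t * of_real (ln x)) * exp (- ?s t * of_real (ln (real n))))"
        by (rule arg_cong)
      then show ?thesis unfolding f_def of_real_mult by (simp only: mult_ac)
    qed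
    have int: "integrable lborel (f n)" for n
    proof -
      have "integrable lborel (\<lambda>t. K t * iexp (t * (ln x - ln (real n))))"
        by (rule Bochner_Integration.integrable_bound[OF Ki]) (measurable, simp add: norm_mult)
      then show ?thesis unfolding f_def[abs_def] by auto
    qed
    have sumb: "summable (\<lambda>n. \<bar>b n\<bar> * exp (\<sigma> * (ln x - ln (real n))))"
    proof -
      have "summable (\<lambda>n. exp (\<sigma> * ln x) * (\<bar>b n\<bar> * exp (- \<sigma> * ln (real n))))"
        using b(1) \<sigma> unfolding dconv_def by (intro summable_mult) blast
      moreover have e: "exp (\<sigma> * ln x) * (\<bar>b n\<bar> * exp (- \<sigma> * ln (real n))) = \<bar>b n\<bar> * exp (\<sigma> * (ln x - ln (real n)))" for n
        by (simp add: right_diff_distrib exp_diff exp_minus divide_inverse)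
      ultimately show ?thesis by (simp only: e)
    qed
    have fn: "norm (f n t) = \<bar>b n\<bar> * exp (\<sigma> * (ln x - ln (real n))) * norm (K t)" for n t
      unfolding f_def norm_mult norm_of_real abs_mult by simp
    have fS: "(\<lambda>n. integral\<^sup>L lborel (f n)) sums integral\<^sup>L lborel S" and SI: "integrable lborel S"
    proof -
      have a: "AE t in lborel. summable (\<lambda>n. norm (f n t))"
        unfolding fn by (intro AE_I2 summable_mult2 sumb)
      have b: "summable (\<lambda>n. \<integral>t. norm (f n t) \<partial>lborel)"
        unfolding fn Bochner_Integration.integral_mult_right_zero by (rule summable_mult2[OF sumb])
      show "(\<lambda>n. integral\<^sup>L lborel (f n)) sums integral\<^sup>L lborel S"
        unfolding S_def by (rule sums_integral[OF int a b])
      show "integrable lborel S" unfolding S_def by (rule integrable_suminf[OF int a b])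
    qed
    have S_eq: "S t = exp (?s t * of_real (ln x)) * K t * dseries b (?s t)" for t
      unfolding S_def f_eq using sums_mult[OF dseries_sums[OF b(1), of "?s t"]] \<sigma> by (simp add: sums_iff)
    have xs: "exp (\<sigma> * ln x) = exp 1 * x"
    proof -
      have "\<sigma> * ln x = 1 + ln x" using lx by (simp add: \<sigma>_def field_simps)
      then show ?thesis using x by (simp add: exp_add)
    qed
    have Sn: "norm (S t) \<le> exp 1 * x * (2 * C) * (1 + \<bar>t\<bar>) powr (-3/2)" for t
    proof -
      have "norm (S t) = exp 1 * x * (norm (K t) * norm (dseries b (?s t)))"
        unfolding S_eq norm_mult by (simp add: xs)
      also have "\<dots> \<le> exp 1 * x * ((1 / (1 + t\<^sup>2)) * (C * (1 + \<bar>t\<bar>) powr (1/2)))"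
        using \<sigma> x C[of "?s t"] Kb[of t] by (intro mult_left_mono mult_mono) auto
      also have "\<dots> = exp 1 * x * C * ((1 + \<bar>t\<bar>) powr (1/2) * (1 / (1 + t\<^sup>2)))" by (simp add: mult_ac)
      also have "\<dots> \<le> exp 1 * x * C * (2 * (1 + \<bar>t\<bar>) powr (-3/2))"
        using x C0 by (intro mult_left_mono weight_bound) auto
      finally show ?thesis by (simp add: mult_ac)
    qed
    have nI: "norm (integral\<^sup>L lborel S) \<le> exp 1 * x * (2 * C) * I"
    proof -
      have "norm (integral\<^sup>L lborel S) \<le> (\<integral>t. norm (S t) \<partial>lborel)" by (rule integral_norm_bound)
      also have "\<dots> \<le> (\<integral>t. exp 1 * x * (2 * C) * (1 + \<bar>t\<bar>) powr (-3/2) \<partial>lborel)"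
        using SI integrable_powr_32 Sn by (intro integral_mono) auto
      finally show ?thesis by (simp add: I_def)
    qed
    have fin: "finite {n. real n \<le> x}"
      by (rule finite_subset[of _ "{..nat \<lfloor>x\<rfloor>}"]) (auto simp: le_nat_floor)
    \<comment> \<open>At \<open>n = x\<close> the weight vanishes, so the strict inequality in the
      kernel agrees with \<open>real n \<le> x\<close>. The term \<open>n = 0\<close>, where
      \<open>ln 0 = 0\<close> would be misleading, is killed by \<open>b 0 = 0\<close>.\<close>
    have val: "integral\<^sup>L lborel (f n) = of_real (2 * pi * (if real n \<le> x then b n * (1 - real n / x) else 0))" for n
    proof (cases "n = 0")
      case False
      have "integral\<^sup>L lborel (f n) = of_real (b n * exp (\<sigma> * (ln x - ln (real n)))) * (\<integral>t. K t * iexp (t * (ln x - ln (real n))) \<partial>lborel)"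
        unfolding f_def[abs_def] by simp
      also have "\<dots> = of_real (b n * exp (\<sigma> * (ln x - ln (real n))) * (2 * pi * (if ln x - ln (real n) > 0 then (1 - exp (- (ln x - ln (real n)))) * exp (- \<sigma> * (ln x - ln (real n))) else 0)))"
        unfolding K_def kernel_identity(2)[OF \<sigma>(1)] by simp
      also have "b n * exp (\<sigma> * (ln x - ln (real n))) * (2 * pi * (if ln x - ln (real n) > 0 then (1 - exp (- (ln x - ln (real n)))) * exp (- \<sigma> * (ln x - ln (real n))) else 0))
        = 2 * pi * (if real n \<le> x then b n * (1 - real n / x) else 0)"
      proof -
        have e: "exp (- (ln x - ln (real n))) = real n / x" using x False by (simp add: exp_diff)
        have "exp (\<sigma> * (ln x - ln (real n))) * exp (- \<sigma> * (ln x - ln (real n))) = 1" by (simp flip: exp_add)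
        moreover have "ln x - ln (real n) > 0 \<longleftrightarrow> real n < x" using x False by auto
        ultimately show ?thesis using x unfolding e by (cases "real n < x") (auto simp: mult_ac)
      qed
      finally show ?thesis .
    qed (simp add: f_def b(2) cong: Bochner_Integration.integral_cong)
    have "(\<lambda>n. integral\<^sup>L lborel (f n)) sums (\<Sum>n\<in>{n. real n \<le> x}. integral\<^sup>L lborel (f n))"
      by (rule sums_finite[OF fin]) (auto simp: val)
    then have "integral\<^sup>L lborel S = (\<Sum>n\<in>{n. real n \<le> x}. integral\<^sup>L lborel (f n))"
      using fS sums_unique2 by blast
    also have "\<dots> = of_real (2 * pi * (\<Sum>n\<in>{n. real n \<le> x}. b n * (1 - real n / x)))"
      by (simp add: val sum_distrib_left)
    finally have SE: "integral\<^sup>L lborel S = of_real (2 * pi * (\<Sum>n\<in>{n. real n \<le> x}. b n * (1 - real n / x)))" .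
    have "2 * pi * \<bar>\<Sum>n\<in>{n. real n \<le> x}. b n * (1 - real n / x)\<bar> \<le> exp 1 * x * (2 * C) * I"
      using nI unfolding SE norm_of_real abs_mult by simp
    moreover have "1 * \<bar>\<Sum>n\<in>{n. real n \<le> x}. b n * (1 - real n / x)\<bar> \<le> 2 * pi * \<bar>\<Sum>n\<in>{n. real n \<le> x}. b n * (1 - real n / x)\<bar>"
      using pi_ge_two by (intro mult_right_mono) auto
    ultimately have "x * \<bar>\<Sum>n\<in>{n. real n \<le> x}. b n * (1 - real n / x)\<bar> \<le> x * (exp 1 * x * (2 * C) * I)"
      using x by (intro mult_left_mono) auto
    moreover have "x * (\<Sum>n\<in>{n. real n \<le> x}. b n * (1 - real n / x)) = (\<Sum>n\<in>{n. real n \<le> x}. b n * (x - real n))"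
      using x unfolding sum_distrib_left by (intro sum.cong) (auto simp: field_simps)
    moreover have "x * \<bar>\<Sum>n\<in>{n. real n \<le> x}. b n * (1 - real n / x)\<bar> = \<bar>x * (\<Sum>n\<in>{n. real n \<le> x}. b n * (1 - real n / x))\<bar>"
      using x by (simp add: abs_mult)
    ultimately show ?thesis by (simp add: power2_eq_square mult_ac)
  qed
  then show ?thesis by blast
qed

subsection \<open>The prime number theorem with error term\<close>

lemma finite_nat_le: "finite {n. real n \<le> x}"
  by (rule finite_subset[of _ "{..nat \<lfloor>x\<rfloor>}"]) (auto simp: le_nat_floor)

lemma card_nat_interval:
  assumes "x \<le> y" "x \<ge> 0"
  shows "real (card {n. x < real n \<and> real n \<le> y}) \<le> y - x + 1"
proof -
  have sub: "{n. x < real n \<and> real n \<le> y} \<subseteq> {Suc (nat \<lfloor>x\<rfloor>)..nat \<lfloor>y\<rfloor>}"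
    by (auto simp: le_nat_floor Suc_le_eq) (metis floor_less_iff nat_less_iff of_int_of_nat_eq of_nat_0_le_iff assms(2) zero_le_floor)
  have "card {n. x < real n \<and> real n \<le> y} \<le> nat \<lfloor>y\<rfloor> - nat \<lfloor>x\<rfloor>"
    using card_mono[OF _ sub] by simp
  also have "real \<dots> \<le> y - x + 1" using assms by (simp add: of_nat_diff nat_mono floor_mono) linarith
  finally show ?thesis by simp
qed

text \<open>The Tauberian condition: because \<open>mangoldt\<close> is nonnegative the coefficients
  are not very negative, and the differencing argument uses only this one-sided bound.\<close>

lemma mdiff_ge: "mdiff n \<ge> - (ln (real n))\<^sup>2"
proof (cases "n = 0")
  case False
  have "(ln (real n))\<^sup>2 * (-1) \<le> (ln (real n))\<^sup>2 * (mangoldt n - one_coeff n)"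
    using mangoldt_nonneg[of n] by (intro mult_left_mono) (auto simp: one_coeff_def)
  then show ?thesis by (simp add: mdiff_def mult.commute)
qed (simp add: mdiff_def)

lemma tail_bound:
  assumes "1 \<le> x" "x \<le> y" and g: "\<And>n. x < real n \<Longrightarrow> real n \<le> y \<Longrightarrow> 0 \<le> g n \<and> g n \<le> y - x"
  shows "(\<Sum>n\<in>{n. x < real n \<and> real n \<le> y}. mdiff n * g n) \<ge> - ((y - x + 1) * ((ln y)\<^sup>2 * (y - x)))"
proof -
  let ?I = "{n. x < real n \<and> real n \<le> y}"
  have "- ((y - x + 1) * ((ln y)\<^sup>2 * (y - x))) \<le> - (real (card ?I) * ((ln y)\<^sup>2 * (y - x)))"
    using card_nat_interval[of x y] assms by (intro le_imp_neg_le mult_right_mono) auto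
  also have "\<dots> = (\<Sum>n\<in>?I. - ((ln y)\<^sup>2 * (y - x)))" by simp
  also have "\<dots> \<le> (\<Sum>n\<in>?I. mdiff n * g n)"
  proof (rule sum_mono)
    fix n assume n: "n \<in> ?I"
    have "(ln (real n))\<^sup>2 \<le> (ln y)\<^sup>2" using n assms by (intro power_mono) auto
    then have "- ((ln y)\<^sup>2) \<le> mdiff n" using mdiff_ge[of n] by linarith
    then have "- ((ln y)\<^sup>2) * g n \<le> mdiff n * g n" using g[of n] n by (intro mult_right_mono) auto
    moreover have "(ln y)\<^sup>2 * g n \<le> (ln y)\<^sup>2 * (y - x)" using g[of n] n by (intro mult_left_mono) auto
    ultimately show "- ((ln y)\<^sup>2 * (y - x)) \<le> mdiff n * g n" by simp
  qed
  finally show ?thesis .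
qed

lemma sum_split_le:
  assumes "x \<le> y"
  shows "sum h {n. real n \<le> y} = sum h {n. real n \<le> x} + sum h {n. x < real n \<and> real n \<le> y}"
proof -
  have "{n. real n \<le> y} = {n. real n \<le> x} \<union> {n. x < real n \<and> real n \<le> y}" using assms by auto
  moreover have "finite {n. x < real n \<and> real n \<le> y}" by (rule finite_subset[OF _ finite_nat_le[of y]]) auto
  ultimately show ?thesis using finite_nat_le by (simp add: sum.union_disjoint disjoint_iff)
qed

text \<open>For \<open>n \<le> x\<close> the weight grows by exactly \<open>y - x\<close>. The terms
  in between enter once with weight \<open>y - n\<close> and once with the complementary weight
  \<open>n - x\<close>; since \<open>tail_bound\<close> is one-sided, the first bounds the sum at
  \<open>x\<close> from above and the second the sum at \<open>y\<close> from below.\<close>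

lemma smooth_diff:
  assumes "1 \<le> x" "x \<le> y"
  defines "U \<equiv> \<lambda>x. \<Sum>n\<in>{n. real n \<le> x}. mdiff n * (x - real n)"
  shows "U y - U x \<ge> (y - x) * (\<Sum>n\<in>{n. real n \<le> x}. mdiff n) - (y - x + 1) * ((ln y)\<^sup>2 * (y - x))"
    and "U y - U x \<le> (y - x) * (\<Sum>n\<in>{n. real n \<le> y}. mdiff n) + (y - x + 1) * ((ln y)\<^sup>2 * (y - x))"
proof -
  let ?I = "{n. x < real n \<and> real n \<le> y}"
  have U: "U y = (\<Sum>n\<in>{n. real n \<le> x}. mdiff n * (y - real n)) + (\<Sum>n\<in>?I. mdiff n * (y - real n))"
    unfolding U_def by (rule sum_split_le[OF assms(2)])
  have U1: "(\<Sum>n\<in>{n. real n \<le> x}. mdiff n * (y - real n)) - U x = (y - x) * (\<Sum>n\<in>{n. real n \<le> x}. mdiff n)"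
    unfolding U_def by (simp add: sum_distrib_left algebra_simps flip: sum_subtractf)
  have "(\<Sum>n\<in>?I. mdiff n * (y - real n)) \<ge> - ((y - x + 1) * ((ln y)\<^sup>2 * (y - x)))"
    using assms by (intro tail_bound) auto
  then show "U y - U x \<ge> (y - x) * (\<Sum>n\<in>{n. real n \<le> x}. mdiff n) - (y - x + 1) * ((ln y)\<^sup>2 * (y - x))"
    using U U1 by linarith
  have "(\<Sum>n\<in>?I. mdiff n * (real n - x)) \<ge> - ((y - x + 1) * ((ln y)\<^sup>2 * (y - x)))"
    using assms by (intro tail_bound) auto
  moreover have "(\<Sum>n\<in>?I. mdiff n * (real n - x)) = (y - x) * (\<Sum>n\<in>?I. mdiff n) - (\<Sum>n\<in>?I. mdiff n * (y - real n))"
    by (simp add: sum_distrib_left algebra_simps flip: sum_subtractf)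
  moreover have "(\<Sum>n\<in>{n. real n \<le> y}. mdiff n) = (\<Sum>n\<in>{n. real n \<le> x}. mdiff n) + (\<Sum>n\<in>?I. mdiff n)"
    by (rule sum_split_le[OF assms(2)])
  ultimately show "U y - U x \<le> (y - x) * (\<Sum>n\<in>{n. real n \<le> y}. mdiff n) + (y - x + 1) * ((ln y)\<^sup>2 * (y - x))"
    using U U1 by (simp add: ring_distribs)
qed

lemma sum_mdiff_bound: "\<exists>C. \<forall>x\<ge>6. \<bar>\<Sum>n\<in>{n. real n \<le> x}. mdiff n\<bar> \<le> C * (x * ln x)"
proof -
  let ?U = "\<lambda>x. \<Sum>n\<in>{n. real n \<le> x}. mdiff n * (x - real n)"
  let ?B = "\<lambda>x. \<Sum>n\<in>{n. real n \<le> x}. mdiff n"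
  obtain C0 where "\<forall>s. 1 < Re s \<longrightarrow> Re s \<le> 2 \<longrightarrow> norm (dseries mdiff s) \<le> C0 * (1 + \<bar>Im s\<bar>) powr (1/2)"
    using dseries_mdiff_bound by blast
  then obtain C1 where C1: "\<forall>x\<ge>3. \<bar>?U x\<bar> \<le> C1 * x\<^sup>2"
    using smoothed_sum_bound[OF dconv_mdiff, of C0] by (auto simp: mdiff_def)
  define C where "C = \<bar>C1\<bar>"
  have C: "\<bar>?U x\<bar> \<le> C * x\<^sup>2" if "x \<ge> 3" for x
  proof -
    have "C1 * x\<^sup>2 \<le> C * x\<^sup>2" by (intro mult_right_mono) (auto simp: C_def)
    then show ?thesis using order_trans[OF C1[rule_format, OF that]] by blast
  qed
  have C0: "C \<ge> 0" by (simp add: C_def)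
  have "\<bar>?B x\<bar> \<le> (10 * C + 6) * (x * ln x)" if x: "x \<ge> 6" for x
  proof -
    have "exp 1 < (3::real)" using e_less_272 by simp
    then have lx: "ln x \<ge> 1" using x by (metis exp_gt_zero ln_exp ln_mono order_trans less_imp_le numeral_le_iff semiring_norm(68) semiring_norm(70) semiring_norm(71) semiring_norm(72) linorder_not_le less_le_trans)
    have lxx: "ln x \<le> x" using x ln_le_minus_one[of x] by linarith
    \<comment> \<open>This balances \<open>x^2 / h\<close>, from the two values of
      \<open>?U\<close>, against \<open>h * (ln x)^2\<close>, from the short interval; both become
      \<open>x * ln x\<close>. The factor 1/2 ensures \<open>x - h \<ge> 3\<close> for
      \<open>x \<ge> 6\<close>.\<close>
    define h where "h = x / (2 * ln x)"
    have h: "h > 0" "h \<le> x / 2" "h * ln x = x / 2" using lx x by (auto simp: h_def field_simps)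
    have x2h: "x\<^sup>2 = h * (2 * (x * ln x))" using h(3) by (simp add: power2_eq_square field_simps)
    have l2: "(ln x)\<^sup>2 \<le> x * ln x" using lx lxx by (simp add: power2_eq_square mult_right_mono)
    have hl: "(h + 1) * (ln x)\<^sup>2 \<le> 3/2 * (x * ln x)"
    proof -
      have "(h + 1) * (ln x)\<^sup>2 = (h * ln x) * ln x + (ln x)\<^sup>2" by (simp add: power2_eq_square algebra_simps)
      then show ?thesis using l2 unfolding h(3) by simp
    qed
    have up: "?B x \<le> (10 * C + 6) * (x * ln x)"
    proof -
      let ?y = "x + h"
      have ly: "(ln ?y)\<^sup>2 \<le> 4 * (ln x)\<^sup>2"
      proof -
        have "x * 2 \<le> x * x" using x by (intro mult_left_mono) auto
        then have "?y \<le> x * x" using h x by linarith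
        then have "ln ?y \<le> ln (x * x)" using x h by (subst ln_le_cancel_iff) auto
        also have "\<dots> = 2 * ln x" using x by (simp add: ln_mult)
        finally have "(ln ?y)\<^sup>2 \<le> (2 * ln x)\<^sup>2" using x h by (intro power_mono) auto
        then show ?thesis by (simp add: power_mult_distrib)
      qed
      have "h * ?B x - (h + 1) * ((ln ?y)\<^sup>2 * h) \<le> ?U ?y - ?U x"
        using smooth_diff(1)[of x ?y] x h by simp
      also have "\<dots> \<le> C * ?y\<^sup>2 + C * x\<^sup>2" using C[of x] C[of ?y] x h by (simp add: abs_le_iff)
      also have "?y\<^sup>2 \<le> (2 * x)\<^sup>2" using x h by (intro power_mono) auto
      then have "C * ?y\<^sup>2 \<le> C * (2 * x)\<^sup>2" using C0 by (rule mult_left_mono)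
      then have "C * ?y\<^sup>2 + C * x\<^sup>2 \<le> 5 * C * x\<^sup>2" by (simp add: power_mult_distrib)
      also have "5 * C * x\<^sup>2 = h * (10 * C * (x * ln x))" unfolding x2h by simp
      finally have "h * ?B x \<le> h * (10 * C * (x * ln x)) + h * ((h + 1) * (ln ?y)\<^sup>2)" by (simp add: mult_ac)
      also have "\<dots> = h * (10 * C * (x * ln x) + (h + 1) * (ln ?y)\<^sup>2)" by (simp add: ring_distribs)
      finally have "?B x \<le> 10 * C * (x * ln x) + (h + 1) * (ln ?y)\<^sup>2" using h by simp
      also have "(h + 1) * (ln ?y)\<^sup>2 \<le> 4 * ((h + 1) * (ln x)\<^sup>2)" using mult_left_mono[OF ly, of "h + 1"] h by simp
      also have "\<dots> \<le> 6 * (x * ln x)" using hl by simp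
      finally show ?thesis by (simp add: ring_distribs)
    qed
    have lo: "- ((10 * C + 6) * (x * ln x)) \<le> ?B x"
    proof -
      let ?y = "x - h"
      have y3: "?y \<ge> 3" using x h by linarith
      have "?U x - ?U ?y \<le> h * ?B x + (h + 1) * ((ln x)\<^sup>2 * h)"
        using smooth_diff(2)[of ?y x] y3 h by simp
      moreover have "- (C * x\<^sup>2 + C * ?y\<^sup>2) \<le> ?U x - ?U ?y" using C[of x] C[OF y3] x by (simp add: abs_le_iff)
      moreover have "?y\<^sup>2 \<le> x\<^sup>2" using y3 h by (intro power_mono) auto
      then have "C * ?y\<^sup>2 \<le> C * x\<^sup>2" using C0 by (rule mult_left_mono)
      ultimately have "- (2 * (C * x\<^sup>2)) - h * ((h + 1) * (ln x)\<^sup>2) \<le> h * ?B x" by (simp add: mult_ac)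
      moreover have "2 * (C * x\<^sup>2) = h * (4 * C * (x * ln x))" unfolding x2h by simp
      ultimately have "h * (- (4 * C * (x * ln x)) - (h + 1) * (ln x)\<^sup>2) \<le> h * ?B x" by (simp add: ring_distribs)
      then have "- (4 * C * (x * ln x)) - (h + 1) * (ln x)\<^sup>2 \<le> ?B x" using h by simp
      then have "- (4 * C * (x * ln x)) - 3/2 * (x * ln x) \<le> ?B x" using hl by linarith
      moreover have "0 \<le> C * (x * ln x)" "0 \<le> x * ln x" using C0 x lx by auto
      ultimately show ?thesis by (simp add: ring_distribs)
    qed
    show ?thesis using up lo by (simp add: abs_le_iff)
  qed
  then show ?thesis by blast
qed

section \<open>From prime powers to primes, and partial summation\<close>

lemma eventually_bound_ex:
  fixes f g :: "nat \<Rightarrow> real"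
  assumes "\<forall>\<^sub>F n in sequentially. f n \<le> C * g n" and g: "\<And>n. n \<ge> n0 \<Longrightarrow> g n > 0"
  shows "\<exists>C'\<ge>0. \<forall>n\<ge>n0. f n \<le> C' * g n"
proof -
  obtain m where m: "\<And>n. n \<ge> m \<Longrightarrow> f n \<le> C * g n" using assms(1) by (auto simp: eventually_sequentially)
  define C' where "C' = \<bar>C\<bar> + (\<Sum>n\<in>{n0..<m}. \<bar>f n\<bar> / g n)"
  have pos: "\<bar>f n\<bar> / g n \<ge> 0" if "n \<ge> n0" for n using g[OF that] by simp
  have s0: "0 \<le> (\<Sum>n\<in>{n0..<m}. \<bar>f n\<bar> / g n)" using pos by (intro sum_nonneg) auto
  have "f n \<le> C' * g n" if n: "n \<ge> n0" for n
  proof (cases "n \<ge> m")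
    case True
    have "C * g n \<le> C' * g n" using g[OF n] s0 by (intro mult_right_mono) (auto simp: C'_def)
    then show ?thesis using m[OF True] by linarith
  next
    case False
    have "\<bar>f n\<bar> / g n \<le> (\<Sum>n\<in>{n0..<m}. \<bar>f n\<bar> / g n)" using False n pos by (intro member_le_sum) auto
    then have "\<bar>f n\<bar> / g n \<le> C'" by (simp add: C'_def)
    then show ?thesis using g[OF n] by (simp add: field_simps)
  qed
  then show ?thesis using s0 by (intro exI[of _ C']) (auto simp: C'_def)
qed

text \<open>
  Primes weighted by \<open>log\<^sup>3\<close> against all integers weighted by \<open>log\<^sup>2\<close>, reflecting the density \<open>1 / log\<close> of the
  primes. Both the prime counting function and the sum of \<open>1/p\<close> follow by partial summation.
\<close>
definition pdiff :: "nat \<Rightarrow> real" where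
  "pdiff n = (if prime n then ln (real n) ^ 3 else 0) - ln (real n) ^ 2"

text \<open>The difference is supported on proper prime powers \<open>p ^ k\<close> with
  \<open>k \<ge> 2\<close>, which are counted by pairs with \<open>p \<le> sqrt N\<close> and
  \<open>k \<le> log 2 N\<close>.\<close>

lemma prime_power_part:
  assumes "N \<ge> 2"
  shows "0 \<le> (\<Sum>n\<le>N. mdiff n - pdiff n)" "(\<Sum>n\<le>N. mdiff n - pdiff n) \<le> sqrt (real N) * (log 2 (real N) + 1) * ln (real N) ^ 3"
proof -
  let ?X = "{n. n \<le> N \<and> primepow n \<and> \<not> prime n}"
  have lnN: "ln (real N) \<ge> 0" using assms by simp
  have d: "mdiff n - pdiff n = (if n \<in> ?X then mangoldt n * ln (real n) ^ 2 else 0)" if "n \<le> N" for n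
  proof (cases "prime n")
    case True
    then show ?thesis by (simp add: mdiff_def pdiff_def one_coeff_def power2_eq_square power3_eq_cube algebra_simps prime_gt_0_nat)
  next
    case False
    then show ?thesis using that by (auto simp: mdiff_def pdiff_def one_coeff_def mangoldt_def algebra_simps)
  qed
  have eq: "(\<Sum>n\<le>N. mdiff n - pdiff n) = (\<Sum>n\<in>?X. mangoldt n * ln (real n) ^ 2)"
  proof -
    have "(\<Sum>n\<le>N. mdiff n - pdiff n) = (\<Sum>n\<le>N. if n \<in> ?X then mangoldt n * ln (real n) ^ 2 else 0)"
      using d by (intro sum.cong) auto
    also have "\<dots> = (\<Sum>n\<in>{..N} \<inter> ?X. mangoldt n * ln (real n) ^ 2)"
      by (rule sum.inter_restrict[symmetric]) simp
    also have "{..N} \<inter> ?X = ?X" by auto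
    finally show ?thesis .
  qed
  show "0 \<le> (\<Sum>n\<le>N. mdiff n - pdiff n)" unfolding eq using mangoldt_nonneg by (intro sum_nonneg mult_nonneg_nonneg) auto
  have fin: "finite ?X" by (rule finite_subset[of _ "{..N}"]) auto
  let ?P = "{1..nat \<lfloor>sqrt (real N)\<rfloor>} \<times> {1..nat \<lfloor>log 2 (real N)\<rfloor>}"
  have sub: "?X \<subseteq> (\<lambda>(p,k). p ^ k) ` ?P"
  proof
    fix n assume n: "n \<in> ?X"
    then obtain p k where pk: "prime p" "k > 0" "n = p ^ k" by (auto simp: primepow_def)
    have "k \<noteq> 1" using n pk by auto
    then have k2: "k \<ge> 2" using pk by auto
    have p2: "p \<ge> 2" using pk(1) by (rule prime_ge_2_nat)
    have "p ^ 2 \<le> p ^ k" using k2 p2 by (intro power_increasing) auto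
    moreover have "p ^ k \<le> N" using n pk by auto
    ultimately have "p ^ 2 \<le> N" by (rule order_trans)
    then have "real p \<le> sqrt (real N)" by (metis of_nat_le_iff of_nat_power real_le_rsqrt)
    then have 1: "p \<le> nat \<lfloor>sqrt (real N)\<rfloor>" by (simp add: le_nat_floor)
    have "2 ^ k \<le> p ^ k" using p2 by (intro power_mono) auto
    moreover have "p ^ k \<le> N" using n pk by auto
    ultimately have "2 ^ k \<le> N" by (rule order_trans)
    then have "real k \<le> log 2 (real N)" by (simp add: le_log2_of_power)
    then have 2: "k \<le> nat \<lfloor>log 2 (real N)\<rfloor>" by (simp add: le_nat_floor)
    show "n \<in> (\<lambda>(p,k). p ^ k) ` ?P" using 1 2 pk p2 by (intro image_eqI[of _ _ "(p,k)"]) auto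
  qed
  have "card ?X \<le> card ?P" using card_mono[OF _ sub] card_image_le[of ?P "\<lambda>(p,k). p ^ k"] by simp
  also have "\<dots> = nat \<lfloor>sqrt (real N)\<rfloor> * nat \<lfloor>log 2 (real N)\<rfloor>" by simp
  finally have "real (card ?X) \<le> real (nat \<lfloor>sqrt (real N)\<rfloor>) * real (nat \<lfloor>log 2 (real N)\<rfloor>)" by (metis of_nat_le_iff of_nat_mult)
  also have "\<dots> \<le> sqrt (real N) * (log 2 (real N) + 1)"
  proof (rule mult_mono)
    have "log 2 (real N) \<ge> 0" using assms by simp
    then show "real (nat \<lfloor>log 2 (real N)\<rfloor>) \<le> log 2 (real N) + 1" using of_nat_floor[of "log 2 (real N)"] by linarith
    show "real (nat \<lfloor>sqrt (real N)\<rfloor>) \<le> sqrt (real N)" by (rule of_nat_floor) simp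
  qed auto
  finally have card: "real (card ?X) \<le> sqrt (real N) * (log 2 (real N) + 1)" .
  have "(\<Sum>n\<in>?X. mangoldt n * ln (real n) ^ 2) \<le> (\<Sum>n\<in>?X. ln (real N) ^ 3)"
  proof (rule sum_mono)
    fix n assume n: "n \<in> ?X"
    then have n1: "n \<ge> 1" using primepow_gt_Suc_0 by force
    have "ln (real n) \<le> ln (real N)" using n n1 by auto
    then have "mangoldt n * ln (real n) ^ 2 \<le> ln (real N) * ln (real N) ^ 2"
      using mangoldt_le[of n] n1 lnN by (intro mult_mono power_mono) auto
    then show "mangoldt n * ln (real n) ^ 2 \<le> ln (real N) ^ 3" by (simp add: power2_eq_square power3_eq_cube)
  qed
  also have "\<dots> = real (card ?X) * ln (real N) ^ 3" by simp
  also have "\<dots> \<le> sqrt (real N) * (log 2 (real N) + 1) * ln (real N) ^ 3"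
    using card lnN by (intro mult_right_mono) auto
  finally show "(\<Sum>n\<le>N. mdiff n - pdiff n) \<le> sqrt (real N) * (log 2 (real N) + 1) * ln (real N) ^ 3" unfolding eq .
qed

lemma sum_pdiff_bound: "\<exists>C\<ge>0. \<forall>N\<ge>2. \<bar>\<Sum>n\<le>N. pdiff n\<bar> \<le> C * (real N * ln (real N))"
proof -
  obtain C1 where C1: "\<And>x. x \<ge> 6 \<Longrightarrow> \<bar>\<Sum>n\<in>{n. real n \<le> x}. mdiff n\<bar> \<le> C1 * (x * ln x)" using sum_mdiff_bound by blast
  have ev: "\<forall>\<^sub>F N in sequentially. \<bar>\<Sum>n\<le>N. pdiff n\<bar> \<le> (C1 + 1) * (real N * ln (real N))"
  proof -
    have "\<forall>\<^sub>F N in sequentially. sqrt (real N) * (log 2 (real N) + 1) * ln (real N) ^ 3 \<le> real N * ln (real N)"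
      unfolding log_def by real_asymp
    then show ?thesis using eventually_ge_at_top[of 6]
    proof eventually_elim
      case (elim N)
      have "{n. real n \<le> real N} = {..N}" by auto
      then have "\<bar>\<Sum>n\<le>N. mdiff n\<bar> \<le> C1 * (real N * ln (real N))" using C1[of "real N"] elim by simp
      moreover have "(\<Sum>n\<le>N. pdiff n) = (\<Sum>n\<le>N. mdiff n) - (\<Sum>n\<le>N. mdiff n - pdiff n)" by (simp add: sum_subtractf)
      moreover note prime_power_part[of N] 
      ultimately show ?case using elim by (simp add: ring_distribs)
    qed
  qed
  show ?thesis by (rule eventually_bound_ex[OF ev]) auto
qed

text \<open>Partial summation by comparison: each increment \<open>T b * (f b - f (Suc b))\<close>
  is at most \<open>2 * K * m b * (f b - f (Suc b))\<close>, and these bounds are the Abel transform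
  of the sum of \<open>(m n - m (n - 1)) * f n\<close>. The factor 2 arises because \<open>T\<close>
  is a difference of two partial sums of \<open>c\<close>.\<close>

lemma abel_bound:
  fixes c m f :: "nat \<Rightarrow> real"
  assumes S: "\<And>j. j \<ge> 2 \<Longrightarrow> \<bar>\<Sum>n\<le>j. c n\<bar> \<le> K * m j" and K: "K \<ge> 0"
    and m: "\<And>i j. 2 \<le> i \<Longrightarrow> i \<le> j \<Longrightarrow> m i \<le> m j" and f: "\<And>i j. 2 \<le> i \<Longrightarrow> i \<le> j \<Longrightarrow> f j \<le> f i"
    and f0: "\<And>i. 2 \<le> i \<Longrightarrow> f i \<ge> 0"
    and a: "3 \<le> a" "a \<le> b"
  shows "\<bar>\<Sum>n=a..b. c n * f n\<bar> \<le> 2 * K * (m a * f a + (\<Sum>n=Suc a..b. (m n - m (n - 1)) * f n))"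
proof -
  define T where "T j = (\<Sum>n=a..j. c n)" for j
  have T: "\<bar>T j\<bar> \<le> 2 * K * m j" if "j \<ge> a" for j
  proof -
    have "(\<Sum>n\<le>j. c n) = (\<Sum>n\<le>a-1. c n) + T j"
    proof -
      have "{..j} = {..a-1} \<union> {a..j}" using a that by auto
      then show ?thesis unfolding T_def using a by (simp add: sum.union_disjoint disjoint_iff)
    qed
    moreover have "\<bar>\<Sum>n\<le>a-1. c n\<bar> \<le> K * m (a - 1)" using a by (intro S) auto
    moreover have "K * m (a - 1) \<le> K * m j" using a that K by (intro mult_left_mono m) auto
    moreover have "\<bar>\<Sum>n\<le>j. c n\<bar> \<le> K * m j" using a that by (intro S) auto
    ultimately show ?thesis by linarith
  qed
  have main: "\<bar>(\<Sum>n=a..b. c n * f n) - T b * f b\<bar> \<le> 2 * K * (m a * f a + (\<Sum>n=Suc a..b. (m n - m (n - 1)) * f n) - m b * f b)"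
    using a(2)
  proof (induction b rule: dec_induct)
    case base
    show ?case by (simp add: T_def)
  next
    case (step b)
    have 1: "(\<Sum>n=a..Suc b. c n * f n) - T (Suc b) * f (Suc b) = ((\<Sum>n=a..b. c n * f n) - T b * f b) + T b * (f b - f (Suc b))"
      using step by (simp add: T_def algebra_simps)
    have "f (Suc b) \<le> f b" using step a by (intro f) auto
    then have "\<bar>T b * (f b - f (Suc b))\<bar> \<le> 2 * K * m b * (f b - f (Suc b))"
      using T[of b] step by (simp add: abs_mult mult_right_mono)
    moreover have "2 * K * (m a * f a + (\<Sum>n=Suc a..Suc b. (m n - m (n - 1)) * f n) - m (Suc b) * f (Suc b))
      = 2 * K * (m a * f a + (\<Sum>n=Suc a..b. (m n - m (n - 1)) * f n) - m b * f b) + 2 * K * m b * (f b - f (Suc b))"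
      using step by (simp add: algebra_simps)
    ultimately show ?case using step.IH unfolding 1 by linarith
  qed
  have "f b \<ge> 0" using a by (intro f0) auto
  then have "\<bar>T b * f b\<bar> \<le> 2 * K * (m b * f b)" using T[of b] a
    using mult_right_mono[of "\<bar>T b\<bar>" "2 * K * m b" "f b"] by (simp add: abs_mult mult_ac)
  then show ?thesis using main by (simp add: ring_distribs)
qed

lemma ln_diff_bounds:
  fixes u v :: real
  assumes "0 < u" "u \<le> v"
  shows "ln v - ln u \<le> (v - u) / u" "(v - u) / v \<le> ln v - ln u"
proof -
  have "ln (v / u) \<le> v / u - 1" using assms by (intro ln_le_minus_one) auto
  then show "ln v - ln u \<le> (v - u) / u" using assms by (simp add: ln_div diff_divide_distrib)
  have "ln (u / v) \<le> u / v - 1" using assms by (intro ln_le_minus_one) auto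
  then show "(v - u) / v \<le> ln v - ln u" using assms by (simp add: ln_div diff_divide_distrib)
qed

lemma lnln_upper:
  fixes u v :: real
  assumes "1 < u" "u \<le> v"
  shows "ln (ln v) - ln (ln u) \<le> (v - u) / (u * ln u)"
proof -
  have l: "0 < ln u" "ln u \<le> ln v" using assms by auto
  have "ln (ln v) - ln (ln u) \<le> (ln v - ln u) / ln u" by (rule ln_diff_bounds(1)[OF l])
  also have "\<dots> \<le> ((v - u) / u) / ln u" using ln_diff_bounds(1)[of u v] assms l by (intro divide_right_mono) auto
  finally show ?thesis by simp
qed

lemma lnln_lower:
  fixes u v :: real
  assumes "1 < u" "u \<le> v"
  shows "(v - u) / (v * ln v) \<le> ln (ln v) - ln (ln u)"
proof -
  have l: "0 < ln u" "ln u \<le> ln v" using assms by auto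
  have "((v - u) / v) / ln v \<le> (ln v - ln u) / ln v" using ln_diff_bounds(2)[of u v] assms l by (intro divide_right_mono) auto
  also have "\<dots> \<le> ln (ln v) - ln (ln u)" by (rule ln_diff_bounds(2)[OF l])
  finally show ?thesis by simp
qed

lemma ln_3_ge_1: "ln (3::real) \<ge> 1"
proof -
  have "exp 1 < (3::real)" using e_less_272 by simp
  then show ?thesis using ln_ge_iff[of 3 1] by simp
qed

lemma ln_nat_ge1: assumes "n \<ge> 3" shows "ln (real n) \<ge> 1"
proof -
  have "ln 3 \<le> ln (real n)" using assms by simp
  then show ?thesis using ln_3_ge_1 by linarith
qed

lemma nlnn_diff: "n \<ge> 3 \<Longrightarrow> real n * ln (real n) - real (n - 1) * ln (real (n - 1)) \<le> 2 * ln (real n)"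
proof -
  assume n: "n \<ge> 3"
  have "(n - 1) * (ln (real n) - ln (real (n - 1))) \<le> (n - 1) * ((real n - real (n - 1)) / real (n - 1))"
    using n by (intro mult_left_mono ln_diff_bounds(1)) auto
  also have "\<dots> = 1" using n by (simp add: of_nat_diff)
  finally have "real n * ln (real n) - real (n - 1) * ln (real (n - 1)) \<le> ln (real n) + 1"
    using n by (simp add: of_nat_diff algebra_simps)
  then show ?thesis using ln_nat_ge1[OF n] by linarith
qed

lemma pdiff_abel:
  assumes C: "C \<ge> 0" "\<And>N. N \<ge> 2 \<Longrightarrow> \<bar>\<Sum>n\<le>N. pdiff n\<bar> \<le> C * (real N * ln (real N))"
    and f: "\<And>i j. 2 \<le> i \<Longrightarrow> i \<le> j \<Longrightarrow> f j \<le> f i" "\<And>i. 2 \<le> i \<Longrightarrow> f i \<ge> 0" and a: "3 \<le> a" "a \<le> b"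
  shows "\<bar>\<Sum>n=a..b. pdiff n * f n\<bar> \<le> 2 * C * (real a * ln (real a) * f a + (\<Sum>n=Suc a..b. 2 * ln (real n) * f n))"
proof -
  have "\<bar>\<Sum>n=a..b. pdiff n * f n\<bar> \<le> 2 * C * (real a * ln (real a) * f a + (\<Sum>n=Suc a..b. (real n * ln (real n) - real (n - 1) * ln (real (n - 1))) * f n))"
    by (rule abel_bound[where m = "\<lambda>n. real n * ln (real n)"]) (use assms in \<open>auto intro!: mult_mono\<close>)
  also have "\<dots> \<le> 2 * C * (real a * ln (real a) * f a + (\<Sum>n=Suc a..b. 2 * ln (real n) * f n))"
    using C(1) a f by (intro mult_left_mono add_left_mono sum_mono mult_right_mono nlnn_diff) auto
  finally show ?thesis .
qed

text \<open>Split at \<open>sqrt N\<close>: below it there are few terms, each at most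
  \<open>1 / ln 2 ^ 2\<close>, and above it \<open>ln n \<ge> ln N / 2\<close> makes each term at
  most \<open>4 / ln N ^ 2\<close>. The constant 5 is 1 + 4.\<close>

lemma sum_inv_ln2_bound: "\<exists>C\<ge>0. \<forall>N\<ge>2. (\<Sum>n=2..N. 1 / ln (real n) ^ 2) \<le> C * (real N / ln (real N) ^ 2)"
proof (rule eventually_bound_ex)
  show "\<forall>\<^sub>F N in sequentially. (\<Sum>n=2..N. 1 / ln (real n) ^ 2) \<le> 5 * (real N / ln (real N) ^ 2)"
  proof -
    have "\<forall>\<^sub>F N in sequentially. sqrt (real N) * (1 / ln 2 ^ 2) + 1 \<le> real N / ln (real N) ^ 2"
      by real_asymp
    then show ?thesis using eventually_ge_at_top[of 2]
    proof eventually_elim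
      case (elim N)
      have lN: "ln (real N) > 0" using elim by auto
      have "1 / ln (real n) ^ 2 \<le> (if real n \<le> sqrt (real N) then 1 / ln 2 ^ 2 else 0) + 4 / ln (real N) ^ 2" if n: "n \<in> {2..N}" for n
      proof (cases "real n \<le> sqrt (real N)")
        case True
        have "1 / ln (real n) ^ 2 \<le> 1 / ln 2 ^ 2" using n by (intro divide_left_mono power_mono mult_pos_pos) auto
        moreover have "0 \<le> 4 / ln (real N) ^ 2" by simp
        ultimately show ?thesis using True by (simp only: if_True)
      next
        case False
        then have "ln (sqrt (real N)) \<le> ln (real n)" using elim n by (subst ln_le_cancel_iff) auto
        then have l: "ln (real N) / 2 \<le> ln (real n)" using elim by (simp add: ln_sqrt)
        then have "1 / ln (real n) ^ 2 \<le> 1 / (ln (real N) / 2) ^ 2" using lN n by (intro divide_left_mono power_mono mult_pos_pos) auto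
        then show ?thesis using False by (simp add: power_divide)
      qed
      then have "(\<Sum>n=2..N. 1 / ln (real n) ^ 2) \<le> (\<Sum>n=2..N. (if real n \<le> sqrt (real N) then 1 / ln 2 ^ 2 else 0) + 4 / ln (real N) ^ 2)"
        by (rule sum_mono)
      also have "\<dots> = (\<Sum>n\<in>{2..N} \<inter> {n. real n \<le> sqrt (real N)}. 1 / ln 2 ^ 2) + real (N - 1) * (4 / ln (real N) ^ 2)"
        by (simp add: sum.distrib sum.If_cases)
      also have "\<dots> \<le> sqrt (real N) * (1 / ln 2 ^ 2) + real N * (4 / ln (real N) ^ 2)"
      proof (intro add_mono mult_right_mono)
        have "card ({2..N} \<inter> {n. real n \<le> sqrt (real N)}) \<le> card {1..nat \<lfloor>sqrt (real N)\<rfloor>}"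
          by (intro card_mono) (auto simp: le_nat_floor)
        then have "real (card ({2..N} \<inter> {n. real n \<le> sqrt (real N)})) \<le> real (nat \<lfloor>sqrt (real N)\<rfloor>)"
          by (simp only: card_atLeastAtMost diff_Suc_1 of_nat_le_iff)
        also have "\<dots> \<le> sqrt (real N)" by (rule of_nat_floor) simp
        finally have "real (card ({2..N} \<inter> {n. real n \<le> sqrt (real N)})) \<le> sqrt (real N)" .
        then show "(\<Sum>n\<in>{2..N} \<inter> {n. real n \<le> sqrt (real N)}. 1 / ln 2 ^ 2) \<le> sqrt (real N) * (1 / ln 2 ^ 2)"
          unfolding sum_constant by (intro mult_right_mono) auto
      qed auto
      also have "\<dots> \<le> 5 * (real N / ln (real N) ^ 2)" using elim by simp
      finally show ?case .
    qed
  qed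
qed auto

text \<open>Up to \<open>1 / ln n ^ 2\<close> the function \<open>n / ln n\<close> is a discrete
  antiderivative of \<open>1 / ln n\<close>; this replaces the logarithmic integral by
  \<open>x / ln x\<close> within the permitted error.\<close>

lemma sum_inv_ln:
  assumes "N \<ge> 3"
  shows "\<bar>(\<Sum>n=3..N. 1 / ln (real n)) - real N / ln (real N)\<bar> \<le> 2 / ln 2 + (\<Sum>n=2..N. 1 / ln (real n) ^ 2)"
proof -
  define m where "m n = real n / ln (real n)" for n
  have d: "\<bar>m (Suc n) - m n - 1 / ln (real (Suc n))\<bar> \<le> 1 / ln (real n) ^ 2" if n: "n \<ge> 2" for n
  proof -
    have l: "ln (real n) > 0" "ln (real n) \<le> ln (real (Suc n))" using n by auto
    have u: "real n * (ln (real (Suc n)) - ln (real n)) \<le> 1"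
      using ln_diff_bounds(1)[of "real n" "real (Suc n)"] n by (simp add: field_simps)
    have u0: "0 \<le> real n * (ln (real (Suc n)) - ln (real n))" using l by simp
    have "m (Suc n) - m n - 1 / ln (real (Suc n)) = - (real n * (ln (real (Suc n)) - ln (real n))) / (ln (real n) * ln (real (Suc n)))"
      using l n by (simp add: m_def divide_simps) (simp add: algebra_simps)
    then have "\<bar>m (Suc n) - m n - 1 / ln (real (Suc n))\<bar> = real n * (ln (real (Suc n)) - ln (real n)) / (ln (real n) * ln (real (Suc n)))"
      using u0 l by (simp add: abs_divide abs_mult)
    also have "\<dots> \<le> 1 / (ln (real n) * ln (real n))" using u u0 l by (intro frac_le mult_left_mono mult_pos_pos) auto
    finally show ?thesis by (simp add: power2_eq_square)
  qed
  have "\<bar>(\<Sum>n=3..M. 1 / ln (real n)) - (m M - m 2)\<bar> \<le> (\<Sum>n=2..<M. 1 / ln (real n) ^ 2)" if "M \<ge> 2" for M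
    using that
  proof (induction M rule: dec_induct)
    case (step M)
    have "(\<Sum>n=3..Suc M. 1 / ln (real n)) = (\<Sum>n=3..M. 1 / ln (real n)) + 1 / ln (real (Suc M))" using step by simp
    moreover have "(\<Sum>n=2..<Suc M. 1 / ln (real n) ^ 2) = (\<Sum>n=2..<M. 1 / ln (real n) ^ 2) + 1 / ln (real M) ^ 2" using step by simp
    ultimately show ?case using d[of M] step by linarith
  qed simp
  from this[of N] have "\<bar>(\<Sum>n=3..N. 1 / ln (real n)) - (m N - m 2)\<bar> \<le> (\<Sum>n=2..<N. 1 / ln (real n) ^ 2)" using assms by simp
  moreover have "(\<Sum>n=2..<N. 1 / ln (real n) ^ 2) \<le> (\<Sum>n=2..N. 1 / ln (real n) ^ 2)" by (intro sum_mono2) auto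
  moreover have "m 2 = 2 / ln 2" by (simp add: m_def)
  moreover have "m 2 > 0" by (simp add: m_def)
  ultimately show ?thesis unfolding m_def[symmetric] by linarith
qed

text \<open>Lets bounded quantities be absorbed into the error term. It is
  \<open>ln y \<le> y - 1\<close> at \<open>y = sqrt x\<close>.\<close>

lemma x_ln2_lower: "x \<ge> 2 \<Longrightarrow> 1 / 4 \<le> x / ln x ^ 2" for x :: real
proof -
  assume x: "x \<ge> 2"
  have "ln (sqrt x) \<le> sqrt x - 1" using x by (intro ln_le_minus_one) auto
  then have "ln x \<le> 2 * sqrt x" using x by (simp add: ln_sqrt)
  then have "ln x ^ 2 \<le> (2 * sqrt x) ^ 2" using x by (intro power_mono) auto
  then have "ln x ^ 2 \<le> 4 * x" using x by (simp add: power_mult_distrib)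
  moreover have "ln x ^ 2 > 0" using x by simp
  ultimately show ?thesis by (simp add: field_simps)
qed

definition prime_pi :: "real \<Rightarrow> nat" where "prime_pi x = card {p. prime p \<and> real p \<le> x}"

lemma primes_atMost: "{p::nat. prime p \<and> real p \<le> real N} = {p\<in>{2..N}. prime p}"
  by (auto intro: prime_ge_2_nat)

text \<open>Partial summation with the weight \<open>1 / ln n ^ 3\<close> turns \<open>pdiff\<close>
  into the indicator of the primes minus \<open>1 / ln n\<close>.\<close>

lemma prime_counting_nat: "\<exists>C\<ge>0. \<forall>N\<ge>2. \<bar>real (prime_pi (real N)) - real N / ln (real N)\<bar> \<le> C * (real N / ln (real N) ^ 2)"
proof -
  obtain K where K: "K \<ge> 0" "\<And>N. N \<ge> 2 \<Longrightarrow> \<bar>\<Sum>n\<le>N. pdiff n\<bar> \<le> K * (real N * ln (real N))" using sum_pdiff_bound by blast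
  obtain C0 where C0: "C0 \<ge> 0" "\<And>N. N \<ge> 2 \<Longrightarrow> (\<Sum>n=2..N. 1 / ln (real n) ^ 2) \<le> C0 * (real N / ln (real N) ^ 2)" using sum_inv_ln2_bound by blast
  define A where "A = 2 * K * (3 / ln 3 ^ 2) + 2 / ln 2 + 1"
  have A0: "A \<ge> 0" using K by (simp add: A_def)
  have "\<forall>\<^sub>F N in sequentially. \<bar>real (prime_pi (real N)) - real N / ln (real N)\<bar> \<le> (4 * A + (4 * K + 1) * C0) * (real N / ln (real N) ^ 2)"
    using eventually_ge_at_top[of 3]
  proof eventually_elim
    case (elim N)
    let ?f = "\<lambda>n. 1 / ln (real n) ^ 3"
    let ?Q = "\<Sum>n=2..N. 1 / ln (real n) ^ 2"
    have "\<bar>\<Sum>n=3..N. pdiff n * ?f n\<bar> \<le> 2 * K * (real 3 * ln (real 3) * ?f 3 + (\<Sum>n=Suc 3..N. 2 * ln (real n) * ?f n))"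
    proof (rule pdiff_abel[OF K])
      show "?f j \<le> ?f i" if "2 \<le> i" "i \<le> j" for i j using that by (intro divide_left_mono power_mono mult_pos_pos) auto
    qed (use elim in auto)
    also have "(\<Sum>n=Suc 3..N. 2 * ln (real n) * ?f n) = (\<Sum>n=Suc 3..N. 2 * (1 / ln (real n) ^ 2))"
      by (intro sum.cong) (auto simp: power2_eq_square power3_eq_cube)
    also have "\<dots> \<le> 2 * ?Q" unfolding sum_distrib_left by (intro sum_mono2) auto
    also have "real 3 * ln (real 3) * ?f 3 = 3 / ln 3 ^ 2" by (simp add: power2_eq_square power3_eq_cube)
    finally have 1: "\<bar>\<Sum>n=3..N. pdiff n * ?f n\<bar> \<le> 2 * K * (3 / ln 3 ^ 2) + 4 * K * ?Q"
      using K(1) by (simp add: ring_distribs mult_left_mono)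
    have "(\<Sum>n=3..N. pdiff n * ?f n) = (\<Sum>n=3..N. (if prime n then 1 else 0) - 1 / ln (real n))"
    proof (rule sum.cong)
      fix n assume "n \<in> {3..N}"
      then have "ln (real n) > 0" by auto
      then show "pdiff n * ?f n = (if prime n then 1 else 0) - 1 / ln (real n)"
        by (simp add: pdiff_def power2_eq_square power3_eq_cube field_simps)
    qed simp
    also have "\<dots> = (\<Sum>n=3..N. if prime n then 1 else 0) - (\<Sum>n=3..N. 1 / ln (real n))" by (rule sum_subtractf)
    \<comment> \<open>The sum starts at 3, so the prime 2 is missing; this is the
      \<open>- 1\<close>.\<close>
    also have "(\<Sum>n=3..N. if prime n then 1 else 0) = real (prime_pi (real N)) - 1"
    proof -
      have "{p. prime p \<and> real p \<le> real N} = insert 2 {n\<in>{3..N}. prime n}"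
      proof -
        have "{2..N} = insert 2 {3..N}" using elim by auto
        then show ?thesis unfolding primes_atMost by (auto simp: two_is_prime_nat)
      qed
      then have "prime_pi (real N) = Suc (card {n\<in>{3..N}. prime n})" unfolding prime_pi_def by simp
      moreover have "(\<Sum>n=3..N. if prime n then 1 else 0 :: real) = real (card {n\<in>{3..N}. prime n})"
      proof -
        have "(\<Sum>n=3..N. if prime n then 1 else 0 :: real) = (\<Sum>n\<in>{n\<in>{3..N}. prime n}. 1)"
          by (rule sum.inter_filter[symmetric]) simp
        then show ?thesis by (simp only: sum_constant mult_1_right)
      qed
      ultimately show ?thesis by simp
    qed
    finally have "\<bar>real (prime_pi (real N)) - 1 - (\<Sum>n=3..N. 1 / ln (real n))\<bar> \<le> 2 * K * (3 / ln 3 ^ 2) + 4 * K * ?Q" using 1 by simp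
    then have "\<bar>real (prime_pi (real N)) - real N / ln (real N)\<bar> \<le> A + (4 * K + 1) * ?Q"
      using sum_inv_ln[OF elim] unfolding A_def by (simp add: ring_distribs)
    also have "A + (4 * K + 1) * ?Q \<le> A * (4 * (real N / ln (real N) ^ 2)) + (4 * K + 1) * (C0 * (real N / ln (real N) ^ 2))"
    proof (rule add_mono)
      have "A * 1 \<le> A * (4 * (real N / ln (real N) ^ 2))"
        using x_ln2_lower[of "real N"] A0 elim by (intro mult_left_mono) auto
      then show "A \<le> A * (4 * (real N / ln (real N) ^ 2))" by simp
      show "(4 * K + 1) * ?Q \<le> (4 * K + 1) * (C0 * (real N / ln (real N) ^ 2))"
        using K(1) C0(2)[of N] elim by (intro mult_left_mono) auto
    qed
    finally show ?case by (simp add: ring_distribs mult_ac)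
  qed
  then show ?thesis by (rule eventually_bound_ex) auto
qed

text \<open>Between an integer and the next, \<open>x / ln x\<close> moves by at most the constant
  \<open>D\<close>, which \<open>x_ln2_lower\<close> absorbs.\<close>

theorem prime_counting: "\<exists>C\<ge>0. \<forall>x\<ge>2. \<bar>real (prime_pi x) - x / ln x\<bar> \<le> C * (x / ln x ^ 2)"
proof -
  obtain C where C: "C \<ge> 0" "\<And>N. N \<ge> 2 \<Longrightarrow> \<bar>real (prime_pi (real N)) - real N / ln (real N)\<bar> \<le> C * (real N / ln (real N) ^ 2)"
    using prime_counting_nat by blast
  define D :: real where "D = 1 / ln 2 + 1 / ln 2 ^ 2"
  have D: "D \<ge> 0" by (simp add: D_def)
  have "\<bar>real (prime_pi x) - x / ln x\<bar> \<le> (4 * C + 4 * D) * (x / ln x ^ 2)" if x: "x \<ge> 2" for x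
  proof -
    define N where "N = nat \<lfloor>x\<rfloor>"
    have N: "real N \<le> x" "x < real N + 1" "N \<ge> 2" using x by (auto simp: N_def le_nat_floor of_nat_floor) 
    have l: "ln 2 \<le> ln (real N)" "ln (real N) \<le> ln x" "0 < ln (2::real)" using N x by auto
    have "{p. prime p \<and> real p \<le> x} = {p. prime p \<and> real p \<le> real N}"
    proof -
      have "real p \<le> x \<longleftrightarrow> real p \<le> real N" for p
        using N(1) le_nat_floor[of p x] unfolding N_def[symmetric] by (meson of_nat_le_iff order_trans)
      then show ?thesis by simp
    qed
    then have pe: "prime_pi x = prime_pi (real N)" by (simp add: prime_pi_def)
    have "real N * 2 \<le> real N * real N" using N by (intro mult_left_mono) auto
    then have "x \<le> real N * real N" using N by linarith
    then have "ln x \<le> ln (real N * real N)" using x N by (subst ln_le_cancel_iff) auto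
    then have "ln x / 2 \<le> ln (real N)" using N by (simp add: ln_mult)
    then have "real N / ln (real N) ^ 2 \<le> x / (ln x / 2) ^ 2" using N x l by (intro frac_le power_mono) auto
    then have 1: "C * (real N / ln (real N) ^ 2) \<le> C * (4 * (x / ln x ^ 2))" using C(1) by (intro mult_left_mono) (auto simp: power_divide mult.commute)
    have 2: "\<bar>x / ln x - real N / ln (real N)\<bar> \<le> D"
    proof -
      have u: "real N * (ln x - ln (real N)) \<le> 1"
        using ln_diff_bounds(1)[of "real N" x] N by (simp add: field_simps)
      have "x / ln x - real N / ln (real N) = (x - real N) / ln x - real N * (ln x - ln (real N)) / (ln (real N) * ln x)"
      proof -
        have n0: "ln x \<noteq> 0" "ln (real N) \<noteq> 0" using l by linarith+
        then show ?thesis by (simp add: divide_simps) (simp add: algebra_simps)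
      qed
      moreover have "0 \<le> (x - real N) / ln x" "(x - real N) / ln x \<le> 1 / ln 2" using N l by (auto intro!: frac_le)
      moreover have lp: "0 < ln x" "0 < ln (real N)" using l by linarith+
      moreover have "0 \<le> real N * (ln x - ln (real N)) / (ln (real N) * ln x)"
        using l lp by (intro divide_nonneg_nonneg mult_nonneg_nonneg) auto
      moreover have "real N * (ln x - ln (real N)) / (ln (real N) * ln x) \<le> 1 / (ln 2 * ln 2)"
        using l u lp by (intro frac_le mult_mono mult_pos_pos) linarith+
      moreover have "1 / ln (2::real) ^ 2 = 1 / (ln 2 * ln 2)" by (simp add: power2_eq_square)
      moreover have "0 \<le> 1 / ln (2::real)" "0 \<le> 1 / (ln 2 * ln (2::real))" by auto
      ultimately show ?thesis unfolding D_def by linarith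
    qed
    have "1 \<le> 4 * (x / ln x ^ 2)" using x_ln2_lower[OF x] by linarith
    from mult_left_mono[OF this D] have "D * 1 \<le> D * (4 * (x / ln x ^ 2))" .
    moreover have "(4 * C + 4 * D) * (x / ln x ^ 2) = C * (4 * (x / ln x ^ 2)) + D * (4 * (x / ln x ^ 2))"
      by (simp only: ring_distribs mult_ac)
    ultimately show ?thesis using 1 2 C(2)[OF N(3)] unfolding pe by linarith
  qed
  then show ?thesis using C(1) D by (intro exI[of _ "4 * C + 4 * D"]) auto
qed

section \<open>Sums of reciprocals of primes\<close>

lemma sum_inv_nlnn:
  assumes "3 \<le> a" "a \<le> b"
  shows "\<bar>(\<Sum>n=a..b. 1 / (real n * ln (real n))) - (ln (ln (real b)) - ln (ln (real a)))\<bar> \<le> 1 / (real a * ln (real a))"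
proof -
  let ?g = "\<lambda>n. 1 / (real n * ln (real n))"
  have up: "(\<Sum>n=a..b. ?g n) \<le> ?g a + (ln (ln (real b)) - ln (ln (real a)))"
    using assms(2)
  proof (induction b rule: dec_induct)
    case (step b)
    then show ?case using lnln_lower[of "real b" "real (Suc b)"] assms by simp
  qed simp
  have lo: "(\<Sum>n=a..b. ?g n) \<ge> ln (ln (real b)) - ln (ln (real a)) + ?g b"
    using assms(2)
  proof (induction b rule: dec_induct)
    case (step b)
    then show ?case using lnln_upper[of "real b" "real (Suc b)"] assms by simp
  qed simp
  have "?g b \<ge> 0" "?g a \<ge> 0" using assms by auto
  then show ?thesis using up lo by linarith
qed

lemma sum_inv_nln2n:
  assumes "3 \<le> a" "a \<le> b"
  shows "(\<Sum>n=Suc a..b. 1 / (real n * ln (real n) ^ 2)) \<le> 1 / ln (real a) - 1 / ln (real b)"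
  using assms(2)
proof (induction b rule: dec_induct)
  case (step b)
  have l: "ln (real b) > 0" "ln (real (Suc b)) > 0" "ln (real b) \<le> ln (real (Suc b))" using step assms by auto
  have "1 / (real (Suc b) * ln (real (Suc b)) ^ 2) = (1 / real (Suc b)) / (ln (real (Suc b)) * ln (real (Suc b)))" by (simp add: power2_eq_square)
  also have "\<dots> \<le> (ln (real (Suc b)) - ln (real b)) / (ln (real b) * ln (real (Suc b)))"
    using ln_diff_bounds(2)[of "real b" "real (Suc b)"] step assms l by (intro frac_le mult_right_mono) auto
  also have "\<dots> = 1 / ln (real b) - 1 / ln (real (Suc b))" using l by (simp add: field_simps)
  finally show ?case using step by simp
qed simp

text \<open>Partial summation with the weight \<open>1 / (n * ln n ^ 3)\<close>. Summing over an
  interval starting at \<open>a\<close> gives an error in terms of \<open>ln a\<close>, and only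
  differences of \<open>ln ln\<close> appear.\<close>

lemma mertens_nat: "\<exists>C\<ge>0. \<forall>a b. 3 \<le> a \<longrightarrow> a \<le> b \<longrightarrow>
   \<bar>(\<Sum>p\<in>{p\<in>{a..b}. prime p}. 1 / real p) - (ln (ln (real b)) - ln (ln (real a)))\<bar> \<le> C / ln (real a)"
proof -
  obtain K where K: "K \<ge> 0" "\<And>N. N \<ge> 2 \<Longrightarrow> \<bar>\<Sum>n\<le>N. pdiff n\<bar> \<le> K * (real N * ln (real N))" using sum_pdiff_bound by blast
  have "\<bar>(\<Sum>p\<in>{p\<in>{a..b}. prime p}. 1 / real p) - (ln (ln (real b)) - ln (ln (real a)))\<bar> \<le> (6 * K + 1) / ln (real a)"
    if ab: "3 \<le> a" "a \<le> b" for a b :: nat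
  proof -
    let ?f = "\<lambda>n. 1 / (real n * ln (real n) ^ 3)"
    have la: "ln (real a) \<ge> 1" using ln_nat_ge1[OF ab(1)] .
    have "\<bar>\<Sum>n=a..b. pdiff n * ?f n\<bar> \<le> 2 * K * (real a * ln (real a) * ?f a + (\<Sum>n=Suc a..b. 2 * ln (real n) * ?f n))"
    proof (rule pdiff_abel[OF K])
      show "?f j \<le> ?f i" if "2 \<le> i" "i \<le> j" for i j using that by (intro divide_left_mono power_mono mult_mono mult_pos_pos) auto
    qed (use ab in auto)
    also have "(\<Sum>n=Suc a..b. 2 * ln (real n) * ?f n) = 2 * (\<Sum>n=Suc a..b. 1 / (real n * ln (real n) ^ 2))"
      unfolding sum_distrib_left using ab by (intro sum.cong) (auto simp: power2_eq_square power3_eq_cube)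
    also have "\<dots> \<le> 2 * (1 / ln (real a))"
    proof -
      have "1 / ln (real b) \<ge> 0" using ab by auto
      then show ?thesis using sum_inv_nln2n[OF ab] by linarith
    qed
    also have "real a * ln (real a) * ?f a = 1 / ln (real a) ^ 2" using ab by (simp add: power2_eq_square power3_eq_cube)
    also have "\<dots> \<le> 1 / ln (real a)" using la by (intro divide_left_mono) (auto simp: power2_eq_square)
    finally have 1: "\<bar>\<Sum>n=a..b. pdiff n * ?f n\<bar> \<le> 6 * K / ln (real a)"
      using K(1) by (simp add: mult_left_mono)
    have "(\<Sum>n=a..b. pdiff n * ?f n) = (\<Sum>n=a..b. (if prime n then 1 / real n else 0) - 1 / (real n * ln (real n)))"
    proof (rule sum.cong)
      fix n assume "n \<in> {a..b}"
      then have "ln (real n) > 0" "n > 0" using ab by auto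
      then show "pdiff n * ?f n = (if prime n then 1 / real n else 0) - 1 / (real n * ln (real n))"
        by (simp add: pdiff_def power2_eq_square power3_eq_cube field_simps)
    qed simp
    also have "\<dots> = (\<Sum>n=a..b. if prime n then 1 / real n else 0) - (\<Sum>n=a..b. 1 / (real n * ln (real n)))" by (rule sum_subtractf)
    also have "(\<Sum>n=a..b. if prime n then 1 / real n else 0) = (\<Sum>p\<in>{p\<in>{a..b}. prime p}. 1 / real p)"
      by (rule sum.inter_filter[symmetric]) simp
    finally have 2: "\<bar>(\<Sum>p\<in>{p\<in>{a..b}. prime p}. 1 / real p) - (\<Sum>n=a..b. 1 / (real n * ln (real n)))\<bar> \<le> 6 * K / ln (real a)"
      using 1 by simp
    have "1 / (real a * ln (real a)) \<le> 1 / ln (real a)" using la ab by (intro divide_left_mono) auto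
    then show ?thesis using 2 sum_inv_nlnn[OF ab] by (simp add: add_divide_distrib)
  qed
  then show ?thesis using K(1) by (intro exI[of _ "6 * K + 1"]) auto
qed

text \<open>The set \<open>P\<close> may or may not contain a prime equal to \<open>w\<close>,
  because \<open>prime_sum_smooth\<close> truncates at both kinds of endpoint. Moving to real
  endpoints costs a few multiples of \<open>1 / ln z\<close>.\<close>

theorem mertens:
  obtains C :: real where "C \<ge> 0" "\<And>z w P. 2 \<le> z \<Longrightarrow> z \<le> w \<Longrightarrow> {p. prime p \<and> z \<le> real p \<and> real p < w} \<subseteq> P \<Longrightarrow>
    P \<subseteq> {p. prime p \<and> z \<le> real p \<and> real p \<le> w} \<Longrightarrow> \<bar>(\<Sum>p\<in>P. 1 / real p) - (ln (ln w) - ln (ln z))\<bar> \<le> C / ln z"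
proof -
  obtain C where C: "C \<ge> 0" "\<And>a b. 3 \<le> a \<Longrightarrow> a \<le> b \<Longrightarrow>
   \<bar>(\<Sum>p\<in>{p\<in>{a..b}. prime p}. 1 / real p) - (ln (ln (real b)) - ln (ln (real a)))\<bar> \<le> C / ln (real a)"
    using mertens_nat by blast
  have main: "\<bar>(\<Sum>p\<in>P. 1 / real p) - (ln (ln w) - ln (ln z))\<bar> \<le> (C + 4) / ln z"
    if zw: "2 \<le> z" "z \<le> w" and P: "{p. prime p \<and> z \<le> real p \<and> real p < w} \<subseteq> P" "P \<subseteq> {p. prime p \<and> z \<le> real p \<and> real p \<le> w}" for z w P
  proof -
    \<comment> \<open>The integer version starts at 3, so the prime 2 can be lost here; the
      inclusion \<open>PQ\<close> keeps track of it.\<close>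
    define a where "a = max 3 (nat \<lceil>z\<rceil>)"
    define b where "b = nat \<lfloor>w\<rfloor>"
    have lz: "ln z > 0" using zw by simp
    have z1: "1 / (z * ln z) \<le> 1 / ln z" using zw lz by (intro divide_left_mono) auto
    have lzz: "1 / z \<le> 1 / ln z" using lz ln_le_minus_one[of z] zw by (intro divide_left_mono) auto
    have a: "a \<ge> 3" "z \<le> real a" "real a - z \<le> 1" using zw unfolding a_def by (auto simp: max_def) linarith+
    have b: "real b \<le> w" "w < real b + 1" using zw by (auto simp: b_def of_nat_floor)
    have fin: "finite P" by (rule finite_subset[OF P(2)], rule finite_subset[OF _ finite_nat_le[of w]]) auto
    let ?Q = "{p\<in>{a..b}. prime p}"
    have PQ: "P \<subseteq> insert 2 ?Q"
    proof
      fix p assume "p \<in> P"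
      then have p: "prime p" "z \<le> real p" "real p \<le> w" using P by auto
      have "p \<le> b" using p by (auto simp: b_def le_nat_floor)
      moreover have "nat \<lceil>z\<rceil> \<le> p" using p by linarith
      moreover have "p = 2 \<or> p \<ge> 3" using prime_ge_2_nat[OF p(1)] by auto
      ultimately show "p \<in> insert 2 ?Q" using p by (auto simp: a_def)
    qed
    have small: "(\<Sum>p\<in>R. 1 / real p) \<le> 1 / ln z" if R: "R \<subseteq> {q}" "q \<in> R \<Longrightarrow> real q \<ge> z" for R q
    proof (cases "q \<in> R")
      case True
      then have "R = {q}" using R by auto
      moreover have "1 / real q \<le> 1 / z" using R True zw by (intro divide_left_mono) auto
      ultimately show ?thesis using lzz by simp
    next
      case False
      then have "R = {}" using R by auto
      then show ?thesis using lz by simp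
    qed
    show ?thesis
    proof (cases "a \<le> b")
      case True
      have d1: "\<bar>(\<Sum>p\<in>P. 1 / real p) - (\<Sum>p\<in>?Q. 1 / real p)\<bar> \<le> 1 / ln z"
      proof -
        have "(\<Sum>p\<in>P. 1 / real p) = (\<Sum>p\<in>P \<inter> ?Q. 1 / real p) + (\<Sum>p\<in>P - ?Q. 1 / real p)"
          using sum.Int_Diff[OF fin] by blast
        moreover have "(\<Sum>p\<in>?Q. 1 / real p) = (\<Sum>p\<in>P \<inter> ?Q. 1 / real p) + (\<Sum>p\<in>?Q - P. 1 / real p)"
          using sum.Int_Diff[of ?Q "\<lambda>p. 1 / real p" P] by (simp add: Int_commute)
        moreover have "(\<Sum>p\<in>P - ?Q. 1 / real p) \<le> 1 / ln z" using PQ P(2) by (intro small[of _ 2]) auto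
        moreover have "(\<Sum>p\<in>?Q - P. 1 / real p) \<le> 1 / ln z"
        proof (rule small[of _ b])
          show "?Q - P \<subseteq> {b}"
          proof
            fix p assume p: "p \<in> ?Q - P"
            then have "z \<le> real p" using a by auto
            then have "\<not> real p < w" using p P(1) by auto
            then show "p \<in> {b}" using p b by auto
          qed
        qed (use a in auto)
        moreover have "(\<Sum>p\<in>P - ?Q. 1 / real p) \<ge> 0" "(\<Sum>p\<in>?Q - P. 1 / real p) \<ge> 0" by (auto intro!: sum_nonneg)
        ultimately show ?thesis by linarith
      qed
      have d2: "\<bar>(\<Sum>p\<in>?Q. 1 / real p) - (ln (ln (real b)) - ln (ln (real a)))\<bar> \<le> C / ln z"
      proof -
        have "C / ln (real a) \<le> C / ln z" using C(1) a lz zw by (intro divide_left_mono mult_pos_pos) auto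
        then show ?thesis using C(2)[OF a(1) True] by linarith
      qed
      have d3: "0 \<le> ln (ln w) - ln (ln (real b))" "ln (ln w) - ln (ln (real b)) \<le> 1 / ln z"
      proof -
        have bz: "z \<le> real b" using a True by linarith
        show "0 \<le> ln (ln w) - ln (ln (real b))" using b bz zw by (simp add: ln_mono)
        have "ln (ln w) - ln (ln (real b)) \<le> (w - real b) / (real b * ln (real b))" using b bz zw by (intro lnln_upper) auto
        also have "\<dots> \<le> 1 / (z * ln z)" using b bz zw lz by (intro frac_le mult_mono) auto
        finally show "ln (ln w) - ln (ln (real b)) \<le> 1 / ln z" using z1 by linarith
      qed
      have d4: "0 \<le> ln (ln (real a)) - ln (ln z)" "ln (ln (real a)) - ln (ln z) \<le> 1 / ln z"
      proof -
        show "0 \<le> ln (ln (real a)) - ln (ln z)" using a zw by simp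
        have "ln (ln (real a)) - ln (ln z) \<le> (real a - z) / (z * ln z)" using a zw by (intro lnln_upper) auto
        also have "\<dots> \<le> 1 / (z * ln z)" using a zw lz by (intro divide_right_mono) auto
        finally show "ln (ln (real a)) - ln (ln z) \<le> 1 / ln z" using z1 by linarith
      qed
      have "(C + 4) / ln z = C / ln z + 4 * (1 / ln z)" by (simp add: add_divide_distrib)
      then show ?thesis using d1 d2 d3 d4 by linarith
    next
      case False
      then have wz: "w - z \<le> 1" using a b zw unfolding a_def by (auto simp: max_def split: if_splits)
      have "?Q = {}" using False by auto
      then have "P \<subseteq> {2}" using PQ by auto
      then have "(\<Sum>p\<in>P. 1 / real p) \<le> 1 / ln z" using P(2) by (intro small[of _ 2]) auto
      moreover have "0 \<le> (\<Sum>p\<in>P. 1 / real p)" by (intro sum_nonneg) auto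
      moreover have "0 \<le> ln (ln w) - ln (ln z)" using zw by simp
      moreover have "ln (ln w) - ln (ln z) \<le> 1 / ln z"
      proof -
        have "ln (ln w) - ln (ln z) \<le> (w - z) / (z * ln z)" using zw by (intro lnln_upper) auto
        also have "\<dots> \<le> 1 / (z * ln z)" using wz zw lz by (intro divide_right_mono) auto
        finally show ?thesis using z1 by linarith
      qed
      moreover have "(C + 4) / ln z = C / ln z + 4 * (1 / ln z)" "C / ln z \<ge> 0" using C(1) lz by (simp_all add: add_divide_distrib)
      ultimately show ?thesis by linarith
    qed
  qed
  show thesis by (rule that[OF _ main]) (use C(1) in simp)
qed

subsection \<open>The delay equation\<close>

text \<open>The method of steps: the \<open>n\<close>-th iterate is already the solution for
  \<open>s \<le> n + 2\<close>. For \<open>s \<le> 2\<close> the upper limit \<open>max 2 s\<close>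
  collapses the integral, leaving the initial value 1.\<close>

primrec delay_iter :: "real \<Rightarrow> nat \<Rightarrow> real \<Rightarrow> real" where
  "delay_iter \<epsilon> 0 s = 1"
| "delay_iter \<epsilon> (Suc n) s = 1 + \<epsilon> * integral {2..max 2 s} (\<lambda>u. delay_iter \<epsilon> n (u - 1) / (u - 1))"

lemma isCont_indefinite:
  fixes g :: "real \<Rightarrow> real"
  assumes g: "continuous_on {2..} g"
  shows "isCont (\<lambda>s. integral {2..max 2 s} g) s"
proof -
  define b where "b = max 2 s + 1"
  have "continuous_on {2..b} g" by (rule continuous_on_subset[OF g]) auto
  then have "continuous_on {2..b} (\<lambda>x. integral {2..x} g)"
    by (intro indefinite_integral_continuous_1 integrable_continuous_interval)
  moreover have "continuous_on {..<b} (max 2)" by (intro continuous_intros)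
  moreover have "max 2 ` {..<b} \<subseteq> {2..b}" by (auto simp: b_def)
  ultimately have "continuous_on {..<b} (\<lambda>s. integral {2..max 2 s} g)"
    using continuous_on_compose2[of "{2..b}" "\<lambda>x. integral {2..x} g" "{..<b}" "max 2"] by auto
  moreover have "s \<in> {..<b}" by (auto simp: b_def)
  ultimately show ?thesis by (simp add: continuous_on_eq_continuous_at)
qed

lemma delay_iter_cont: "continuous_on UNIV (delay_iter \<epsilon> n)"
proof (induction n)
  case 0
  show ?case by (simp add: continuous_on_const)
next
  case (Suc n)
  have "continuous_on {2..} (\<lambda>u. delay_iter \<epsilon> n (u - 1) / (u - 1))"
    by (intro continuous_intros continuous_on_compose2[OF Suc]) auto
  then have "isCont (\<lambda>s. integral {2..max 2 s} (\<lambda>u. delay_iter \<epsilon> n (u - 1) / (u - 1))) s" for s by (rule isCont_indefinite)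
  then show ?case
    by (auto simp: continuous_on_eq_continuous_at intro!: continuous_intros)
qed

lemma delay_iter_stable: "s \<le> real n + 2 \<Longrightarrow> delay_iter \<epsilon> (Suc n) s = delay_iter \<epsilon> n s"
proof (induction n arbitrary: s)
  case 0
  then have "max 2 s = 2" by auto
  then show ?case by simp
next
  case (Suc n)
  have "integral {2..max 2 s} (\<lambda>u. delay_iter \<epsilon> (Suc n) (u - 1) / (u - 1)) = integral {2..max 2 s} (\<lambda>u. delay_iter \<epsilon> n (u - 1) / (u - 1))"
  proof (rule integral_cong)
    fix u assume "u \<in> {2..max 2 s}"
    then have "u - 1 \<le> real n + 2" using Suc.prems by (auto simp: max_def split: if_splits)
    then show "delay_iter \<epsilon> (Suc n) (u - 1) / (u - 1) = delay_iter \<epsilon> n (u - 1) / (u - 1)" by (simp only: Suc.IH)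
  qed
  then show ?case by (simp only: delay_iter.simps)
qed

lemma delay_iter_stable': "s \<le> real n + 2 \<Longrightarrow> delay_iter \<epsilon> (n + m) s = delay_iter \<epsilon> n s"
proof (induction m)
  case (Suc m)
  then show ?case using delay_iter_stable[of s "n + m" \<epsilon>] by simp
qed simp

definition delayQ :: "real \<Rightarrow> real \<Rightarrow> real" where "delayQ \<epsilon> s = delay_iter \<epsilon> (nat \<lceil>s\<rceil>) s"

lemma delayQ_eq: "s \<le> real n + 2 \<Longrightarrow> delayQ \<epsilon> s = delay_iter \<epsilon> n s"
proof -
  assume s: "s \<le> real n + 2"
  have "s \<le> real (nat \<lceil>s\<rceil>) + 2" by linarith
  from delay_iter_stable'[OF this, of \<epsilon> n] delay_iter_stable'[OF s, of \<epsilon> "nat \<lceil>s\<rceil>"]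
  show ?thesis by (simp add: delayQ_def add.commute)
qed

lemma delayQ_one: "s \<le> 2 \<Longrightarrow> delayQ \<epsilon> s = 1"
  using delayQ_eq[of s 0] by simp

lemma delayQ_cont: "continuous_on UNIV (delayQ \<epsilon>)"
proof -
  have "isCont (delayQ \<epsilon>) s" for s
  proof -
    define n where "n = nat \<lceil>s\<rceil>"
    have s: "s \<in> {..<real n + 2}" unfolding n_def by simp linarith
    have "continuous_on {..<real n + 2} (delay_iter \<epsilon> n)" by (rule continuous_on_subset[OF delay_iter_cont]) auto
    then have "continuous_on {..<real n + 2} (delayQ \<epsilon>)"
      by (rule continuous_on_eq) (auto simp: delayQ_eq[of _ n])
    then show ?thesis using s by (simp add: continuous_on_eq_continuous_at)
  qed
  then show ?thesis by (simp add: continuous_on_eq_continuous_at)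
qed

lemma delayQ_int_cont: "continuous_on {2..} (\<lambda>u. delayQ \<epsilon> (u - 1) / (u - 1))"
  by (intro continuous_intros continuous_on_compose2[OF delayQ_cont]) auto

lemma delayQ_int:
  assumes "s \<ge> 2" shows "delayQ \<epsilon> s = 1 + \<epsilon> * integral {2..s} (\<lambda>u. delayQ \<epsilon> (u - 1) / (u - 1))"
proof -
  define n where "n = nat \<lceil>s\<rceil>"
  have n: "s \<le> real n" unfolding n_def by linarith
  have "delayQ \<epsilon> s = delay_iter \<epsilon> (Suc n) s" using n by (intro delayQ_eq) auto
  also have "\<dots> = 1 + \<epsilon> * integral {2..s} (\<lambda>u. delay_iter \<epsilon> n (u - 1) / (u - 1))" using assms by (simp add: max_def)
  also have "integral {2..s} (\<lambda>u. delay_iter \<epsilon> n (u - 1) / (u - 1)) = integral {2..s} (\<lambda>u. delayQ \<epsilon> (u - 1) / (u - 1))"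
    using n by (intro integral_cong) (auto simp: delayQ_eq[of _ n])
  finally show ?thesis .
qed

lemma delayQ_deriv_within:
  assumes "2 \<le> a" "t \<in> {a..b}"
  shows "(delayQ \<epsilon> has_real_derivative \<epsilon> * (delayQ \<epsilon> (t - 1) / (t - 1))) (at t within {a..b})"
proof -
  let ?g = "\<lambda>u. delayQ \<epsilon> (u - 1) / (u - 1)"
  have "((\<lambda>x. integral {2..x} ?g) has_real_derivative ?g t) (at t within {2..b})"
    by (rule integral_has_real_derivative[OF continuous_on_subset[OF delayQ_int_cont]]) (use assms in auto)
  then have "((\<lambda>x. 1 + \<epsilon> * integral {2..x} ?g) has_real_derivative \<epsilon> * ?g t) (at t within {2..b})"
    by (auto intro!: derivative_eq_intros)
  then have "(delayQ \<epsilon> has_real_derivative \<epsilon> * ?g t) (at t within {2..b})"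
    by (rule has_field_derivative_transform_within[where d = 1]) (use assms delayQ_int in auto)
  then show ?thesis by (rule DERIV_subset) (use assms in auto)
qed

lemma delayQ_deriv:
  assumes "t > 2"
  shows "(delayQ \<epsilon> has_real_derivative \<epsilon> * (delayQ \<epsilon> (t - 1) / (t - 1))) (at t)"
proof -
  have "(delayQ \<epsilon> has_real_derivative \<epsilon> * (delayQ \<epsilon> (t - 1) / (t - 1))) (at t within {2..t+1})"
    using assms by (intro delayQ_deriv_within) auto
  moreover have "at t within {2..t+1} = at t" using assms by (intro at_within_interior) auto
  ultimately show ?thesis by simp
qed

text \<open>Up to 3 the delayed argument stays where both functions are 1, so their increments are
  opposite. This is why the formula for \<open>F\<close> persists up to 3 while that for
  \<open>f\<close> stops at 2.\<close>

lemma delayQ_sum_2_3: "s \<le> 3 \<Longrightarrow> delayQ 1 s + delayQ (-1) s = 2"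
proof (cases "s \<le> 2")
  case False
  assume s: "s \<le> 3"
  have "integral {2..s} (\<lambda>u. delayQ 1 (u - 1) / (u - 1)) = integral {2..s} (\<lambda>u. delayQ (-1) (u - 1) / (u - 1))"
    using s by (intro integral_cong) (auto simp: delayQ_one)
  then show ?thesis using delayQ_int[of s 1] delayQ_int[of s "-1"] False by simp
qed (auto simp: delayQ_one)

text \<open>Passing to the sum and the difference couples the two scalar delay equations: the
  derivative of each is the shifted other one divided by \<open>s - 1\<close>, which is the system
  for \<open>s F\<close> and \<open>s f\<close>.\<close>

lemma sieve_pair_delayQ:
  "sieve_pair (\<lambda>s. exp euler_mascheroni * (delayQ 1 s + delayQ (-1) s) / s) (\<lambda>s. exp euler_mascheroni * (delayQ 1 s - delayQ (-1) s) / s)"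
  unfolding sieve_pair_def
proof (intro conjI allI impI)
  show "continuous_on {0<..} (\<lambda>s. exp euler_mascheroni * (delayQ 1 s + delayQ (-1) s) / s)"
    "continuous_on {0<..} (\<lambda>s. exp euler_mascheroni * (delayQ 1 s - delayQ (-1) s) / s)"
    by (intro continuous_intros continuous_on_subset[OF delayQ_cont]; auto)+
  show "exp euler_mascheroni * (delayQ 1 s + delayQ (-1) s) / s = 2 * exp euler_mascheroni / s" if "0 < s \<and> s \<le> 3" for s
    using that delayQ_sum_2_3[of s] by simp
  show "exp euler_mascheroni * (delayQ 1 s - delayQ (-1) s) / s = 0" if "0 < s \<and> s \<le> 2" for s
    using that by (simp add: delayQ_one)
  fix s :: real assume s: "s > 2"
  show "((\<lambda>t. t * (exp euler_mascheroni * (delayQ 1 t + delayQ (-1) t) / t)) has_real_derivative exp euler_mascheroni * (delayQ 1 (s - 1) - delayQ (-1) (s - 1)) / (s - 1)) (at s)"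
  proof (rule has_field_derivative_transform_within_open)
    show "((\<lambda>t. exp euler_mascheroni * (delayQ 1 t + delayQ (-1) t)) has_real_derivative exp euler_mascheroni * (delayQ 1 (s - 1) - delayQ (-1) (s - 1)) / (s - 1)) (at s)"
      using delayQ_deriv[OF s, of 1] delayQ_deriv[OF s, of "-1"]
      by (auto intro!: derivative_eq_intros simp: diff_divide_distrib algebra_simps)
  qed (use s in \<open>auto intro!: open_greaterThan[of 2]\<close>)
  show "((\<lambda>t. t * (exp euler_mascheroni * (delayQ 1 t - delayQ (-1) t) / t)) has_real_derivative exp euler_mascheroni * (delayQ 1 (s - 1) + delayQ (-1) (s - 1)) / (s - 1)) (at s)"
  proof (rule has_field_derivative_transform_within_open)
    show "((\<lambda>t. exp euler_mascheroni * (delayQ 1 t - delayQ (-1) t)) has_real_derivative exp euler_mascheroni * (delayQ 1 (s - 1) + delayQ (-1) (s - 1)) / (s - 1)) (at s)"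
      using delayQ_deriv[OF s, of 1] delayQ_deriv[OF s, of "-1"]
      by (auto intro!: derivative_eq_intros simp: add_divide_distrib algebra_simps)
  qed (use s in \<open>auto intro!: open_greaterThan[of 2]\<close>)
qed

lemma delay_zero_step:
  fixes D d :: "real \<Rightarrow> real"
  assumes cont: "continuous_on {0<..} D" and der: "\<And>t. t > 2 \<Longrightarrow> ((\<lambda>t. t * D t) has_real_derivative d (t - 1)) (at t)"
    and z: "D 2 = 0" "\<And>t. 0 < t \<Longrightarrow> t \<le> r \<Longrightarrow> d t = 0" and s: "2 < s" "s \<le> r + 1"
  shows "D s = 0"
proof -
  have "continuous_on {2..s} (\<lambda>t. t * D t)"
    by (intro continuous_intros continuous_on_subset[OF cont]) auto
  moreover have "((\<lambda>t. t * D t) has_real_derivative 0) (at t)" if "2 < t" "t < s" for t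
    using der[OF that(1)] z(2)[of "t - 1"] that s by simp
  ultimately have "s * D s = 2 * D 2"
    using DERIV_isconst_end[of 2 s "\<lambda>t. t * D t"] s by simp
  then show ?thesis using z s by simp
qed

text \<open>Makes the \<open>THE\<close> in \<open>sieve_F\<close> and \<open>sieve_f\<close>
  meaningful: the differences of two solutions vanish up to 2, and \<open>delay_zero_step\<close>
  extends this by one unit at a time, each difference controlling the derivative of the
  other.\<close>

lemma sieve_pair_unique:
  assumes "sieve_pair F f" "sieve_pair G g" "s > 0"
  shows "F s = G s \<and> f s = g s"
proof -
  define D where "D t = F t - G t" for t
  define d where "d t = f t - g t" for t
  have c: "continuous_on {0<..} D" "continuous_on {0<..} d"
    using assms unfolding D_def d_def sieve_pair_def by (auto intro!: continuous_intros)
  have D2: "D t = 0" "d t = 0" if "0 < t" "t \<le> 2" for t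
    using assms that unfolding D_def d_def sieve_pair_def by auto
  have der: "((\<lambda>t. t * D t) has_real_derivative d (t - 1)) (at t)" "((\<lambda>t. t * d t) has_real_derivative D (t - 1)) (at t)" if "t > 2" for t
    using assms(1,2) that unfolding sieve_pair_def D_def d_def right_diff_distrib
    by (auto intro!: DERIV_diff)
  have "\<forall>t. 0 < t \<and> t \<le> real n + 2 \<longrightarrow> D t = 0 \<and> d t = 0" for n
  proof (induction n)
    case 0
    show ?case using D2 by simp
  next
    case (Suc n)
    show ?case
    proof (intro allI impI)
      fix t assume t: "0 < t \<and> t \<le> real (Suc n) + 2"
      show "D t = 0 \<and> d t = 0"
      proof (cases "t \<le> 2")
        case False
        have "D t = 0" by (rule delay_zero_step[of D d "real n + 2"]) (use c der D2 Suc t False in auto)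
        moreover have "d t = 0" by (rule delay_zero_step[of d D "real n + 2"]) (use c der D2 Suc t False in auto)
        ultimately show ?thesis by simp
      qed (use D2 t in auto)
    qed
  qed
  from this[of "nat \<lceil>s\<rceil>"] have *: "\<forall>t. 0 < t \<and> t \<le> real (nat \<lceil>s\<rceil>) + 2 \<longrightarrow> D t = 0 \<and> d t = 0" .
  have "s \<le> real (nat \<lceil>s\<rceil>) + 2" by linarith
  with * have "D s = 0 \<and> d s = 0" using assms(3) by blast
  then show ?thesis by (simp add: D_def d_def)
qed

lemma sieve_F_eq: "s > 0 \<Longrightarrow> sieve_F s = exp euler_mascheroni * (delayQ 1 s + delayQ (-1) s) / s"
  unfolding sieve_F_def
  by (rule the_equality) (use sieve_pair_delayQ sieve_pair_unique in blast)+

lemma sieve_f_eq: "s > 0 \<Longrightarrow> sieve_f s = exp euler_mascheroni * (delayQ 1 s - delayQ (-1) s) / s"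
  unfolding sieve_f_def
  by (rule the_equality) (use sieve_pair_delayQ sieve_pair_unique in blast)+

subsection \<open>Sifted sums\<close>

text \<open>
  Writing \<open>\<phi>(u) = \<phi>(a) + \<integral> \<phi>'\<close> reduces the sum to truncated sums of \<open>1/p\<close>, so that no Stieltjes integral
  is needed.
\<close>
lemma prime_sum_smooth:
  fixes \<phi> \<phi>' :: "real \<Rightarrow> real"
  assumes C: "C \<ge> 0" and mert: "\<And>z w P. 2 \<le> z \<Longrightarrow> z \<le> w \<Longrightarrow> {p. prime p \<and> z \<le> real p \<and> real p < w} \<subseteq> P \<Longrightarrow>
    P \<subseteq> {p. prime p \<and> z \<le> real p \<and> real p \<le> w} \<Longrightarrow> \<bar>(\<Sum>p\<in>P. 1 / real p) - (ln (ln w) - ln (ln z))\<bar> \<le> C / ln z"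
    and a: "1 \<le> a" "a \<le> s"
    and der: "\<And>v. v \<in> {a..s} \<Longrightarrow> (\<phi> has_real_derivative \<phi>' v) (at v within {a..s})"
    and bd: "\<And>v. v \<in> {a..s} \<Longrightarrow> \<bar>\<phi>' v\<bar> \<le> B"
    and x: "x powr (1/s) \<ge> 2" "x \<ge> 2"
  defines "P \<equiv> {p::nat. prime p \<and> x powr (1/s) \<le> real p \<and> real p < x powr (1/a)}"
  shows "\<bar>(\<Sum>p\<in>P. (1 / real p) * \<phi> (ln x / ln (real p))) - integral {a..s} (\<lambda>v. \<phi> v / v)\<bar> \<le> (\<bar>\<phi> a\<bar> + B * (s - a)) * (C * s / ln x)"
proof -
  let ?z = "x powr (1/s)"
  let ?u = "\<lambda>p::nat. ln x / ln (real p)"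
  have lx: "ln x > 0" using x by simp
  have z: "ln ?z = ln x / s" using x by (simp add: ln_powr)
  have finP: "finite P" by (rule finite_subset[OF _ finite_nat_le[of "x powr (1/a)"]]) (auto simp: P_def)
  have lp: "ln (real p) > 0" "p > 0" if "prime p" for p :: nat using prime_gt_1_nat[OF that] by auto
  have le_iff: "real p \<le> x powr (1/v) \<longleftrightarrow> v \<le> ?u p" if "prime p" "v > 0" for p v
  proof -
    have "real p \<le> x powr (1/v) \<longleftrightarrow> ln (real p) \<le> ln (x powr (1/v))" using lp[OF that(1)] x by (subst ln_le_cancel_iff) auto
    also have "\<dots> \<longleftrightarrow> v \<le> ?u p" using lp[OF that(1)] that(2) x by (simp add: ln_powr field_simps)
    finally show ?thesis .
  qed
  have ge_iff: "x powr (1/v) \<le> real p \<longleftrightarrow> ?u p \<le> v" if "prime p" "v > 0" for p v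
  proof -
    have "x powr (1/v) \<le> real p \<longleftrightarrow> ln (x powr (1/v)) \<le> ln (real p)" using lp[OF that(1)] x by (subst ln_le_cancel_iff) auto
    also have "\<dots> \<longleftrightarrow> ?u p \<le> v" using lp[OF that(1)] that(2) x by (simp add: ln_powr field_simps)
    finally show ?thesis .
  qed
  have u: "a < ?u p" "?u p \<le> s" if "p \<in> P" for p
    using that ge_iff[of p a] ge_iff[of p s] a by (auto simp: P_def not_le)
  \<comment> \<open>Since \<open>v \<le> ln x / ln p\<close> means
    \<open>p \<le> x powr (1/v)\<close>, this is a Mertens sum between two powers of
    \<open>x\<close>, and its main term \<open>ln s - ln v\<close> does not depend on
    \<open>x\<close>.\<close>
  define M where "M v = (\<Sum>p\<in>{p\<in>P. v \<le> ?u p}. 1 / real p)" for v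
  have M: "\<bar>M v - (ln s - ln v)\<bar> \<le> C * s / ln x" if v: "v \<in> {a..s}" for v
  proof -
    have v0: "v > 0" using v a by auto
    have w1: "x powr (1/v) \<le> x powr (1/a)" using v a x by (intro powr_mono) (auto simp: frac_le)
    have w2: "?z \<le> x powr (1/v)" using v a x by (intro powr_mono) (auto simp: frac_le)
    have "\<bar>M v - (ln (ln (x powr (1/v))) - ln (ln ?z))\<bar> \<le> C / ln ?z"
      unfolding M_def
    proof (rule mert[OF x(1) w2])
      show "{p. prime p \<and> ?z \<le> real p \<and> real p < x powr (1/v)} \<subseteq> {p\<in>P. v \<le> ?u p}"
        using w1 by (auto simp: P_def le_iff[OF _ v0, symmetric])
      show "{p\<in>P. v \<le> ?u p} \<subseteq> {p. prime p \<and> ?z \<le> real p \<and> real p \<le> x powr (1/v)}"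
        using le_iff v0 by (auto simp: P_def)
    qed
    moreover have "ln (ln (x powr (1/v))) - ln (ln ?z) = ln s - ln v"
      using v0 v a lx x by (simp add: ln_powr ln_div)
    ultimately show ?thesis unfolding z by (simp add: mult.commute)
  qed
  have cont: "continuous_on {a..s} \<phi>"
    by (rule DERIV_continuous_on[OF der])
  have ftc: "((\<lambda>v. if v \<in> {a..?u p} then \<phi>' v else 0) has_integral (\<phi> (?u p) - \<phi> a)) {a..s}" if "p \<in> P" for p
  proof -
    have "(\<phi>' has_integral (\<phi> (?u p) - \<phi> a)) {a..?u p}"
    proof (rule fundamental_theorem_of_calculus)
      show "(\<phi> has_vector_derivative \<phi>' v) (at v within {a..?u p})" if "v \<in> {a..?u p}" for v
        using der[of v] that u[OF \<open>p \<in> P\<close>] unfolding has_real_derivative_iff_has_vector_derivative[symmetric]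
        by (auto intro: DERIV_subset)
    qed (use u[OF that] in auto)
    then show ?thesis using u[OF that] by (subst has_integral_restrict) auto
  qed
  have "((\<lambda>v. \<Sum>p\<in>P. (1 / real p) * (if v \<in> {a..?u p} then \<phi>' v else 0)) has_integral (\<Sum>p\<in>P. (1 / real p) * (\<phi> (?u p) - \<phi> a))) {a..s}"
    by (intro has_integral_sum finP has_integral_mult_right ftc)
  then have 1: "((\<lambda>v. \<phi>' v * M v) has_integral (\<Sum>p\<in>P. (1 / real p) * (\<phi> (?u p) - \<phi> a))) {a..s}"
  proof (rule has_integral_eq[rotated])
    fix v assume v: "v \<in> {a..s}"
    have "(\<Sum>p\<in>P. (1 / real p) * (if v \<in> {a..?u p} then \<phi>' v else 0)) = (\<Sum>p\<in>P. if v \<le> ?u p then \<phi>' v * (1 / real p) else 0)"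
      using v by (intro sum.cong) auto
    also have "\<dots> = (\<Sum>p\<in>{p\<in>P. v \<le> ?u p}. \<phi>' v * (1 / real p))" by (rule sum.inter_filter[OF finP, symmetric])
    also have "\<dots> = \<phi>' v * M v" unfolding M_def sum_distrib_left ..
    finally show "(\<Sum>p\<in>P. (1 / real p) * (if v \<in> {a..?u p} then \<phi>' v else 0)) = \<phi>' v * M v" .
  qed
  \<comment> \<open>Integration by parts for the main term of \<open>M\<close>: the boundary value
    at \<open>s\<close> vanishes, and the one at \<open>a\<close> is the main term of
    \<open>\<phi> a * M a\<close>, so that only the integral of \<open>\<phi> v / v\<close> is
    left.\<close>
  have 2: "((\<lambda>v. \<phi>' v * (ln s - ln v) - \<phi> v / v) has_integral (\<phi> s * (ln s - ln s) - \<phi> a * (ln s - ln a))) {a..s}"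
  proof (rule fundamental_theorem_of_calculus[OF a(2)])
    fix v assume v: "v \<in> {a..s}"
    have "((\<lambda>v. \<phi> v * (ln s - ln v)) has_real_derivative \<phi>' v * (ln s - ln v) - \<phi> v / v) (at v within {a..s})"
      using der[OF v] v a by (auto intro!: derivative_eq_intros)
    then show "((\<lambda>v. \<phi> v * (ln s - ln v)) has_vector_derivative \<phi>' v * (ln s - ln v) - \<phi> v / v) (at v within {a..s})"
      by (simp add: has_real_derivative_iff_has_vector_derivative)
  qed
  have 3: "((\<lambda>v. \<phi> v / v) has_integral integral {a..s} (\<lambda>v. \<phi> v / v)) {a..s}"
    using a by (intro integrable_integral integrable_continuous_interval continuous_intros cont) auto
  have "((\<lambda>v. \<phi>' v * M v - ((\<phi>' v * (ln s - ln v) - \<phi> v / v) + \<phi> v / v)) has_integral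
     ((\<Sum>p\<in>P. (1 / real p) * (\<phi> (?u p) - \<phi> a)) - ((\<phi> s * (ln s - ln s) - \<phi> a * (ln s - ln a)) + integral {a..s} (\<lambda>v. \<phi> v / v)))) {a..s}"
    (is "(_ has_integral ?E) _")
    by (intro has_integral_diff has_integral_add 1 2 3)
  moreover have "(\<lambda>v. \<phi>' v * M v - ((\<phi>' v * (ln s - ln v) - \<phi> v / v) + \<phi> v / v)) = (\<lambda>v. \<phi>' v * (M v - (ln s - ln v)))"
    by (simp add: fun_eq_iff algebra_simps)
  ultimately have 4: "((\<lambda>v. \<phi>' v * (M v - (ln s - ln v))) has_integral ?E) {a..s}" by (simp only:)
  have B0: "B \<ge> 0" using bd[of a] a by auto
  have "norm ?E \<le> (B * (C * s / ln x)) * measure lborel {a..s}"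
  proof (rule has_integral_bound_real[OF _ _ 4, where S = "{}"])
    show "0 \<le> B * (C * s / ln x)" using B0 C a lx by simp
    show "norm (\<phi>' v * (M v - (ln s - ln v))) \<le> B * (C * s / ln x)" if "v \<in> {a..s} - {}" for v
      unfolding real_norm_def abs_mult using bd[of v] M[of v] that B0 by (intro mult_mono) auto
  qed auto
  then have 5: "\<bar>?E\<bar> \<le> B * (s - a) * (C * s / ln x)" using a by (simp add: mult_ac)
  have Ma: "(\<Sum>p\<in>P. 1 / real p) = M a"
  proof -
    have "{p\<in>P. a \<le> ?u p} = P" using u by (auto intro: less_imp_le)
    then show ?thesis by (simp add: M_def)
  qed
  have "(\<Sum>p\<in>P. (1 / real p) * \<phi> (?u p)) - integral {a..s} (\<lambda>v. \<phi> v / v) = ?E + \<phi> a * (M a - (ln s - ln a))"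
    unfolding Ma[symmetric] by (simp add: right_diff_distrib sum_subtractf sum_distrib_left sum_distrib_right mult.commute)
  also have "\<bar>\<dots>\<bar> \<le> \<bar>?E\<bar> + \<bar>\<phi> a\<bar> * \<bar>M a - (ln s - ln a)\<bar>" unfolding abs_mult[symmetric] by (rule abs_triangle_ineq)
  also have "\<dots> \<le> B * (s - a) * (C * s / ln x) + \<bar>\<phi> a\<bar> * (C * s / ln x)"
    using 5 M[of a] a by (intro add_mono mult_left_mono) auto
  finally show ?thesis by (simp add: ring_distribs mult_ac)
qed

section \<open>Sifted sets, Buchstab's identity and small exponents\<close>

definition sifted :: "real \<Rightarrow> real \<Rightarrow> nat set" where
  "sifted x z = {n. 1 \<le> n \<and> real n \<le> x \<and> (\<forall>p. prime p \<and> p dvd n \<longrightarrow> z \<le> real p)}"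

definition Omega :: "nat \<Rightarrow> nat" where "Omega n = size (prime_factorization n)"

definition sifted_sum :: "real \<Rightarrow> real \<Rightarrow> real \<Rightarrow> real" where
  "sifted_sum \<epsilon> x z = (\<Sum>n\<in>sifted x z. \<epsilon> ^ Omega n)"

lemma finite_sifted: "finite (sifted x z)"
  by (rule finite_subset[OF _ finite_nat_le[of x]]) (auto simp: sifted_def)

lemma Omega_mult: "prime p \<Longrightarrow> m > 0 \<Longrightarrow> Omega (p * m) = Suc (Omega m)"
  by (auto simp: Omega_def prime_factorization_mult prime_factorization_prime)

text \<open>The numbers lost when the level rises from \<open>z\<close> to \<open>w\<close> are
  sorted by their least prime factor \<open>p\<close>. The cofactor may be divisible by
  \<open>p\<close> again, hence the non-strict condition in \<open>sifted\<close>; as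
  \<open>Omega\<close> counts multiplicity, each removal contributes exactly one factor
  \<open>\<epsilon>\<close>.\<close>

lemma buchstab:
  assumes "z \<le> w"
  shows "sifted_sum \<epsilon> x z = sifted_sum \<epsilon> x w + \<epsilon> * (\<Sum>p\<in>{p. prime p \<and> z \<le> real p \<and> real p < w}. sifted_sum \<epsilon> (x / real p) (real p))"
proof -
  let ?P = "{p::nat. prime p \<and> z \<le> real p \<and> real p < w}"
  let ?I = "\<lambda>p. (\<lambda>m. p * m) ` sifted (x / real p) (real p)"
  have finP: "finite ?P" by (rule finite_subset[OF _ finite_nat_le[of w]]) auto
  have mem: "prime p \<and> p dvd p * m \<and> (\<forall>q. prime q \<and> q dvd p * m \<longrightarrow> p \<le> q)" if "prime p" "m \<in> sifted (x / real p) (real p)" for p m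
    using that by (auto simp: sifted_def prime_dvd_mult_iff dest: primes_dvd_imp_eq)
  have eq: "sifted x z = sifted x w \<union> (\<Union>p\<in>?P. ?I p)"
  proof (intro equalityI subsetI)
    fix n assume n: "n \<in> sifted x z"
    show "n \<in> sifted x w \<union> (\<Union>p\<in>?P. ?I p)"
    proof (cases "n \<in> sifted x w")
      case False
      then obtain q where q: "prime q" "q dvd n" "real q < w" using n by (auto simp: sifted_def not_le)
      define p where "p = (LEAST p. prime p \<and> p dvd n)"
      have p: "prime p" "p dvd n" unfolding p_def using LeastI[of "\<lambda>p. prime p \<and> p dvd n" q] q by auto
      have pmin: "p \<le> r" if "prime r" "r dvd n" for r unfolding p_def using that by (intro Least_le) auto
      obtain m where m: "n = p * m" using p by auto
      have p0: "p > 0" using prime_gt_0_nat[OF p(1)] .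
      have "real p < w" using pmin[OF q(1,2)] q by auto
      then have "p \<in> ?P" using p n by (auto simp: sifted_def)
      moreover have "m \<in> sifted (x / real p) (real p)"
        using n m p0 pmin by (auto simp: sifted_def field_simps Suc_le_eq)
      ultimately show ?thesis using m by blast
    qed simp
  next
    fix n assume n: "n \<in> sifted x w \<union> (\<Union>p\<in>?P. ?I p)"
    show "n \<in> sifted x z"
    proof (cases "n \<in> sifted x w")
      case True
      then have "w \<le> real q" if "prime q" "q dvd n" for q using that by (auto simp: sifted_def)
      then have "z \<le> real q" if "prime q" "q dvd n" for q using that assms order_trans by blast
      then show ?thesis using True by (auto simp: sifted_def)
    next
      case False
      with n obtain p where p: "p \<in> ?P" and "n \<in> ?I p" by (elim UnE UN_E) auto
      then obtain m where m: "n = p * m" "m \<in> sifted (x / real p) (real p)" by (elim imageE)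
      have p0: "p > 0" using p prime_gt_0_nat by auto
      have "real (p * m) \<le> x" using m p0 by (simp add: sifted_def field_simps)
      moreover have "z \<le> real q" if q: "prime q" "q dvd p * m" for q
      proof -
        have "p \<le> q" using mem[of p m] p m(2) q by auto
        then have "real p \<le> real q" by simp
        moreover have "z \<le> real p" using p by simp
        ultimately show ?thesis by linarith
      qed
      ultimately show ?thesis using m p0 by (auto simp: sifted_def Suc_le_eq)
    qed
  qed
  have d1: "sifted x w \<inter> (\<Union>p\<in>?P. ?I p) = {}"
  proof (rule ccontr)
    assume "sifted x w \<inter> (\<Union>p\<in>?P. ?I p) \<noteq> {}"
    then obtain p m where "p \<in> ?P" "p * m \<in> sifted x w" by auto
    then have "w \<le> real p" "real p < w" by (auto simp: sifted_def)
    then show False by simp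
  qed
  have d2: "?I p \<inter> ?I q = {}" if "p \<in> ?P" "q \<in> ?P" "p \<noteq> q" for p q
  proof (rule ccontr)
    assume "?I p \<inter> ?I q \<noteq> {}"
    then obtain m m' where m: "m \<in> sifted (x / real p) (real p)" "m' \<in> sifted (x / real q) (real q)" "p * m = q * m'" by blast
    then have "p \<le> q" "q \<le> p" using mem[of p m] mem[of q m'] that by auto
    then show False using that by simp
  qed
  have "sifted_sum \<epsilon> x z = sifted_sum \<epsilon> x w + (\<Sum>n\<in>(\<Union>p\<in>?P. ?I p). \<epsilon> ^ Omega n)"
    unfolding sifted_sum_def eq by (rule sum.union_disjoint) (use finite_sifted finP d1 in auto)
  also have "(\<Sum>n\<in>(\<Union>p\<in>?P. ?I p). \<epsilon> ^ Omega n) = (\<Sum>p\<in>?P. \<Sum>n\<in>?I p. \<epsilon> ^ Omega n)"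
    by (rule sum.UNION_disjoint) (use finite_sifted finP d2 in auto)
  also have "\<dots> = (\<Sum>p\<in>?P. \<epsilon> * sifted_sum \<epsilon> (x / real p) (real p))"
  proof (rule sum.cong)
    fix p assume p: "p \<in> ?P"
    then have "inj_on (\<lambda>m. p * m) (sifted (x / real p) (real p))" using prime_gt_0_nat by (auto intro!: inj_onI)
    then have "(\<Sum>n\<in>?I p. \<epsilon> ^ Omega n) = (\<Sum>m\<in>sifted (x / real p) (real p). \<epsilon> ^ Omega (p * m))" by (simp add: sum.reindex)
    also have "\<dots> = (\<Sum>m\<in>sifted (x / real p) (real p). \<epsilon> * \<epsilon> ^ Omega m)"
      using p by (intro sum.cong) (auto simp: Omega_mult sifted_def)
    finally show "(\<Sum>n\<in>?I p. \<epsilon> ^ Omega n) = \<epsilon> * sifted_sum \<epsilon> (x / real p) (real p)" by (simp add: sifted_sum_def sum_distrib_left)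
  qed simp
  finally show ?thesis by (simp add: sum_distrib_left)
qed

lemma sifted_sum_le:
  assumes "\<bar>\<epsilon>\<bar> = 1" "x \<ge> 0" shows "\<bar>sifted_sum \<epsilon> x z\<bar> \<le> x"
proof -
  have "\<bar>sifted_sum \<epsilon> x z\<bar> \<le> (\<Sum>n\<in>sifted x z. \<bar>\<epsilon> ^ Omega n\<bar>)" unfolding sifted_sum_def by (rule sum_abs)
  also have "\<dots> = real (card (sifted x z))" using assms by (simp add: power_abs)
  also have "card (sifted x z) \<le> card {1..nat \<lfloor>x\<rfloor>}" by (rule card_mono) (auto simp: sifted_def le_nat_floor)
  then have "real (card (sifted x z)) \<le> real (nat \<lfloor>x\<rfloor>)" by simp
  also have "\<dots> \<le> x" using assms by simp
  finally show ?thesis .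
qed

text \<open>Two prime factors force \<open>n \<ge> z * z \<ge> x\<close>. The case
  \<open>n = x\<close> really occurs, for example for the square of a prime at level
  \<open>z = sqrt x\<close>.\<close>

lemma two_prime_factors:
  assumes "n \<in> sifted x z" "n \<noteq> 1" "\<not> prime n" "z \<ge> 0" "x \<le> z * z"
  shows "real n = x"
proof -
  have n: "n > 1" using assms by (auto simp: sifted_def)
  obtain p where p: "prime p" "p dvd n" using prime_factor_nat[of n] assms by auto
  then obtain m where m: "n = p * m" by auto
  have "m \<noteq> 1" using m p assms by auto
  then obtain q where q: "prime q" "q dvd m" using prime_factor_nat by blast
  have m0: "m > 0" using m n by (cases m) auto
  have "z \<le> real p" "z \<le> real q" using assms(1) p q m by (auto simp: sifted_def)
  moreover have "q \<le> m" using q m0 by (intro dvd_imp_le)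
  ultimately have "z * z \<le> real p * real m" using assms by (intro mult_mono) auto
  then show ?thesis using assms m by (auto simp: sifted_def)
qed

text \<open>Besides primes only 1 and possibly \<open>x\<close> itself survive, which explains the
  2; the primes below the level are missing from the sum, which explains
  \<open>prime_pi z\<close>.\<close>

lemma sifted_sum_base:
  assumes \<epsilon>: "\<bar>\<epsilon>\<bar> = 1" and x: "x \<ge> 1" and z: "1 \<le> z" "z \<le> x" "x \<le> z * z"
  shows "\<bar>sifted_sum \<epsilon> x z - \<epsilon> * real (prime_pi x)\<bar> \<le> 2 + real (prime_pi z)"
proof -
  let ?R = "{p::nat. prime p \<and> z \<le> real p \<and> real p \<le> x}"
  have R: "?R \<subseteq> sifted x z" by (auto simp: sifted_def Suc_le_eq prime_gt_0_nat dest: primes_dvd_imp_eq)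
  have finR: "finite ?R" by (rule finite_subset[OF R finite_sifted])
  have sub: "sifted x z - ?R \<subseteq> {1, nat \<lfloor>x\<rfloor>}"
  proof
    fix n assume n: "n \<in> sifted x z - ?R"
    show "n \<in> {1, nat \<lfloor>x\<rfloor>}"
    proof (cases "n = 1 \<or> prime n")
      case True
      then show ?thesis using n by (auto simp: sifted_def)
    next
      case False
      then have "real n = x" using two_prime_factors[of n x z] n z by auto
      then show ?thesis by auto
    qed
  qed
  have "\<bar>\<Sum>n\<in>sifted x z - ?R. \<epsilon> ^ Omega n\<bar> \<le> (\<Sum>n\<in>sifted x z - ?R. \<bar>\<epsilon> ^ Omega n\<bar>)" by (rule sum_abs)
  also have "\<dots> = real (card (sifted x z - ?R))" using \<epsilon> by (simp add: power_abs)
  also have "\<dots> \<le> real (card {1, nat \<lfloor>x\<rfloor>})" using card_mono[OF _ sub] by simp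
  also have "\<dots> \<le> 2" by (cases "nat \<lfloor>x\<rfloor> = 1") auto
  finally have 1: "\<bar>\<Sum>n\<in>sifted x z - ?R. \<epsilon> ^ Omega n\<bar> \<le> 2" .
  have "(\<Sum>n\<in>?R. \<epsilon> ^ Omega n) = (\<Sum>n\<in>?R. \<epsilon>)"
    by (intro sum.cong) (auto simp: Omega_def prime_factorization_prime)
  then have 2: "sifted_sum \<epsilon> x z = \<epsilon> * real (card ?R) + (\<Sum>n\<in>sifted x z - ?R. \<epsilon> ^ Omega n)"
    unfolding sifted_sum_def using sum.subset_diff[OF R finite_sifted, of "\<lambda>n. \<epsilon> ^ Omega n"] by (simp add: mult.commute)
  have 3: "\<bar>real (card ?R) - real (prime_pi x)\<bar> \<le> real (prime_pi z)"
  proof -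
    have "finite {p::nat. prime p \<and> real p \<le> x}" by (rule finite_subset[OF _ finite_nat_le[of x]]) auto
    then have "card ?R \<le> prime_pi x" unfolding prime_pi_def by (intro card_mono) auto
    moreover have "finite {p::nat. prime p \<and> real p \<le> z}" by (rule finite_subset[OF _ finite_nat_le[of z]]) auto
    then have "prime_pi x \<le> card (?R \<union> {p. prime p \<and> real p \<le> z})" unfolding prime_pi_def using finR by (intro card_mono) auto
    then have "prime_pi x \<le> card ?R + prime_pi z" unfolding prime_pi_def using card_Un_le order_trans by blast
    ultimately show ?thesis by linarith
  qed
  have "\<bar>\<epsilon> * real (card ?R) - \<epsilon> * real (prime_pi x)\<bar> \<le> real (prime_pi z)"
    using 3 \<epsilon> by (simp add: abs_mult flip: right_diff_distrib)
  then show ?thesis using 1 unfolding 2 by linarith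
qed

text \<open>Stated down to \<open>z > 1\<close>, where there are no primes below 2, because a
  sifting level \<open>x powr (1/s)\<close> can lie below 2.\<close>

lemma prime_pi_upper: "\<exists>C\<ge>0. \<forall>z>1. real (prime_pi z) \<le> C * (z / ln z)"
proof -
  obtain C where C: "C \<ge> 0" "\<And>x. x \<ge> 2 \<Longrightarrow> \<bar>real (prime_pi x) - x / ln x\<bar> \<le> C * (x / ln x ^ 2)" using prime_counting by blast
  have "real (prime_pi z) \<le> (1 + C / ln 2) * (z / ln z)" if z: "z > 1" for z
  proof (cases "z \<ge> 2")
    case True
    have "ln 2 \<le> ln z" using True by simp
    moreover have "ln (2::real) > 0" by simp
    ultimately have l: "ln 2 \<le> ln z" "0 < ln z" "0 < ln (2::real)" by linarith+
    have "z / ln z ^ 2 = (z / ln z) * (1 / ln z)" by (simp add: power2_eq_square)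
    also have "\<dots> \<le> (z / ln z) * (1 / ln 2)" using l True by (intro mult_left_mono divide_left_mono) auto
    finally have "C * (z / ln z ^ 2) \<le> C * ((z / ln z) * (1 / ln 2))" using C(1) by (rule mult_left_mono)
    moreover have "(1 + C / ln 2) * (z / ln z) = z / ln z + C * ((z / ln z) * (1 / ln 2))" by (simp add: distrib_right add_divide_distrib)
    ultimately show ?thesis using C(2)[OF True] by linarith
  next
    case False
    have "\<not> (prime p \<and> real p \<le> z)" for p :: nat
    proof
      assume "prime p \<and> real p \<le> z"
      then have "2 \<le> real p" "real p \<le> z" using prime_ge_2_nat[of p] by auto
      then show False using False by linarith
    qed
    then have e: "{p::nat. prime p \<and> real p \<le> z} = {}" by simp
    have "ln z > 0" using z by simp
    then have "0 \<le> (1 + C / ln 2) * (z / ln z)" using z C(1) by (intro mult_nonneg_nonneg add_nonneg_nonneg divide_nonneg_nonneg) auto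
    then show ?thesis unfolding prime_pi_def e by (simp only: card.empty of_nat_0)
  qed
  moreover have "1 + C / ln 2 \<ge> 0" using C(1) by simp
  ultimately show ?thesis by blast
qed

section \<open>The asymptotic formula by induction on the unit interval\<close>

lemma delayQ_abs_bound: "\<exists>B\<ge>0. \<forall>s\<in>{0..b}. \<bar>delayQ \<epsilon> s\<bar> \<le> B"
proof -
  have "bounded (delayQ \<epsilon> ` {0..b})"
    by (intro compact_imp_bounded compact_continuous_image continuous_on_subset[OF delayQ_cont]) auto
  then obtain B where "\<forall>y\<in>delayQ \<epsilon> ` {0..b}. norm y \<le> B" by (auto simp: bounded_iff)
  then have "\<bar>delayQ \<epsilon> s\<bar> \<le> \<bar>B\<bar>" if "s \<in> {0..b}" for s
    using that abs_ge_self[of B] order_trans by (metis imageI real_norm_def)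
  then show ?thesis using abs_ge_zero by blast
qed

text \<open>
  The derivative of \<open>Q\<close> jumps at 2, so it is continuous only up to the ends of the unit intervals.
\<close>
lemma delayQ_unit_interval_deriv:
  assumes "k \<ge> 2"
  shows "\<exists>q. continuous_on {real k - 1..real k} q \<and>
    (\<forall>v\<in>{real k - 1..real k}. (delayQ \<epsilon> has_real_derivative q v) (at v within {real k - 1..real k}))"
proof (cases "k = 2")
  case True
  have "(delayQ \<epsilon> has_real_derivative 0) (at v within {1..2})" if "v \<in> {1..2}" for v
    by (rule has_field_derivative_transform_within[OF DERIV_const[of 1], where d = 1]) (use that in \<open>auto simp: delayQ_one\<close>)
  then show ?thesis using True by (intro exI[of _ "\<lambda>_. 0"]) auto
next
  case False
  then have k: "real k \<ge> 3" using assms by simp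
  have "continuous_on {real k - 1..real k} (\<lambda>v. \<epsilon> * (delayQ \<epsilon> (v - 1) / (v - 1)))"
    by (intro continuous_intros continuous_on_subset[OF delayQ_int_cont]) (use k in auto)
  then show ?thesis using delayQ_deriv_within[of "real k - 1" _ "real k" \<epsilon>] k
    by (intro exI[of _ "\<lambda>v. \<epsilon> * (delayQ \<epsilon> (v - 1) / (v - 1))"]) auto
qed

text \<open>With \<open>u = ln x / ln p\<close> the cofactor bound \<open>x / p\<close> has the
  exponent \<open>u - 1\<close> at level \<open>p\<close>, and
  \<open>ln (x / p) = ln x * (u - 1) / u\<close>. So the main term at \<open>x / p\<close> is
  \<open>x / ln x\<close> times \<open>delay_phi \<epsilon> u / p\<close>, up to sign.\<close>

definition delay_phi :: "real \<Rightarrow> real \<Rightarrow> real" where "delay_phi \<epsilon> u = u / (u - 1) * delayQ \<epsilon> (u - 1)"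

text \<open>For \<open>v\<close> between \<open>k\<close> and \<open>k + 1\<close> the argument
  \<open>v - 1\<close> runs through a single unit interval, on which the derivative of
  \<open>delayQ\<close> extends continuously to both ends.\<close>

lemma delay_phi_deriv:
  assumes "k \<ge> 2"
  shows "\<exists>\<phi>' B. \<forall>v\<in>{real k..real k + 1}. (delay_phi \<epsilon> has_real_derivative \<phi>' v) (at v within {real k..real k + 1}) \<and> \<bar>\<phi>' v\<bar> \<le> B"
proof -
  let ?S = "{real k..real k + 1}"
  let ?S' = "{real k - 1..real k}"
  obtain q where q: "continuous_on ?S' q" "\<And>v. v \<in> ?S' \<Longrightarrow> (delayQ \<epsilon> has_real_derivative q v) (at v within ?S')"
    using delayQ_unit_interval_deriv[OF assms, of \<epsilon>] by blast
  have k: "real k \<ge> 2" using assms by simp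
  have im: "(\<lambda>u. u - 1) ` ?S = ?S'" 
  proof (rule set_eqI)
    show "y \<in> (\<lambda>u. u - 1) ` ?S \<longleftrightarrow> y \<in> ?S'" for y by (auto intro!: image_eqI[of _ _ "y + 1"])
  qed
  define \<phi>' where "\<phi>' v = - 1 / (v - 1)^2 * delayQ \<epsilon> (v - 1) + v / (v - 1) * q (v - 1)" for v
  have der: "(delay_phi \<epsilon> has_real_derivative \<phi>' v) (at v within ?S)" if v: "v \<in> ?S" for v
  proof -
    have "((\<lambda>u. u - 1) has_real_derivative 1) (at v within ?S)" by (auto intro!: derivative_eq_intros)
    moreover have "(delayQ \<epsilon> has_real_derivative q (v - 1)) (at (v - 1) within (\<lambda>u. u - 1) ` ?S)"
      unfolding im using v by (intro q(2)) auto
    ultimately have 1: "((\<lambda>u. delayQ \<epsilon> (u - 1)) has_real_derivative q (v - 1)) (at v within ?S)"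
      using DERIV_image_chain[of "delayQ \<epsilon>" "q (v - 1)" "\<lambda>u. u - 1" v ?S 1] by (simp add: o_def)
    have 2: "((\<lambda>u. u / (u - 1)) has_real_derivative (- 1 / (v - 1)^2)) (at v within ?S)"
      using v k by (auto intro!: derivative_eq_intros simp: power2_eq_square field_simps)
    show ?thesis unfolding delay_phi_def[abs_def] \<phi>'_def using DERIV_mult[OF 2 1] by (simp add: add.commute mult.commute)
  qed
  have "continuous_on ?S \<phi>'" unfolding \<phi>'_def[abs_def]
    by (intro continuous_intros continuous_on_compose2[OF delayQ_cont] continuous_on_compose2[OF q(1)]) (use k in auto)
  then have "bounded (\<phi>' ` ?S)" by (intro compact_imp_bounded compact_continuous_image) auto
  then obtain B where "\<forall>y\<in>\<phi>' ` ?S. norm y \<le> B" by (auto simp: bounded_iff)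
  then have B: "\<bar>\<phi>' v\<bar> \<le> B" if "v \<in> ?S" for v using that by auto
  show ?thesis using der B by blast
qed

lemma delayQ_step:
  assumes "2 \<le> a" "a \<le> s"
  shows "delayQ \<epsilon> s = delayQ \<epsilon> a + \<epsilon> * integral {a..s} (\<lambda>v. delay_phi \<epsilon> v / v)"
proof -
  let ?g = "\<lambda>u. delayQ \<epsilon> (u - 1) / (u - 1)"
  have int: "?g integrable_on {2..s}"
    by (intro integrable_continuous_interval continuous_on_subset[OF delayQ_int_cont]) auto
  have "integral {2..a} ?g + integral {a..s} ?g = integral {2..s} ?g"
    by (rule Henstock_Kurzweil_Integration.integral_combine) (use assms int in auto)
  moreover have "integral {a..s} (\<lambda>v. delay_phi \<epsilon> v / v) = integral {a..s} ?g"
    using assms by (intro integral_cong) (auto simp: delay_phi_def)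
  ultimately show ?thesis using delayQ_int[of s \<epsilon>] delayQ_int[of a \<epsilon>] assms by (simp add: ring_distribs flip: \<open>_ = integral {2..s} ?g\<close>)
qed

text \<open>The second error term dominates only for \<open>s < 2\<close>. It is kept separate
  because the step applies the formula at \<open>x / p\<close>, where it has size
  \<open>p / ln x\<close> and is small after summation over \<open>p\<close>.\<close>

definition sifted_asymp :: "real \<Rightarrow> nat \<Rightarrow> real \<Rightarrow> bool" where
  "sifted_asymp \<epsilon> k C \<longleftrightarrow> (\<forall>x\<ge>2. \<forall>s. 1 < s \<longrightarrow> s \<le> real k \<longrightarrow>
     \<bar>sifted_sum \<epsilon> x (x powr (1/s)) - \<epsilon> * (x / ln x) * delayQ \<epsilon> s\<bar> \<le> C * (x / ln x ^ 2 + x powr (1/s) / ln x))"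

lemma sifted_asymp_base:
  assumes \<epsilon>: "\<bar>\<epsilon>\<bar> = 1"
  shows "\<exists>C\<ge>0. sifted_asymp \<epsilon> 2 C"
proof -
  obtain C where C: "C \<ge> 0" "\<And>x. x \<ge> 2 \<Longrightarrow> \<bar>real (prime_pi x) - x / ln x\<bar> \<le> C * (x / ln x ^ 2)" using prime_counting by blast
  obtain D where D: "D \<ge> 0" "\<And>z. z > 1 \<Longrightarrow> real (prime_pi z) \<le> D * (z / ln z)" using prime_pi_upper by blast
  have "\<bar>sifted_sum \<epsilon> x (x powr (1/s)) - \<epsilon> * (x / ln x) * delayQ \<epsilon> s\<bar> \<le> (C + 8 + 2 * D) * (x / ln x ^ 2 + x powr (1/s) / ln x)"
    if x: "x \<ge> 2" and s: "1 < s" "s \<le> 2" for x s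
  proof -
    let ?z = "x powr (1/s)"
    define q where "q = x / ln x ^ 2"
    have lx: "ln x > 0" using x by simp
    have z1: "1 < ?z" using x s by (simp add: gr_one_powr)
    have zx: "?z \<le> x" using x s powr_mono[of "1/s" 1 x] by simp
    have "?z * ?z = x powr (2/s)" using x by (simp flip: powr_add)
    also have "\<dots> \<ge> x powr 1" using x s by (intro powr_mono) auto
    finally have zz: "x \<le> ?z * ?z" using x by simp
    have 1: "\<bar>sifted_sum \<epsilon> x ?z - \<epsilon> * real (prime_pi x)\<bar> \<le> 2 + real (prime_pi ?z)"
      using sifted_sum_base[OF \<epsilon>, of x ?z] x z1 zx zz by simp
    have "ln ?z = ln x / s" using x by (simp add: ln_powr)
    then have "real (prime_pi ?z) \<le> D * (?z / (ln x / s))" using D(2)[OF z1] by simp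
    also have "?z / (ln x / s) = s * (?z / ln x)" by simp
    also have "D * (s * (?z / ln x)) \<le> D * (2 * (?z / ln x))" using D(1) s lx by (intro mult_left_mono mult_right_mono) auto
    finally have 2: "real (prime_pi ?z) \<le> D * (2 * (?z / ln x))" .
    have 3: "\<bar>\<epsilon> * real (prime_pi x) - \<epsilon> * (x / ln x)\<bar> \<le> C * q"
      using C(2)[OF x] \<epsilon> unfolding right_diff_distrib[symmetric] abs_mult q_def by simp
    have 4: "2 \<le> 8 * q" using x_ln2_lower[OF x] by (simp add: q_def)
    have "\<bar>sifted_sum \<epsilon> x ?z - \<epsilon> * (x / ln x) * delayQ \<epsilon> s\<bar> \<le> (C + 8) * q + (2 * D) * (?z / ln x)"
    proof -
      have "\<epsilon> * (x / ln x) * delayQ \<epsilon> s = \<epsilon> * (x / ln x)" using delayQ_one[OF s(2)] by simp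
      moreover have "(C + 8) * q + (2 * D) * (?z / ln x) = C * q + 8 * q + D * (2 * (?z / ln x))" by (simp add: distrib_right)
      ultimately show ?thesis using 1 2 3 4 by linarith
    qed
    also have "\<dots> \<le> (C + 8 + 2 * D) * q + (C + 8 + 2 * D) * (?z / ln x)"
      using C(1) D(1) lx x by (intro add_mono[OF mult_right_mono mult_right_mono]) (auto simp: q_def)
    finally show ?thesis by (simp add: q_def ring_distribs)
  qed
  moreover have "C + 8 + 2 * D \<ge> 0" using C(1) D(1) by simp
  ultimately show ?thesis unfolding sifted_asymp_def by (metis of_nat_numeral)
qed

text \<open>For levels up to \<open>sqrt x\<close> the second error term is absorbed by the
  first.\<close>

lemma w_ln_bound:
  fixes x w :: real
  assumes x: "x \<ge> 2" and w: "w \<ge> 0" "w * w \<le> x"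
  shows "w / ln x \<le> 2 * (x / ln x ^ 2)"
proof -
  have lx: "ln x > 0" using x by simp
  have "ln (sqrt x) \<le> sqrt x - 1" using x by (intro ln_le_minus_one) auto
  then have "ln x \<le> 2 * sqrt x" using x by (simp add: ln_sqrt)
  moreover have "w \<le> sqrt x" using w by (intro real_le_rsqrt) (simp add: power2_eq_square)
  ultimately have "w * ln x \<le> sqrt x * (2 * sqrt x)" using lx x by (intro mult_mono) auto
  moreover have "sqrt x * (2 * sqrt x) = 2 * x" using real_sqrt_mult_self[of x] x by (simp add: mult.left_commute)
  ultimately have "w * ln x \<le> 2 * x" by linarith
  then show ?thesis using lx by (simp add: field_simps power2_eq_square)
qed

lemma abs_sum3_le:
  fixes a b c d :: real
  assumes "a = b + c + d" "\<bar>b\<bar> \<le> r1" "\<bar>c\<bar> \<le> r2" "\<bar>d\<bar> \<le> r3" "R = r1 + r2 + r3"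
  shows "\<bar>a\<bar> \<le> R"
  using assms by linarith

text \<open>Buchstab's identity from the level \<open>x powr (1/s)\<close> up to
  \<open>x powr (1/k)\<close>. The primes in between have \<open>k < u \<le> s \<le> k + 1\<close>
  for \<open>u = ln x / ln p\<close>, so \<open>u - 1\<close> lies in the range of the hypothesis,
  and it exceeds 1 because \<open>k \<ge> 2\<close>.\<close>

lemma sifted_asymp_step:
  assumes \<epsilon>: "\<bar>\<epsilon>\<bar> = 1" and k: "k \<ge> 2" and C: "C \<ge> 0" "sifted_asymp \<epsilon> k C"
  shows "\<exists>C'\<ge>0. sifted_asymp \<epsilon> (Suc k) C'"
proof -
  obtain CM where CM: "CM \<ge> 0" "\<And>z w P. 2 \<le> z \<Longrightarrow> z \<le> w \<Longrightarrow> {p. prime p \<and> z \<le> real p \<and> real p < w} \<subseteq> P \<Longrightarrow>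
    P \<subseteq> {p. prime p \<and> z \<le> real p \<and> real p \<le> w} \<Longrightarrow> \<bar>(\<Sum>p\<in>P. 1 / real p) - (ln (ln w) - ln (ln z))\<bar> \<le> CM / ln z"
    using mertens by blast
  obtain D where D: "D \<ge> 0" "\<And>z. z > 1 \<Longrightarrow> real (prime_pi z) \<le> D * (z / ln z)" using prime_pi_upper by blast
  obtain \<phi>' B where \<phi>: "\<And>v. v \<in> {real k..real k + 1} \<Longrightarrow> (delay_phi \<epsilon> has_real_derivative \<phi>' v) (at v within {real k..real k + 1})"
    "\<And>v. v \<in> {real k..real k + 1} \<Longrightarrow> \<bar>\<phi>' v\<bar> \<le> B"
    using delay_phi_deriv[OF k, of \<epsilon>] by blast
  obtain Bq where Bq: "Bq \<ge> 0" "\<And>s. s \<in> {0..real k + 1} \<Longrightarrow> \<bar>delayQ \<epsilon> s\<bar> \<le> Bq" using delayQ_abs_bound by blast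
  have IH: "\<bar>sifted_sum \<epsilon> x (x powr (1/s)) - \<epsilon> * (x / ln x) * delayQ \<epsilon> s\<bar> \<le> C * (x / ln x ^ 2 + x powr (1/s) / ln x)"
    if "x \<ge> 2" "1 < s" "s \<le> real k" for x s using C(2) that by (auto simp: sifted_asymp_def)
  have B0: "B \<ge> 0" using \<phi>(2)[of "real k"] by simp
  have kr: "real k \<ge> 2" using k by simp
  have ee: "\<epsilon> * \<epsilon> = 1" using \<epsilon> by (metis abs_mult_self_eq mult_1)
  \<comment> \<open>The condition \<open>ln x \<ge> L\<close> guarantees
    \<open>x powr (1/s) \<ge> 2\<close> for all \<open>s \<le> k + 1\<close>, as the sums of
    \<open>1 / p\<close> require. For smaller \<open>x\<close> trivial bounds suffice, since
    \<open>ln x\<close> is then bounded by \<open>L\<close>; their cost is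
    \<open>C1\<close>.\<close>
  define L where "L = (real k + 1) * ln 2"
  define C1 where "C1 = L * L + Bq * L"
  define A1 where "A1 = 1 + CM / ln 2"
  define C2 where "C2 = 3 * C + C * (4 * A1 + 2 * D * real k) + (\<bar>delay_phi \<epsilon> (real k)\<bar> + B) * (CM * (real k + 1))"
  have L0: "L \<ge> 0" by (simp add: L_def)
  have A10: "A1 \<ge> 0" using CM(1) by (simp add: A1_def)
  have C10: "C1 \<ge> 0" using L0 Bq by (simp add: C1_def)
  have C20: "C2 \<ge> 0" using C(1) A10 D(1) B0 CM(1) by (simp add: C2_def)
  have "\<bar>sifted_sum \<epsilon> x (x powr (1/s)) - \<epsilon> * (x / ln x) * delayQ \<epsilon> s\<bar> \<le> (C + C1 + C2) * (x / ln x ^ 2 + x powr (1/s) / ln x)"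
    if x: "x \<ge> 2" and s: "1 < s" "s \<le> real (Suc k)" for x s
  proof -
    define q where "q = x / ln x ^ 2"
    let ?z = "x powr (1/s)"
    have lx: "ln x > 0" using x by simp
    have q0: "q > 0" using x lx by (simp add: q_def)
    have E: "0 \<le> x powr (1/s) / ln x" using lx by simp
    have fin: ?thesis if "\<bar>sifted_sum \<epsilon> x ?z - \<epsilon> * (x / ln x) * delayQ \<epsilon> s\<bar> \<le> c * (q + ?z / ln x)" "c \<le> C + C1 + C2" for c
    proof -
      have "c * (q + ?z / ln x) \<le> (C + C1 + C2) * (q + ?z / ln x)" using that(2) q0 E by (intro mult_right_mono) auto
      then show ?thesis using that(1) unfolding q_def by linarith
    qed
    have fin': ?thesis if "\<bar>sifted_sum \<epsilon> x ?z - \<epsilon> * (x / ln x) * delayQ \<epsilon> s\<bar> \<le> c * q" "c \<le> C + C1 + C2" "0 \<le> c" for c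
    proof -
      have "c * q \<le> c * (q + ?z / ln x)" using that(3) E by (intro mult_left_mono) auto
      then show ?thesis using fin[of c] that by linarith
    qed
    show ?thesis
    proof (cases "s \<le> real k")
      case True
      then show ?thesis using fin[of C] IH[OF x s(1)] C10 C20 by (simp add: q_def)
    next
      case False
      then have sk: "real k < s" "s \<le> real k + 1" using s by auto
      show ?thesis
      proof (cases "ln x < L")
        case True
        have xl: "x / ln x = q * ln x" "x = q * (ln x * ln x)" using lx by (simp_all add: q_def power2_eq_square field_simps)
        have "\<bar>sifted_sum \<epsilon> x ?z\<bar> \<le> x" using sifted_sum_le[OF \<epsilon>] x by simp
        also have "x \<le> q * (L * L)" using True lx q0 by (subst xl(2)) (intro mult_left_mono mult_mono, auto)
        finally have a: "\<bar>sifted_sum \<epsilon> x ?z\<bar> \<le> q * (L * L)" .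
        have "\<bar>\<epsilon> * (x / ln x) * delayQ \<epsilon> s\<bar> = (x / ln x) * \<bar>delayQ \<epsilon> s\<bar>" using \<epsilon> x lx by (simp add: abs_mult)
        also have "\<dots> \<le> (q * L) * Bq" unfolding xl(1) using True lx q0 Bq(2)[of s] s L0 by (intro mult_mono) auto
        finally have "\<bar>\<epsilon> * (x / ln x) * delayQ \<epsilon> s\<bar> \<le> (q * L) * Bq" .
        moreover have "C1 * q = q * (L * L) + (q * L) * Bq" by (simp add: C1_def algebra_simps)
        ultimately have "\<bar>sifted_sum \<epsilon> x ?z - \<epsilon> * (x / ln x) * delayQ \<epsilon> s\<bar> \<le> C1 * q" using a by linarith
        then show ?thesis by (rule fin') (use C10 C20 C(1) in auto)
      next
        case False
        let ?w = "x powr (1/real k)"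
        let ?u = "\<lambda>p::nat. ln x / ln (real p)"
        let ?P = "{p::nat. prime p \<and> ?z \<le> real p \<and> real p < ?w}"
        have lz: "ln ?z = ln x / s" and lw: "ln ?w = ln x / real k" using x by (simp_all add: ln_powr)
        have lnz: "ln 2 \<le> ln ?z"
        proof -
          have "s * ln 2 \<le> L" unfolding L_def using sk by (intro mult_right_mono) auto
          then have "s * ln 2 \<le> ln x" using False by linarith
          then show ?thesis unfolding lz using s by (simp add: field_simps)
        qed
        have z2: "?z \<ge> 2" using lnz x by (subst (asm) ln_le_cancel_iff) auto
        have zw: "?z \<le> ?w" using x sk kr by (intro powr_mono) (auto simp: frac_le)
        have ww: "?w * ?w \<le> x"
        proof -
          have "?w * ?w = x powr (2/real k)" using x by (simp flip: powr_add)
          also have "\<dots> \<le> x powr 1" using x kr by (intro powr_mono) auto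
          finally show ?thesis using x by simp
        qed
        have w2: "?w \<ge> 2" using z2 zw by linarith
        have finP: "finite ?P" by (rule finite_subset[OF _ finite_nat_le[of ?w]]) auto
        have pP: "real p \<ge> 2" "ln (real p) > 0" "real k < ?u p" "?u p \<le> s" "x / real p \<ge> 2"
          "(x / real p) powr (1 / (?u p - 1)) = real p" "ln (x / real p) = ln x * (?u p - 1) / ?u p" "ln x / 2 \<le> ln (x / real p)"
          if p: "p \<in> ?P" for p
        proof -
          show p2: "real p \<ge> 2" using p z2 by auto
          then show lp: "ln (real p) > 0" by simp
          have "ln (real p) < ln ?w" using p p2 w2 by (subst ln_less_cancel_iff) auto
          then show u1: "real k < ?u p" unfolding lw using lp kr by (simp add: field_simps)
          have "ln ?z \<le> ln (real p)" using p p2 z2 by (subst ln_le_cancel_iff) auto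
          then show "?u p \<le> s" unfolding lz using lp s by (simp add: field_simps)
          have "real p * 2 \<le> ?w * ?w" using p w2 by (intro mult_mono) auto
          then have "2 * real p \<le> x" using ww by linarith
          then show "x / real p \<ge> 2" using p2 by (simp add: field_simps)
          have l1: "ln (x / real p) = ln x - ln (real p)" using x p2 by (simp add: ln_div)
          show l2: "ln (x / real p) = ln x * (?u p - 1) / ?u p" unfolding l1 using lx lp by (simp add: field_simps)
          show "ln x / 2 \<le> ln (x / real p)"
          proof -
            have "2 < ?u p" using u1 kr by linarith
            then have "2 * ln (real p) < ln x" using lp by (simp add: field_simps)
            then show ?thesis unfolding l1 by linarith
          qed
          have "(1 / (?u p - 1)) * ln (x / real p) = ln (real p)"
          proof -
            have u2: "?u p - 1 \<noteq> 0" "?u p \<noteq> 0" using u1 kr by linarith+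
            have "(1 / (?u p - 1)) * (ln x * (?u p - 1) / ?u p) = ln x / ?u p" 
            proof -
              have "(1 / (t - 1)) * (r * (t - 1) / t) = r / t" if "t - 1 \<noteq> 0" for r t :: real
                using that by simp
              from this[OF u2(1)] show ?thesis .
            qed
            also have "\<dots> = ln (real p)" using lx lp by simp
            finally show ?thesis unfolding l2 .
          qed
          then show "(x / real p) powr (1 / (?u p - 1)) = real p"
            using x p2 by (simp add: powr_def)
        qed
        \<comment> \<open>The hypothesis at \<open>x / p\<close> with exponent
          \<open>?u p - 1\<close>, whose level is \<open>p\<close> itself. The factors 4 and 2 come
          from \<open>ln (x / p) \<ge> ln x / 2\<close>.\<close>
        have each: "\<bar>sifted_sum \<epsilon> (x / real p) (real p) - \<epsilon> * (x / ln x) * ((1 / real p) * delay_phi \<epsilon> (?u p))\<bar>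
            \<le> C * (4 * q * (1 / real p) + 2 / ln x * real p)" if p: "p \<in> ?P" for p
        proof -
          note pp = pP[OF p]
          have u1: "1 < ?u p - 1" "?u p - 1 \<le> real k" using pp kr sk by auto
          have "\<bar>sifted_sum \<epsilon> (x / real p) (real p) - \<epsilon> * ((x / real p) / ln (x / real p)) * delayQ \<epsilon> (?u p - 1)\<bar>
             \<le> C * ((x / real p) / ln (x / real p) ^ 2 + real p / ln (x / real p))"
            using IH[OF pp(5) u1] unfolding pp(6) .
          moreover have "\<epsilon> * ((x / real p) / ln (x / real p)) * delayQ \<epsilon> (?u p - 1) = \<epsilon> * (x / ln x) * ((1 / real p) * delay_phi \<epsilon> (?u p))"
            unfolding delay_phi_def pp(7) by (simp add: mult_ac)
          moreover define l where "l = ln (x / real p)"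
          moreover have l: "ln x / 2 \<le> l" "l > 0" using pp(8) lx unfolding l_def by linarith+
          moreover have "(x / real p) / l ^ 2 \<le> (x / real p) / (ln x / 2) ^ 2"
            using l lx x pp(1) by (intro divide_left_mono power_mono mult_pos_pos zero_less_power divide_nonneg_nonneg) linarith+
          then have "(x / real p) / l ^ 2 \<le> 4 * q * (1 / real p)" by (simp add: q_def power_divide mult_ac)
          moreover have "real p / l \<le> real p / (ln x / 2)"
            using l lx pp(1) by (intro divide_left_mono mult_pos_pos) linarith+
          then have "real p / l \<le> 2 / ln x * real p" by (simp add: mult_ac)
          ultimately have "\<bar>sifted_sum \<epsilon> (x / real p) (real p) - \<epsilon> * (x / ln x) * ((1 / real p) * delay_phi \<epsilon> (?u p))\<bar> \<le> C * ((x / real p) / l ^ 2 + real p / l)"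
            and le: "(x / real p) / l ^ 2 + real p / l \<le> 4 * q * (1 / real p) + 2 / ln x * real p"
            by (simp_all only: add_mono)
          from this(1) show ?thesis by (rule order_trans) (intro mult_left_mono le C(1))
        qed
        have s1: "(\<Sum>p\<in>?P. 1 / real p) \<le> A1"
        proof -
          have "\<bar>(\<Sum>p\<in>?P. 1 / real p) - (ln (ln ?w) - ln (ln ?z))\<bar> \<le> CM / ln ?z"
            by (rule CM(2)[OF z2 zw]) auto
          moreover have "ln (ln ?w) - ln (ln ?z) = ln s - ln (real k)" unfolding lw lz using lx s kr by (simp add: ln_div)
          moreover have "ln s - ln (real k) \<le> 1"
          proof -
            have "ln s - ln (real k) \<le> (s - real k) / real k" using sk kr by (intro ln_diff_bounds) auto
            also have "\<dots> \<le> 1" using sk kr by simp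
            finally show ?thesis .
          qed
          moreover have "CM / ln ?z \<le> CM / ln 2"
          proof -
            have "0 < ln (2::real)" by simp
            then show ?thesis using lnz CM(1) by (intro divide_left_mono mult_pos_pos) linarith+
          qed
          ultimately show ?thesis unfolding A1_def by linarith
        qed
        have s2: "(\<Sum>p\<in>?P. real p) \<le> D * real k * (x / ln x)"
        proof -
          have "(\<Sum>p\<in>?P. real p) \<le> (\<Sum>p\<in>?P. ?w)" by (intro sum_mono) auto
          also have "\<dots> = real (card ?P) * ?w" by simp
          also have "card ?P \<le> prime_pi ?w"
            unfolding prime_pi_def by (intro card_mono finite_subset[OF _ finite_nat_le[of ?w]]) auto
          then have "real (card ?P) * ?w \<le> real (prime_pi ?w) * ?w" using w2 by (intro mult_right_mono) auto
          also have "\<dots> \<le> (D * (?w / ln ?w)) * ?w" using D(2)[of ?w] w2 by (intro mult_right_mono) auto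
          also have "\<dots> = (D * real k / ln x) * (?w * ?w)" unfolding lw using kr by simp
          also have "\<dots> \<le> (D * real k / ln x) * x" using D(1) lx by (intro mult_left_mono ww) auto
          finally show ?thesis by simp
        qed
        let ?ST = "\<Sum>p\<in>?P. sifted_sum \<epsilon> (x / real p) (real p)"
        let ?SF = "\<Sum>p\<in>?P. (1 / real p) * delay_phi \<epsilon> (?u p)"
        let ?I = "integral {real k..s} (\<lambda>v. delay_phi \<epsilon> v / v)"
        have e1: "\<bar>?ST - \<epsilon> * (x / ln x) * ?SF\<bar> \<le> C * (4 * A1 + 2 * D * real k) * q"
        proof -
          have "\<bar>?ST - \<epsilon> * (x / ln x) * ?SF\<bar> = \<bar>\<Sum>p\<in>?P. (sifted_sum \<epsilon> (x / real p) (real p) - \<epsilon> * (x / ln x) * ((1 / real p) * delay_phi \<epsilon> (?u p)))\<bar>"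
            by (simp only: sum_subtractf sum_distrib_left)
          also have "\<dots> \<le> (\<Sum>p\<in>?P. C * (4 * q * (1 / real p) + 2 / ln x * real p))"
            by (rule order_trans[OF sum_abs sum_mono[OF each]])
          also have "\<dots> = C * (4 * q * (\<Sum>p\<in>?P. 1 / real p) + 2 / ln x * (\<Sum>p\<in>?P. real p))"
            by (simp only: sum_distrib_left[symmetric] sum.distrib)
          also have "\<dots> \<le> C * (4 * q * A1 + 2 / ln x * (D * real k * (x / ln x)))"
            using C(1) q0 lx s1 s2 by (intro mult_left_mono add_mono) auto
          also have "2 / ln x * (D * real k * (x / ln x)) = 2 * D * real k * q" by (simp add: q_def power2_eq_square)
          finally show ?thesis by (simp add: algebra_simps)
        qed
        have e2: "\<bar>?SF - ?I\<bar> \<le> (\<bar>delay_phi \<epsilon> (real k)\<bar> + B) * (CM * (real k + 1)) / ln x"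
        proof -
          have "\<bar>?SF - ?I\<bar> \<le> (\<bar>delay_phi \<epsilon> (real k)\<bar> + B * (s - real k)) * (CM * s / ln x)"
          proof (rule prime_sum_smooth[OF CM])
            fix v assume v: "v \<in> {real k..s}"
            show "(delay_phi \<epsilon> has_real_derivative \<phi>' v) (at v within {real k..s})"
              by (rule DERIV_subset[OF \<phi>(1)]) (use v sk in auto)
            show "\<bar>\<phi>' v\<bar> \<le> B" using v sk by (intro \<phi>(2)) auto
          qed (use kr sk z2 x in auto)
          also have "\<dots> \<le> (\<bar>delay_phi \<epsilon> (real k)\<bar> + B * 1) * (CM * (real k + 1) / ln x)"
            using B0 sk s CM(1) lx by (intro mult_mono add_left_mono mult_left_mono divide_right_mono) auto
          finally show ?thesis by simp
        qed
        have "\<bar>(x / ln x) * (?SF - ?I)\<bar> = (x / ln x) * \<bar>?SF - ?I\<bar>" using x lx by (simp add: abs_mult)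
        also have "\<dots> \<le> (x / ln x) * ((\<bar>delay_phi \<epsilon> (real k)\<bar> + B) * (CM * (real k + 1)) / ln x)"
          using e2 x lx by (intro mult_left_mono) auto
        also have "\<dots> = (\<bar>delay_phi \<epsilon> (real k)\<bar> + B) * (CM * (real k + 1)) * q" by (simp add: q_def power2_eq_square)
        finally have e2': "\<bar>(x / ln x) * (?SF - ?I)\<bar> \<le> (\<bar>delay_phi \<epsilon> (real k)\<bar> + B) * (CM * (real k + 1)) * q" .
        have e3: "\<bar>sifted_sum \<epsilon> x ?w - \<epsilon> * (x / ln x) * delayQ \<epsilon> (real k)\<bar> \<le> 3 * C * q"
        proof -
          have "?w / ln x \<le> 2 * q" unfolding q_def using w2 by (intro w_ln_bound[OF x _ ww]) auto
          then have "C * (q + ?w / ln x) \<le> C * (3 * q)" using C(1) by (intro mult_left_mono) auto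
          then show ?thesis using IH[OF x, of "real k"] kr unfolding q_def by simp
        qed
        \<comment> \<open>One sign \<open>\<epsilon>\<close> comes from Buchstab's identity and one
          from the main term at \<open>x / p\<close>; as \<open>\<epsilon> * \<epsilon> = 1\<close>
          their product disappears, and the last summand carries no sign.\<close>
        have eq3: "sifted_sum \<epsilon> x ?z - \<epsilon> * (x / ln x) * delayQ \<epsilon> s = (sifted_sum \<epsilon> x ?w - \<epsilon> * (x / ln x) * delayQ \<epsilon> (real k))
            + \<epsilon> * (?ST - \<epsilon> * (x / ln x) * ?SF) + (x / ln x) * (?SF - ?I)"
        proof -
          have 1: "sifted_sum \<epsilon> x ?z = sifted_sum \<epsilon> x ?w + \<epsilon> * ?ST" by (rule buchstab[OF zw])
          have 2: "delayQ \<epsilon> s = delayQ \<epsilon> (real k) + \<epsilon> * ?I" using sk kr by (intro delayQ_step) auto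
          have alg: "(a + \<epsilon> * b) - \<epsilon> * y * (c + \<epsilon> * d) = (a - \<epsilon> * y * c) + \<epsilon> * (b - \<epsilon> * y * e) + y * (e - d)" for a b c d e y
          proof -
            have "((a + \<epsilon> * b) - \<epsilon> * y * (c + \<epsilon> * d)) - ((a - \<epsilon> * y * c) + \<epsilon> * (b - \<epsilon> * y * e) + y * (e - d)) = (\<epsilon> * \<epsilon> - 1) * (y * e - y * d)"
              by (simp add: algebra_simps)
            then show ?thesis unfolding ee by simp
          qed
          show ?thesis unfolding 1 2 by (rule alg)
        qed
        have e1': "\<bar>\<epsilon> * (?ST - \<epsilon> * (x / ln x) * ?SF)\<bar> \<le> C * (4 * A1 + 2 * D * real k) * q"
          using e1 unfolding abs_mult[of \<epsilon>] \<epsilon> mult_1 .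
        have "\<bar>sifted_sum \<epsilon> x ?z - \<epsilon> * (x / ln x) * delayQ \<epsilon> s\<bar> \<le> C2 * q"
          by (rule abs_sum3_le[OF eq3 e3 e1' e2']) (simp only: C2_def distrib_right)
        then show ?thesis by (rule fin') (use C10 C20 C(1) in auto)
      qed
    qed
  qed
  moreover have "C + C1 + C2 \<ge> 0" using C(1) C10 C20 by simp
  ultimately show ?thesis unfolding sifted_asymp_def by blast
qed

lemma sifted_asymp_all:
  assumes "\<bar>\<epsilon>\<bar> = 1" "k \<ge> 2" shows "\<exists>C\<ge>0. sifted_asymp \<epsilon> k C"
  using assms(2)
proof (induction k rule: dec_induct)
  case base
  show ?case by (rule sifted_asymp_base[OF assms(1)])
next
  case (step k)
  then show ?case using sifted_asymp_step[OF assms(1)] by blast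
qed

section \<open>The two counting functions\<close>

lemma half_diff_le:
  fixes a b R :: real
  assumes "\<bar>a\<bar> + \<bar>b\<bar> \<le> R"
  shows "\<bar>a - b\<bar> / 2 \<le> R" "\<bar>a + b\<bar> / 2 \<le> R"
proof -
  have "\<bar>a - b\<bar> \<le> R" "\<bar>a + b\<bar> \<le> R" "0 \<le> R"
    using assms abs_triangle_ineq4[of a b] abs_triangle_ineq[of a b] abs_ge_zero[of a] abs_ge_zero[of b] by linarith+
  then show "\<bar>a - b\<bar> / 2 \<le> R" "\<bar>a + b\<bar> / 2 \<le> R" by simp_all
qed

lemma liouville_Omega: "liouville n = (-1) ^ Omega n"
  by (simp add: liouville_def Omega_def)

lemma S_plus_sifted_sum: "real (S_plus x s) = (sifted_sum 1 x (x powr (1/s)) - sifted_sum (-1) x (x powr (1/s))) / 2"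
  and S_minus_sifted_sum: "real (S_minus x s) = (sifted_sum 1 x (x powr (1/s)) + sifted_sum (-1) x (x powr (1/s))) / 2"
proof -
  let ?A = "sifted x (x powr (1/s))"
  have lm: "liouville n = -1 \<longleftrightarrow> odd (Omega n)" "liouville n = 1 \<longleftrightarrow> even (Omega n)" for n
    by (cases "even (Omega n)"; simp add: liouville_Omega)+
  have "{n::nat. 1 \<le> n \<and> real n \<le> x \<and> liouville n = -1 \<and> (\<forall>p. prime p \<and> p dvd n \<longrightarrow> real p \<ge> x powr (1/s))} = {n\<in>?A. odd (Omega n)}"
    unfolding sifted_def lm by auto
  then have "real (S_plus x s) = (\<Sum>n\<in>{n\<in>?A. odd (Omega n)}. 1)" unfolding S_plus_def by simp
  also have "\<dots> = (\<Sum>n\<in>?A. if odd (Omega n) then 1 else 0)" by (rule sum.inter_filter[OF finite_sifted])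
  also have "\<dots> = (\<Sum>n\<in>?A. (1 ^ Omega n - (-1) ^ Omega n) / 2)" by (intro sum.cong) auto
  also have "\<dots> = (sifted_sum 1 x (x powr (1/s)) - sifted_sum (-1) x (x powr (1/s))) / 2"
    unfolding sifted_sum_def sum_divide_distrib[symmetric] sum_subtractf ..
  finally show "real (S_plus x s) = (sifted_sum 1 x (x powr (1/s)) - sifted_sum (-1) x (x powr (1/s))) / 2" .
  have "{n::nat. 1 \<le> n \<and> real n \<le> x \<and> liouville n = 1 \<and> (\<forall>p. prime p \<and> p dvd n \<longrightarrow> real p \<ge> x powr (1/s))} = {n\<in>?A. even (Omega n)}"
    unfolding sifted_def lm by auto
  then have "real (S_minus x s) = (\<Sum>n\<in>{n\<in>?A. even (Omega n)}. 1)" unfolding S_minus_def by simp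
  also have "\<dots> = (\<Sum>n\<in>?A. if even (Omega n) then 1 else 0)" by (rule sum.inter_filter[OF finite_sifted])
  also have "\<dots> = (\<Sum>n\<in>?A. (1 ^ Omega n + (-1) ^ Omega n) / 2)" by (intro sum.cong) auto
  also have "\<dots> = (sifted_sum 1 x (x powr (1/s)) + sifted_sum (-1) x (x powr (1/s))) / 2"
    unfolding sifted_sum_def sum_divide_distrib[symmetric] sum.distrib ..
  finally show "real (S_minus x s) = (sifted_sum 1 x (x powr (1/s)) + sifted_sum (-1) x (x powr (1/s))) / 2" .
qed

text \<open>Primes have the wrong parity, so only \<open>n = 1\<close> and \<open>n = x\<close> can
  be counted, while \<open>f\<close> vanishes for \<open>s \<le> 2\<close>. This covers
  \<open>s = 1\<close> and avoids the error \<open>x powr (1/s) / ln x\<close>, which is too large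
  near it.\<close>

lemma S_minus_small:
  assumes x: "x \<ge> 1" and s: "1 \<le> s" "s \<le> 2"
  shows "S_minus x s \<le> 2"
proof -
  let ?z = "x powr (1/s)"
  have "?z * ?z = x powr (2/s)" using x by (simp flip: powr_add)
  also have "\<dots> \<ge> x powr 1" using x s by (intro powr_mono) auto
  finally have zz: "x \<le> ?z * ?z" using x by simp
  have "{n::nat. 1 \<le> n \<and> real n \<le> x \<and> liouville n = 1 \<and> (\<forall>p. prime p \<and> p dvd n \<longrightarrow> real p \<ge> ?z)} \<subseteq> {1, nat \<lfloor>x\<rfloor>}"
  proof
    fix n :: nat assume n: "n \<in> {n. 1 \<le> n \<and> real n \<le> x \<and> liouville n = 1 \<and> (\<forall>p. prime p \<and> p dvd n \<longrightarrow> real p \<ge> ?z)}"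
    have np: "\<not> prime n" using n by (auto simp: liouville_def prime_factorization_prime)
    have "n \<in> sifted x ?z" using n by (auto simp: sifted_def)
    then have "n = 1 \<or> real n = x" using two_prime_factors[of n x ?z] np zz by auto
    then show "n \<in> {1, nat \<lfloor>x\<rfloor>}" by auto
  qed
  from card_mono[OF _ this] have "S_minus x s \<le> card {1, nat \<lfloor>x\<rfloor>}" unfolding S_minus_def by simp
  also have "\<dots> \<le> 2" by (cases "nat \<lfloor>x\<rfloor> = 1") auto
  finally show ?thesis .
qed

theorem theorem4p1:
  fixes N :: nat
  shows "\<exists>C::real. \<forall>x::real. x \<ge> 2 \<longrightarrow>
     (\<forall>s::real. 1 < s \<and> s \<le> real N \<longrightarrow>
        \<bar>real (S_plus x s) - (x / 2) / (exp euler_mascheroni * ln (x powr (1/s))) * sieve_F s\<bar>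
          \<le> C * x / ((s - 1) * (ln x)^2)) \<and>
     (\<forall>s::real. 1 \<le> s \<and> s \<le> real N \<longrightarrow>
        \<bar>real (S_minus x s) - (x / 2) / (exp euler_mascheroni * ln (x powr (1/s))) * sieve_f s\<bar>
          \<le> C * x / (ln x)^2)"
proof -
  define K where "K = max 2 N"
  obtain Cp where Cp: "Cp \<ge> 0" "sifted_asymp 1 K Cp" using sifted_asymp_all[of 1 K] by (auto simp: K_def)
  obtain Cm where Cm: "Cm \<ge> 0" "sifted_asymp (-1) K Cm" using sifted_asymp_all[of "-1" K] by (auto simp: K_def)
  define C0 where "C0 = Cp + Cm"
  have C0: "C0 \<ge> 0" using Cp Cm by (simp add: C0_def)
  \<comment> \<open>The summands serve \<open>S_plus\<close>, \<open>S_minus\<close> for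
    \<open>s > 2\<close>, and \<open>S_minus\<close> for \<open>s \<le> 2\<close>, in this
    order.\<close>
  define C where "C = 2 * C0 * real K + 3 * C0 + 8"
  have K2: "real K \<ge> 2" "real N \<le> real K" by (auto simp: K_def)
  \<comment> \<open>Here \<open>exp euler_mascheroni\<close> cancels, and
    \<open>ln (x powr (1/s)) = ln x / s\<close> cancels the division by \<open>s\<close> in
    \<open>sieve_F\<close> and \<open>sieve_f\<close>.\<close>
  have main: "(x / 2) / (exp euler_mascheroni * ln (x powr (1/s))) * (exp euler_mascheroni * y / s) = (x / ln x) * y / 2"
    if "x \<ge> 2" "s > 0" for x s y :: real
    using that by (simp add: ln_powr)
  have cl: "\<bar>sifted_sum 1 x (x powr (1/s)) - (x / ln x) * delayQ 1 s\<bar> + \<bar>sifted_sum (-1) x (x powr (1/s)) + (x / ln x) * delayQ (-1) s\<bar>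
     \<le> C0 * (x / ln x ^ 2 + x powr (1/s) / ln x)" if "x \<ge> 2" "1 < s" "s \<le> real N" for x s
  proof -
    have "s \<le> real K" using that K2 by linarith
    then have "\<bar>sifted_sum 1 x (x powr (1/s)) - 1 * (x / ln x) * delayQ 1 s\<bar> \<le> Cp * (x / ln x ^ 2 + x powr (1/s) / ln x)"
      "\<bar>sifted_sum (-1) x (x powr (1/s)) - (-1) * (x / ln x) * delayQ (-1) s\<bar> \<le> Cm * (x / ln x ^ 2 + x powr (1/s) / ln x)"
      using Cp(2) Cm(2) that unfolding sifted_asymp_def by blast+
    then show ?thesis by (simp add: C0_def distrib_right)
  qed
  show ?thesis
  proof (intro exI[of _ C] allI impI conjI)
    fix x s :: real assume x: "2 \<le> x" and s: "1 < s \<and> s \<le> real N"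
    let ?z = "x powr (1/s)"
    define q where "q = x / ln x ^ 2"
    define T1 where "T1 = sifted_sum 1 x ?z"
    define T2 where "T2 = sifted_sum (-1) x ?z"
    define y where "y = x / ln x"
    have lx: "ln x > 0" using x by simp
    have q0: "q > 0" using x lx by (simp add: q_def)
    have m: "(x / 2) / (exp euler_mascheroni * ln ?z) * sieve_F s = y * (delayQ 1 s + delayQ (-1) s) / 2"
      using s main[OF x, of s] by (simp add: sieve_F_eq y_def)
    have "\<bar>real (S_plus x s) - (x / 2) / (exp euler_mascheroni * ln ?z) * sieve_F s\<bar>
      = \<bar>(T1 - y * delayQ 1 s) - (T2 + y * delayQ (-1) s)\<bar> / 2"
      unfolding m S_plus_sifted_sum T1_def[symmetric] T2_def[symmetric] by (simp add: algebra_simps flip: diff_divide_distrib add_divide_distrib)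
    also have "\<dots> \<le> C0 * (q + ?z / ln x)"
      unfolding T1_def T2_def y_def q_def by (rule half_diff_le(1)[OF cl[OF x conjunct1[OF s] conjunct2[OF s]]])
    also have "\<dots> \<le> C0 * (2 * real K * (q / (s - 1)))"
    proof (intro mult_left_mono C0)
      have sK: "s \<le> real K" using s K2 by linarith
      have "q * (s - 1) \<le> q * real K" using q0 sK by (intro mult_left_mono) auto
      then have a: "q \<le> real K * (q / (s - 1))" using s by (simp add: field_simps)
      \<comment> \<open>The source of the factor \<open>1 / (s - 1)\<close>: the level is
        \<open>x * exp (- t)\<close>, and \<open>t * exp (- t) \<le> 1\<close> bounds it by
        \<open>x / t\<close>, where \<open>s * t = (s - 1) * ln x\<close>.\<close>
      define t where "t = (1 - 1/s) * ln x"
      have "t \<le> exp t" using exp_ge_add_one_self[of t] by linarith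
      then have te: "t * exp (- t) \<le> 1" by (simp add: exp_minus field_simps)
      have zt: "?z = x * exp (- t)"
      proof -
        have "exp (- t) = exp (ln x / s - ln x)" by (simp add: t_def algebra_simps)
        also have "\<dots> = exp (ln x / s) / x" using x by (simp add: exp_diff)
        finally show ?thesis using x by (simp add: powr_def)
      qed
      have "(s - 1) * ln x = s * t" using s by (simp add: t_def field_simps)
      then have "?z * ((s - 1) * ln x) = (x * s) * (t * exp (- t))" unfolding zt by simp
      also have "\<dots> \<le> (x * s) * 1" using te x s by (intro mult_left_mono) auto
      also have "\<dots> \<le> x * real K" using x sK by (simp add: mult_left_mono)
      finally have zK: "?z * ((s - 1) * ln x) \<le> x * real K" .
      have "?z / ln x = (?z * ((s - 1) * ln x)) / ((s - 1) * ln x ^ 2)" using s lx by (simp add: power2_eq_square)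
      also have "\<dots> \<le> (x * real K) / ((s - 1) * ln x ^ 2)" using s by (intro divide_right_mono zK) auto
      also have "\<dots> = real K * (q / (s - 1))" by (simp add: q_def mult.commute)
      finally have "?z / ln x \<le> real K * (q / (s - 1))" .
      then show "q + ?z / ln x \<le> 2 * real K * (q / (s - 1))"
        unfolding mult_2 distrib_right by (rule add_mono[OF a])
    qed
    also have "\<dots> = (2 * C0 * real K) * (q / (s - 1))" by simp
    also have "\<dots> \<le> C * (q / (s - 1))"
      using s q0 C0 by (intro mult_right_mono) (auto simp: C_def)
    also have "\<dots> = C * x / ((s - 1) * (ln x)^2)" by (simp add: q_def mult.commute)
    finally show "\<bar>real (S_plus x s) - (x / 2) / (exp euler_mascheroni * ln ?z) * sieve_F s\<bar> \<le> C * x / ((s - 1) * (ln x)^2)" .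
  next
    fix x s :: real assume x: "2 \<le> x" and s: "1 \<le> s \<and> s \<le> real N"
    let ?z = "x powr (1/s)"
    define q where "q = x / ln x ^ 2"
    have lx: "ln x > 0" using x by simp
    have q0: "q > 0" using x lx by (simp add: q_def)
    have m: "(x / 2) / (exp euler_mascheroni * ln ?z) * sieve_f s = x / ln x * (delayQ 1 s - delayQ (-1) s) / 2"
      using s main[OF x, of s] by (simp add: sieve_f_eq)
    have Cq: "c * q \<le> C * x / (ln x)^2" if "c \<le> C" for c
    proof -
      have "c * q \<le> C * q" using that q0 by (intro mult_right_mono) auto
      then show ?thesis by (simp add: q_def)
    qed
    show "\<bar>real (S_minus x s) - (x / 2) / (exp euler_mascheroni * ln ?z) * sieve_f s\<bar> \<le> C * x / (ln x)^2"
    proof (cases "s \<le> 2")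
      case True
      have "real (S_minus x s) \<le> 2" using S_minus_small[of x s] x s True by simp
      moreover have "2 \<le> 8 * q" using x_ln2_lower[OF x] by (simp add: q_def)
      moreover have "8 * q \<le> C * x / (ln x)^2" by (rule Cq) (use C0 K2 in \<open>simp add: C_def\<close>)
      ultimately show ?thesis unfolding m using True by (simp add: delayQ_one)
    next
      case False
      define T1 where "T1 = sifted_sum 1 x ?z"
      define T2 where "T2 = sifted_sum (-1) x ?z"
      define y where "y = x / ln x"
      have s1: "1 < s" "s \<le> real N" using s False by auto
      have "\<bar>real (S_minus x s) - (x / 2) / (exp euler_mascheroni * ln ?z) * sieve_f s\<bar>
        = \<bar>(T1 - y * delayQ 1 s) + (T2 + y * delayQ (-1) s)\<bar> / 2"
        unfolding m S_minus_sifted_sum T1_def[symmetric] T2_def[symmetric] y_def[symmetric]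
        by (simp add: algebra_simps flip: diff_divide_distrib add_divide_distrib)
      also have "\<dots> \<le> C0 * (q + ?z / ln x)"
        unfolding T1_def T2_def y_def q_def by (rule half_diff_le(2)[OF cl[OF x s1]])
      also have "\<dots> \<le> C0 * (3 * q)"
      proof (intro mult_left_mono C0)
        have "?z * ?z = x powr (2/s)" using x by (simp flip: powr_add)
        also have "\<dots> \<le> x powr 1" using x False by (intro powr_mono) auto
        finally have "?z * ?z \<le> x" using x by simp
        then have "?z / ln x \<le> 2 * q" unfolding q_def by (intro w_ln_bound[OF x]) auto
        then show "q + ?z / ln x \<le> 3 * q" by linarith
      qed
      also have "\<dots> = (3 * C0) * q" by simp
      also have "\<dots> \<le> C * x / (ln x)^2" by (rule Cq) (use C0 K2 in \<open>simp add: C_def\<close>)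
      finally show ?thesis .
    qed
  qed
qed

end
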